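(* For all $\alpha\in(0,1)$, $m,m'\in\mathbb{N}$ and $\varepsilon>0$ there is $\zeta>0$ such that the following holds. Suppose $\mathcal{U}_{\vec{k}}\subseteq[m]^n$ and $\mathcal{U}_{\vec{k}'}\subseteq[m']^n$ are $\alpha$-balanced multi-slices, and $\mu$ is a connected, $\alpha$-admissible distribution over $\mathcal{U}_{\vec{k}}\times\mathcal{U}_{\vec{k}'}$. Suppose $\mathcal{C}$ is an $(\alpha,\zeta)$-coupling between $(\mathcal{U}_{\vec{k}},\mathrm{Uniform})$ and $([m]^n,\nu_{\vec{k}}^{\otimes n})$, $\mathcal{C}'$ is an $(\alpha,\zeta)$-coupling between $(\mathcal{U}_{\vec{k}'},\mathrm{Uniform})$ and $([m']^n,\nu_{\vec{k}'}^{\otimes n})$, and that there is an $(\alpha,\zeta)$-coupling $\mathcal{C}''$ between $\mu$ and its product version $\tilde\mu$. Then for all $f\colon\mathcal{U}_{\vec{k}}\to\mathbb{R}$ and $g\colon\mathcal{U}_{\vec{k}'}\to\mathbb{R}$, \[ \Big|\mathbb{E}_{({\bf x},{\bf x}')\sim\mu}[f({\bf x})g({\bf x}')]-\mathbb{E}_{({\bf y},{\bf y}')\sim\tilde\mu}[\mathrm{T}_{\mathcal{C}}f({\bf y})\,\mathrm{T}_{\mathcal{C}'}g({\bf y}')]\Big|\le\varepsilon\|f\|_2\|g\|_2. \]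
   Context: For $\vec{k}=(k_1,\dots,k_m)$ nonnegative integers summing to $n$, $\mathcal{U}_{\vec{k}}\subseteq[m]^n$ is the set of vectors in which each symbol $j$ appears exactly $k_j$ times; it is $\alpha$-balanced if $k_j\ge\alpha n$ for all $j$; $\nu_{\vec{k}}(j)=k_j/n$. Norms are expectation norms w.r.t. the uniform measure on the multi-slice. For $\pi\in S_n$, $({}^{\pi}x)_i=x_{\pi(i)}$; a distribution on tuples of length-$n$ vectors is symmetric if applying the same $\pi$ to all components preserves it; pairs $(x,x')$ are identified with vectors in $([m]\times[m'])^n$. For symmetric distributions $\nu_1,\nu_2$ on $\Sigma^n$, an $(\alpha,\zeta)$-coupling is a jointly distributed $({\bf x},{\bf y})$ with marginals $\nu_1,\nu_2$, symmetric under $S_n$, with $\Pr[{\bf x}_i\ne{\bf y}_i]\le\zeta$ for all $i$, and $\Pr[|\{i:{\bf x}_i\ne{\bf y}_i\}|\ge\varepsilon n]\le\frac1\alpha e^{-\alpha\varepsilon^2n}$ for all $\varepsilon>0$. $\mathrm{T}_{\mathcal{C}}f(y)=\mathbb{E}_{({\bf x},{\bf y})\sim\mathcal{C}}[f({\bf x})\mid{\bf y}=y]$. For $\mu$ on pairs and $\vec a=(a_1,a_2)$, $\mu_{\vec a}=\Pr_{({\bf x},{\bf x}')\sim\mu,i\in_R[n]}[{\bf x}_i=a_1,{\bf x}'_i=a_2]$; $\mu$ is $\alpha$-admissible if symmetric under $S_n$ and each $\mu_{\vec a}$ is $0$ or $\ge\alpha$. $\mu$ is connected if for each of the two components, the bipartite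 graph between the support of that component's marginal and the support of the other component's marginal, with an edge whenever the pair lies in the support of $\mu$, is connected. The product version is $\tilde\mu=\prod_{i=1}^n\tilde\mu_i$ with $\tilde\mu_i(a_1,a_2)=\Pr_\mu[{\bf x}_i=a_1,{\bf x}'_i=a_2]$. *)

theory Defs
  imports "HOL-Probability.Probability" "HOL-Combinatorics.Permutations"
begin

text \<open>
  A vector in \<open>\<Sigma>\<^sup>n\<close> is a function in \<open>{1..n} \<rightarrow>\<^sub>E \<Sigma>\<close>, i.e. it takes the value \<^const>\<open>undefined\<close>
  outside \<open>{1..n}\<close>. For \<open>\<pi>\<close> permuting \<open>{1..n}\<close>, the permuted vector is \<open>x \<circ> \<pi>\<close>.
  The alphabet \<open>[m]\<close> is \<open>{1..m}\<close>, and only the values of \<open>k\<close> on \<open>{1..m}\<close> matter.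
\<close>

definition multislice :: "nat \<Rightarrow> nat \<Rightarrow> (nat \<Rightarrow> nat) \<Rightarrow> (nat \<Rightarrow> nat) set" where
  "multislice n m k =
     {x \<in> {1..n} \<rightarrow>\<^sub>E {1..m}. \<forall>j\<in>{1..m}. card {i \<in> {1..n}. x i = j} = k j}"

definition balanced :: "real \<Rightarrow> nat \<Rightarrow> nat \<Rightarrow> (nat \<Rightarrow> nat) \<Rightarrow> bool" where
  "balanced \<alpha> n m k \<longleftrightarrow> (\<forall>j\<in>{1..m}. real (k j) \<ge> \<alpha> * real n)"

definition freq_pmf :: "nat \<Rightarrow> nat \<Rightarrow> (nat \<Rightarrow> nat) \<Rightarrow> nat pmf" where
  "freq_pmf n m k = embed_pmf (\<lambda>j. if j \<in> {1..m} then real (k j) / real n else 0)"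

lemma pmf_freq_pmf:
  assumes "n \<ge> 1" and "(\<Sum>j=1..m. k j) = n"
  shows "pmf (freq_pmf n m k) j = (if j \<in> {1..m} then real (k j) / real n else 0)"
  unfolding freq_pmf_def
proof (rule pmf_embed_pmf)
  let ?p = "\<lambda>j. if j \<in> {1..m} then real (k j) / real n else 0"
  have "(\<integral>\<^sup>+ j. ennreal (?p j) \<partial>count_space UNIV) = (\<Sum>j\<in>{1..m}. ennreal (?p j))"
    by (rule nn_integral_count_space') auto
  also have "\<dots> = ennreal (\<Sum>j\<in>{1..m}. ?p j)"
    by (rule sum_ennreal) simp
  also have "(\<Sum>j\<in>{1..m}. ?p j) = real (\<Sum>j=1..m. k j) / real n"
    by (simp add: sum_divide_distrib)
  also have "\<dots> = 1"
    using assms by simp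
  finally show "(\<integral>\<^sup>+ j. ennreal (?p j) \<partial>count_space UNIV) = 1"
    by simp
qed simp

definition norm2 :: "'a set \<Rightarrow> ('a \<Rightarrow> real) \<Rightarrow> real" where
  "norm2 U f = sqrt (measure_pmf.expectation (pmf_of_set U) (\<lambda>x. \<bar>f x\<bar> ^ 2))"

definition symmetric :: "nat \<Rightarrow> ((nat \<Rightarrow> 'a) \<times> (nat \<Rightarrow> 'b)) pmf \<Rightarrow> bool" where
  "symmetric n \<mu> \<longleftrightarrow> (\<forall>\<pi>. \<pi> permutes {1..n} \<longrightarrow> map_pmf (\<lambda>(x, x'). (x \<circ> \<pi>, x' \<circ> \<pi>)) \<mu> = \<mu>)"

text \<open>Symmetry of \<open>\<nu>\<^sub>1\<close> and \<open>\<nu>\<^sub>2\<close> is implied by the symmetry of the joint distribution.\<close>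

definition is_coupling ::
  "nat \<Rightarrow> real \<Rightarrow> real \<Rightarrow> (nat \<Rightarrow> 'a) pmf \<Rightarrow> (nat \<Rightarrow> 'a) pmf \<Rightarrow> ((nat \<Rightarrow> 'a) \<times> (nat \<Rightarrow> 'a)) pmf \<Rightarrow> bool"
where
  "is_coupling n \<alpha> \<zeta> \<nu>\<^sub>1 \<nu>\<^sub>2 C \<longleftrightarrow>
     map_pmf fst C = \<nu>\<^sub>1 \<and> map_pmf snd C = \<nu>\<^sub>2 \<and>
     symmetric n C \<and>
     (\<forall>i\<in>{1..n}. measure_pmf.prob C {(x, y). x i \<noteq> y i} \<le> \<zeta>) \<and>
     (\<forall>\<epsilon>>0. measure_pmf.prob C {(x, y). real (card {i \<in> {1..n}. x i \<noteq> y i}) \<ge> \<epsilon> * real n}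
               \<le> 1 / \<alpha> * exp (- \<alpha> * \<epsilon>\<^sup>2 * real n))"

text \<open>
  The operator \<open>T\<^sub>C\<close>. Its value at \<open>y\<close> is meaningful only if \<open>y\<close> has positive probability under
  the second marginal of \<open>C\<close>.
\<close>

definition coupling_op ::
  "((nat \<Rightarrow> 'a) \<times> (nat \<Rightarrow> 'a)) pmf \<Rightarrow> ((nat \<Rightarrow> 'a) \<Rightarrow> real) \<Rightarrow> (nat \<Rightarrow> 'a) \<Rightarrow> real" where
  "coupling_op C f y = measure_pmf.expectation (cond_pmf C {p. snd p = y}) (\<lambda>p. f (fst p))"

definition pair_freq :: "nat \<Rightarrow> ((nat \<Rightarrow> 'a) \<times> (nat \<Rightarrow> 'b)) pmf \<Rightarrow> 'a \<times> 'b \<Rightarrow> real" where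
  "pair_freq n \<mu> a =
     measure_pmf.prob (pair_pmf \<mu> (pmf_of_set {1..n})) {((x, x'), i). x i = fst a \<and> x' i = snd a}"

definition admissible :: "real \<Rightarrow> nat \<Rightarrow> ((nat \<Rightarrow> 'a) \<times> (nat \<Rightarrow> 'b)) pmf \<Rightarrow> bool" where
  "admissible \<alpha> n \<mu> \<longleftrightarrow>
     symmetric n \<mu> \<and> (\<forall>a. pair_freq n \<mu> a = 0 \<or> pair_freq n \<mu> a \<ge> \<alpha>)"

definition bipartite_edges :: "('a \<times> 'b) set \<Rightarrow> (('a + 'b) \<times> ('a + 'b)) set" where
  "bipartite_edges E = (\<Union>(x, y)\<in>E. {(Inl x, Inr y), (Inr y, Inl x)})"

definition bipartite_connected :: "'a set \<Rightarrow> 'b set \<Rightarrow> ('a \<times> 'b) set \<Rightarrow> bool" where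
  "bipartite_connected A B E \<longleftrightarrow>
     (\<forall>u \<in> A <+> B. \<forall>v \<in> A <+> B. (u, v) \<in> (bipartite_edges E)\<^sup>*)"

text \<open>
  One conjunct for each of the two components; the vertices are whole vectors, not letters.
\<close>

definition connected_pmf :: "((nat \<Rightarrow> 'a) \<times> (nat \<Rightarrow> 'b)) pmf \<Rightarrow> bool" where
  "connected_pmf \<mu> \<longleftrightarrow>
     bipartite_connected (set_pmf (map_pmf fst \<mu>)) (set_pmf (map_pmf snd \<mu>)) (set_pmf \<mu>) \<and>
     bipartite_connected (set_pmf (map_pmf snd \<mu>)) (set_pmf (map_pmf fst \<mu>)) ((set_pmf \<mu>)\<inverse>)"

text \<open>
  The identification of \<open>\<Sigma>\<^sup>n \<times> \<Sigma>'\<^sup>n\<close> with \<open>(\<Sigma> \<times> \<Sigma>')\<^sup>n\<close>.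
\<close>

definition zip_vec :: "nat \<Rightarrow> (nat \<Rightarrow> 'a) \<times> (nat \<Rightarrow> 'b) \<Rightarrow> (nat \<Rightarrow> 'a \<times> 'b)" where
  "zip_vec n = (\<lambda>(x, x'). \<lambda>i\<in>{1..n}. (x i, x' i))"

definition fst_vec :: "nat \<Rightarrow> (nat \<Rightarrow> 'a \<times> 'b) \<Rightarrow> (nat \<Rightarrow> 'a)" where
  "fst_vec n z = (\<lambda>i\<in>{1..n}. fst (z i))"

definition snd_vec :: "nat \<Rightarrow> (nat \<Rightarrow> 'a \<times> 'b) \<Rightarrow> (nat \<Rightarrow> 'b)" where
  "snd_vec n z = (\<lambda>i\<in>{1..n}. snd (z i))"

definition product_version ::
  "nat \<Rightarrow> ((nat \<Rightarrow> 'a) \<times> (nat \<Rightarrow> 'b)) pmf \<Rightarrow> (nat \<Rightarrow> 'a \<times> 'b) pmf" where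
  "product_version n \<mu> =
     Pi_pmf {1..n} undefined (\<lambda>i. map_pmf (\<lambda>(x, x'). (x i, x' i)) \<mu>)"

end

theory Submission
  imports Defs
begin

text \<open>
  Let \<open>\<mu>'\<close> be the law of \<open>(x, x')\<close> obtained by drawing \<open>(y, y')\<close> from the product version of \<open>\<mu>\<close> and then \<open>x\<close>, \<open>x'\<close>
  from the conditional laws of the couplings. The claim is that the forms \<open>E f(x) g(x')\<close> under \<open>\<mu>\<close> and \<open>\<mu>'\<close>, both
  symmetric laws on the product of the two multislices with uniform marginals, differ by at most \<open>\<epsilon> \<parallel>f\<parallel> \<parallel>g\<parallel>\<close>.

  The difference \<open>D\<close> of the two operators commutes with the symmetric group, so \<open>D\<^sup>* D\<close> preserves the functions of
  \<open>x\<^sub>J\<close> that are orthogonal to all functions of fewer than \<open>|J|\<close> coordinates (the pure \<open>J\<close>-juntas). These span,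
  and iterating a self-adjoint operator on a finite sum shows that a norm bound on each of them is a norm bound
  everywhere. If \<open>|J|\<close> is bounded, the bound is a comparison of the marginals on \<open>J\<close>, which are
  close because every coordinate agrees with the product measure up to probability \<open>O(\<zeta>)\<close>.

  If \<open>|J|\<close> is large, each law separately contracts \<open>h\<close> strongly. Composing the law with its reverse a bounded
  number of times makes every pair of letters occur with positive frequency, since the letter graph is
  connected, and a second moment estimate shows that the coordinates where \<open>x\<close> has a fixed letter contain
  linearly many copies of each letter of the other vector \<open>w\<close>. A uniformly random linear-size set \<open>S\<close> of coordinates can then
  be placed inside them, independently of \<open>w\<close>, and \<open>w\<close> may be shuffled inside \<open>S\<close>. As \<open>S\<close> meets \<open>J\<close> with probability close to one, and
  shuffling one coordinate of \<open>J\<close> with many outside \<open>J\<close> nearly annihilates a pure junta, the operator is small.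
\<close>

section \<open>Inner products and a growth criterion for quadratic forms\<close>

text \<open>Pure juntas on different sets \<open>J\<close> are in general neither orthogonal nor
  independent, so bounds on them cannot be added without losing a factor that grows with
  \<open>n\<close>. A criterion that ignores multiplicative constants takes the place of an
  orthogonal decomposition. The high-degree argument needs room outside \<open>J\<close>. It comes
  from the point masses: a vector is determined by the coordinates whose letter differs from one
  fixed letter, so its point mass is a junta on that many coordinates, and no larger
  \<open>J\<close> ever has to be treated. Balance then leaves at least \<open>\<alpha> * n\<close>
  coordinates free. The constants are chosen in the order degree threshold \<open>d\<close>, class
  mass \<rho>, coupling error \<zeta>. In low degree the marginals are compared in supremum norm,
  and the passage to the quadratic norm costs the mass of a class of vectors that agree on
  \<open>J\<close>, which is about \<open>\<alpha> ^ d\<close>; hence \<zeta> has to be small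
  compared with that.\<close>

definition ip :: "'a set \<Rightarrow> ('a \<Rightarrow> real) \<Rightarrow> ('a \<Rightarrow> real) \<Rightarrow> real" where
  "ip U f g = (\<Sum>x\<in>U. f x * g x)"

lemma ip_commute: "ip U f g = ip U g f"
  by (simp add: ip_def mult.commute)

lemma ip_nonneg: "0 \<le> ip U f f"
  by (simp add: ip_def sum_nonneg)

lemma ip_add_left: "ip U (\<lambda>x. f x + g x) h = ip U f h + ip U g h"
  by (simp add: ip_def algebra_simps sum.distrib)

lemma ip_diff_left: "ip U (\<lambda>x. f x - g x) h = ip U f h - ip U g h"
  by (simp add: ip_def algebra_simps sum_subtractf)

lemma ip_scale_left: "ip U (\<lambda>x. c * f x) h = c * ip U f h"
  by (simp add: ip_def algebra_simps sum_distrib_left)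

lemma ip_scale_self: "ip U (\<lambda>x. c * f x) (\<lambda>x. c * f x) = c\<^sup>2 * ip U f f"
  by (simp add: ip_def sum_distrib_left power2_eq_square mult_ac)

lemma ip_cong: "(\<And>x. x \<in> U \<Longrightarrow> f x = f' x) \<Longrightarrow> (\<And>x. x \<in> U \<Longrightarrow> g x = g' x) \<Longrightarrow> ip U f g = ip U f' g'"
  by (auto simp: ip_def intro!: sum.cong)

lemma ip_Cauchy_Schwarz: "(ip U f g)\<^sup>2 \<le> ip U f f * ip U g g"
  using Cauchy_Schwarz_ineq_sum[of f g U] by (simp add: ip_def power2_eq_square)

lemma ip_self_add_le: "ip U (\<lambda>x. f x + g x) (\<lambda>x. f x + g x) \<le> 2 * ip U f f + 2 * ip U g g"
proof -
  have "(f x + g x) * (f x + g x) \<le> 2 * (f x * f x) + 2 * (g x * g x)" for x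
  proof -
    have "0 \<le> (f x - g x)\<^sup>2" by simp
    then show ?thesis by (simp add: power2_eq_square algebra_simps)
  qed
  then show ?thesis
    unfolding ip_def sum_distrib_left sum.distrib[symmetric] by (intro sum_mono) simp
qed

text \<open>\<open>V\<close> is any set closed under the vector space operations, so that an
  inductively generated span can be plugged in; Gram-Schmidt runs over the finite test set
  \<open>B\<close>, and no basis of \<open>V\<close> is involved.\<close>

lemma ip_orthogonal_projection:
  assumes U: "finite U" and "finite B" and "B \<subseteq> V"
    and V0: "(\<lambda>x. 0) \<in> V"
    and Va: "\<And>f g. f \<in> V \<Longrightarrow> g \<in> V \<Longrightarrow> (\<lambda>x. f x + g x) \<in> V"
    and Vs: "\<And>f c. f \<in> V \<Longrightarrow> (\<lambda>x. c * f x) \<in> V"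
  shows "\<exists>v\<in>V. \<forall>b\<in>B. ip U (\<lambda>x. f x - v x) b = 0"
proof -
  \<comment> \<open>The projection is also required to lie in the double orthogonal complement of \<open>B\<close>,
     which is what makes the Gram-Schmidt step go through.\<close>
  have "\<exists>v\<in>V. (\<forall>b\<in>B. ip U (\<lambda>x. f x - v x) b = 0) \<and>
      (\<forall>r. (\<forall>b\<in>B. ip U r b = 0) \<longrightarrow> ip U r v = 0)" for f
    using \<open>finite B\<close> \<open>B \<subseteq> V\<close>
  proof (induction B arbitrary: f rule: finite_induct)
    case empty
    have "ip U r (\<lambda>x. 0) = 0" for r by (simp add: ip_def)
    then show ?case using V0 by auto
  next
    case (insert b B)
    obtain v where v: "v \<in> V" "\<forall>b\<in>B. ip U (\<lambda>x. f x - v x) b = 0"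
      "\<And>r. (\<forall>b\<in>B. ip U r b = 0) \<Longrightarrow> ip U r v = 0" using insert by blast
    obtain u where u: "u \<in> V" "\<forall>b'\<in>B. ip U (\<lambda>x. b x - u x) b' = 0"
      "\<And>r. (\<forall>b\<in>B. ip U r b = 0) \<Longrightarrow> ip U r u = 0" using insert by blast
    define w where "w = (\<lambda>x. b x - u x)"
    define s where "s = (\<lambda>x. f x - v x)"
    define c where "c = ip U s w / ip U w w"
    have wV: "w \<in> V"
      unfolding w_def using Va[OF _ Vs[OF u(1), of "-1"], of b] insert.prems by simp
    have b: "b = (\<lambda>x. u x + w x)" by (simp add: w_def)
    have wB: "ip U w b' = 0" if "b' \<in> B" for b' using u(2) that by (simp add: w_def)
    have sB: "ip U s b' = 0" if "b' \<in> B" for b' using v(2) that by (simp add: s_def)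
    \<comment> \<open>\<open>ip\<close> is only semidefinite, since \<open>w\<close> may vanish on
      \<open>U\<close> without being zero. In that case Cauchy-Schwarz makes the right side zero as
      well.\<close>
    have cw: "c * ip U w w = ip U s w"
    proof (cases "ip U w w = 0")
      case True
      then have "ip U s w = 0"
        using ip_Cauchy_Schwarz[of U s w] by simp
      then show ?thesis using True by simp
    qed (simp add: c_def)
    have rem: "ip U (\<lambda>x. f x - (v x + c * w x)) g = ip U s g - c * ip U w g" for g
      by (simp add: s_def ip_diff_left ip_add_left ip_scale_left)
    have "ip U w u = 0" "ip U s u = 0" using u(3) wB sB by auto
    then have orthb: "ip U s b - c * ip U w b = 0"
      using cw ip_add_left[of U u w s] ip_add_left[of U u w w]
      by (simp add: b[symmetric] ip_commute[of U b] ip_commute[of U u] ip_commute[of U w s])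
    show ?case
    proof (intro bexI[of _ "\<lambda>x. v x + c * w x"] conjI ballI allI impI)
      show "(\<lambda>x. v x + c * w x) \<in> V" using v(1) wV Va Vs by blast
      fix b' assume "b' \<in> insert b B"
      then show "ip U (\<lambda>x. f x - (v x + c * w x)) b' = 0"
        using orthb wB sB by (auto simp: rem)
    next
      fix r assume r: "\<forall>b\<in>insert b B. ip U r b = 0"
      then have "ip U r v = 0" "ip U r u = 0" "ip U r b = 0" using v(3) u(3) by auto
      then show "ip U r (\<lambda>x. v x + c * w x) = 0"
        by (simp add: ip_commute[of U r] ip_add_left ip_scale_left w_def ip_diff_left)
    qed
  qed
  then show ?thesis by blast
qed

lemma power_two_power_le_of_doubling:
  fixes b :: "nat \<Rightarrow> real"
  assumes step: "\<And>j. (b j)\<^sup>2 \<le> b (2 * j)" and "0 \<le> b 1"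
  shows "b 1 ^ 2 ^ p \<le> b (2 ^ p)"
proof (induction p)
  case (Suc p)
  have "b 1 ^ 2 ^ Suc p = (b 1 ^ 2 ^ p)\<^sup>2" by (simp add: power_mult[symmetric] mult.commute)
  also have "\<dots> \<le> (b (2 ^ p))\<^sup>2" using Suc assms(2) by (intro power_mono) auto
  also have "\<dots> \<le> b (2 ^ Suc p)" using step by simp
  finally show ?case .
qed simp

text \<open>The moments \<open>b j\<close> satisfy \<open>(b j)\<^sup>2 \<le> b (2 * j)\<close> by
  Cauchy-Schwarz, so a first moment above \<open>l\<close> would force the moments of order
  \<open>2 ^ p\<close> to exceed every fixed multiple of \<open>l ^ 2 ^ p\<close>. The constant
  \<open>c\<close> is arbitrary and leaves no trace in the conclusion: this replaces a spectral
  decomposition of \<open>Q\<close>.\<close>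

lemma quadratic_form_le_of_growth:
  fixes Q :: "('a \<Rightarrow> real) \<Rightarrow> ('a \<Rightarrow> real)"
  assumes sa: "\<And>f g. ip U f (Q g) = ip U (Q f) g"
    and growth: "\<And>r. ip U ((Q ^^ r) f) ((Q ^^ r) f) \<le> c * (l ^ r)\<^sup>2"
    and l: "0 < l"
  shows "ip U f (Q f) \<le> l * ip U f f"
proof (cases "ip U f f = 0")
  case True
  then show ?thesis using ip_Cauchy_Schwarz[of U f "Q f"] by simp
next
  case False
  define N where "N = ip U f f"
  have N: "N > 0" using False ip_nonneg[of U f] by (simp add: N_def)
  define b where "b j = ip U f ((Q ^^ j) f) / N" for j
  have sa_pow: "ip U ((Q ^^ i) f) ((Q ^^ j) f) = ip U f ((Q ^^ (i + j)) f)" for i j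
  proof (induction i arbitrary: j)
    case (Suc i)
    have "ip U ((Q ^^ Suc i) f) ((Q ^^ j) f) = ip U ((Q ^^ i) f) ((Q ^^ Suc j) f)"
      by (simp add: sa)
    also have "\<dots> = ip U f ((Q ^^ (i + Suc j)) f)" by (rule Suc)
    finally show ?case by simp
  qed simp
  have b2: "b (2 * j) = ip U ((Q ^^ j) f) ((Q ^^ j) f) / N" for j
    by (simp add: b_def sa_pow mult_2)
  have step: "(b j)\<^sup>2 \<le> b (2 * j)" for j
    using ip_Cauchy_Schwarz[of U f "(Q ^^ j) f"] N
    by (simp add: b2) (simp add: b_def N_def[symmetric] power_divide field_simps power2_eq_square)
  show ?thesis
  proof (rule ccontr)
    assume "\<not> ?thesis"
    then have gt: "b 1 > l" using N by (simp add: b_def N_def[symmetric] field_simps)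
    define t where "t = b 1 / l - 1"
    have t: "t > 0" using gt l by (simp add: t_def)
    obtain p :: nat where p: "c / N < p * t" using reals_Archimedean3[OF t] by blast
    have "b 1 ^ 2 ^ Suc p \<le> b (2 ^ Suc p)" using power_two_power_le_of_doubling[of b "Suc p"] step gt l by simp
    also have "\<dots> \<le> c / N * l ^ 2 ^ Suc p"
      using growth[of "2 ^ p"] N b2[of "2 ^ p"]
      by (simp add: power_mult[symmetric] divide_right_mono mult.commute)
    finally have "(1 + t) ^ 2 ^ Suc p \<le> c / N"
      using l by (simp add: t_def power_divide field_simps)
    moreover have "1 + real (2 ^ Suc p) * t \<le> (1 + t) ^ 2 ^ Suc p"
      using Bernoulli_inequality[of t "2 ^ Suc p"] t by simp
    moreover have "real p * t \<le> real (2 ^ Suc p) * t"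
    proof -
      have "p \<le> 2 ^ Suc p" using less_exp[of "Suc p"] by linarith
      then have "real p \<le> real (2 ^ Suc p)" by (simp only: of_nat_le_iff)
      then show ?thesis using t by (intro mult_right_mono) auto
    qed
    ultimately show False using p by linarith
  qed
qed

section \<open>Juntas and their pure components\<close>

lemma ex_permutes_of_card_fibres_eq:
  assumes "finite A" and "\<And>y. card {i\<in>A. f i = y} = card {i\<in>A. g i = y}"
  shows "\<exists>\<pi>. \<pi> permutes A \<and> (\<forall>i\<in>A. f i = g (\<pi> i))"
proof -
  have "image_mset f (mset_set A) = image_mset g (mset_set A)"
  proof (rule multiset_eqI)
    fix y
    have "count (image_mset h (mset_set A)) y = card {i\<in>A. h i = y}" for h :: "'a \<Rightarrow> 'b"
      using assms(1) by (simp add: count_image_mset_eq_card_vimage)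
    then show "count (image_mset f (mset_set A)) y = count (image_mset g (mset_set A)) y"
      using assms(2) by simp
  qed
  from image_mset_eq_implies_permutes[OF assms(1) this] show ?thesis by blast
qed

text \<open>On a multislice, invariance under the permutations fixing \<open>J\<close> pointwise means depending on the
  coordinates in \<open>J\<close> only. The group-theoretic form is visibly preserved by equivariant operators.\<close>

definition junta :: "nat \<Rightarrow> (nat \<Rightarrow> 'a) set \<Rightarrow> nat set \<Rightarrow> ((nat \<Rightarrow> 'a) \<Rightarrow> real) \<Rightarrow> bool" where
  "junta n U J h \<longleftrightarrow> (\<forall>\<pi>. \<pi> permutes {1..n} - J \<longrightarrow> (\<forall>x\<in>U. h (x \<circ> \<pi>) = h x))"

text \<open>The orthogonal complement of the functions of degree below \<open>e\<close>. A pure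
  \<open>J\<close>-junta in the sense of the overview is a \<open>J\<close>-junta that is
  \<open>pure\<close> at level \<open>card J\<close>.\<close>

definition pure :: "nat \<Rightarrow> (nat \<Rightarrow> 'a) set \<Rightarrow> nat \<Rightarrow> ((nat \<Rightarrow> 'a) \<Rightarrow> real) \<Rightarrow> bool" where
  "pure n U e h \<longleftrightarrow> (\<forall>J v. J \<subseteq> {1..n} \<longrightarrow> card J < e \<longrightarrow> junta n U J v \<longrightarrow> ip U h v = 0)"

text \<open>Used in two ways: for \<open>A\<close> the complement of \<open>J\<close> it is the
  projection onto \<open>J\<close>-juntas, and for \<open>A\<close> a random set it is the shuffling
  of the coordinates inside that set.\<close>

definition perm_avg :: "nat set \<Rightarrow> ((nat \<Rightarrow> 'a) \<Rightarrow> real) \<Rightarrow> (nat \<Rightarrow> 'a) \<Rightarrow> real" where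
  "perm_avg A f x = (\<Sum>\<pi> | \<pi> permutes A. f (x \<circ> \<pi>)) / fact (card A)"

lemma perm_avg_comp:
  assumes "\<rho> permutes A"
  shows "perm_avg A f (x \<circ> \<rho>) = perm_avg A f x"
proof -
  have "(\<Sum>\<pi> | \<pi> permutes A. f (x \<circ> \<rho> \<circ> \<pi>)) = (\<Sum>\<pi> | \<pi> permutes A. f (x \<circ> \<pi>))"
    using setum_permutations_compose_left[OF assms, of "\<lambda>\<pi>. f (x \<circ> \<pi>)"] by (simp add: comp_assoc)
  then show ?thesis by (simp add: perm_avg_def)
qed

lemma perm_avg_of_comp:
  assumes "\<rho> permutes A"
  shows "perm_avg A (\<lambda>x. f (x \<circ> \<rho>)) x = perm_avg A f x"
proof -
  have "(\<Sum>\<pi> | \<pi> permutes A. f (x \<circ> \<pi> \<circ> \<rho>)) = (\<Sum>\<pi> | \<pi> permutes A. f (x \<circ> \<pi>))"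
    using sum_permutations_compose_right[OF assms, of "\<lambda>\<pi>. f (x \<circ> \<pi>)"] by (simp add: comp_assoc)
  then show ?thesis by (simp add: perm_avg_def)
qed

lemma perm_avg_add: "perm_avg A (\<lambda>x. f x + g x) x = perm_avg A f x + perm_avg A g x"
  by (simp add: perm_avg_def sum.distrib add_divide_distrib)

lemma perm_avg_scale: "perm_avg A (\<lambda>x. c * f x) x = c * perm_avg A f x"
  by (simp add: perm_avg_def sum_distrib_left[symmetric])

lemma perm_avg_sum: "perm_avg A (\<lambda>x. \<Sum>i\<in>I. f i x) x = (\<Sum>i\<in>I. perm_avg A (f i) x)"
  unfolding perm_avg_def by (subst sum.swap) (simp add: sum_divide_distrib)

lemma perm_avg_eq_self:
  assumes "finite A" "\<And>\<pi>. \<pi> permutes A \<Longrightarrow> f (x \<circ> \<pi>) = f x"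
  shows "perm_avg A f x = f x"
  using assms by (simp add: perm_avg_def card_permutations)

lemma junta_scale: "junta n U J f \<Longrightarrow> junta n U J (\<lambda>x. c * f x)"
  by (simp add: junta_def)

text \<open>All that is used of a multislice. Transitivity relative to \<open>J\<close> is what
  identifies invariance under the permutations fixing \<open>J\<close> with dependence on the
  coordinates in \<open>J\<close>; for empty \<open>J\<close> it is transitivity of the whole
  symmetric group.\<close>

locale orbit =
  fixes n m :: nat and U :: "(nat \<Rightarrow> nat) set"
  assumes fin: "finite U" and ne: "U \<noteq> {}"
    and letters: "x \<in> U \<Longrightarrow> i \<in> {1..n} \<Longrightarrow> x i \<in> {1..m}"
    and closed: "x \<in> U \<Longrightarrow> \<pi> permutes {1..n} \<Longrightarrow> x \<circ> \<pi> \<in> U"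
    and transitive: "x \<in> U \<Longrightarrow> y \<in> U \<Longrightarrow> J \<subseteq> {1..n} \<Longrightarrow> (\<forall>i\<in>J. x i = y i) \<Longrightarrow>
      \<exists>\<pi>. \<pi> permutes {1..n} - J \<and> y = x \<circ> \<pi>"
begin

lemma card_pos: "0 < card U"
  using fin ne by (simp add: card_gt_0_iff)

lemma sum_permute:
  assumes "\<pi> permutes {1..n}"
  shows "(\<Sum>x\<in>U. F (x \<circ> \<pi>)) = (\<Sum>x\<in>U. F x)"
proof (rule sum.reindex_bij_witness[of _ "\<lambda>x. x \<circ> inv \<pi>" "\<lambda>x. x \<circ> \<pi>"])
  fix x assume "x \<in> U"
  then show "x \<circ> \<pi> \<in> U" "x \<circ> inv \<pi> \<in> U" using closed assms permutes_inv by blast+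
  show "x \<circ> \<pi> \<circ> inv \<pi> = x" "x \<circ> inv \<pi> \<circ> \<pi> = x"
    using permutes_inv_o[OF assms] by (simp_all add: comp_assoc)
qed simp

lemma ip_permute:
  assumes "\<pi> permutes {1..n}"
  shows "ip U (\<lambda>x. f (x \<circ> \<pi>)) (\<lambda>x. g (x \<circ> \<pi>)) = ip U f g"
  unfolding ip_def using sum_permute[OF assms, of "\<lambda>x. f x * g x"] .

lemma ip_permute_left:
  assumes "\<pi> permutes {1..n}"
  shows "ip U (\<lambda>x. f (x \<circ> \<pi>)) g = ip U f (\<lambda>x. g (x \<circ> inv \<pi>))"
proof -
  have "x \<circ> \<pi> \<circ> inv \<pi> = x" for x :: "nat \<Rightarrow> nat"
    using permutes_inv_o[OF assms] by (simp add: comp_assoc)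
  then show ?thesis using ip_permute[OF assms, of f "\<lambda>x. g (x \<circ> inv \<pi>)"] by simp
qed

lemma junta_eq:
  assumes "junta n U J h" "J \<subseteq> {1..n}" "x \<in> U" "y \<in> U" "\<And>i. i \<in> J \<Longrightarrow> x i = y i"
  shows "h x = h y"
  using transitive[OF assms(3,4,2)] assms(1,3,5) unfolding junta_def by metis

lemma juntaI:
  assumes "J \<subseteq> {1..n}"
    and "\<And>x y. x \<in> U \<Longrightarrow> y \<in> U \<Longrightarrow> (\<And>i. i \<in> J \<Longrightarrow> x i = y i) \<Longrightarrow> h x = h y"
  shows "junta n U J h"
  unfolding junta_def
proof (intro allI impI ballI)
  fix \<pi> x assume \<pi>: "\<pi> permutes {1..n} - J" and x: "x \<in> U"
  have "\<pi> permutes {1..n}" using \<pi> by (rule permutes_subset) auto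
  then have "x \<circ> \<pi> \<in> U" using x closed by blast
  moreover have "(x \<circ> \<pi>) i = x i" if "i \<in> J" for i
    using \<pi> that by (simp add: permutes_not_in)
  ultimately show "h (x \<circ> \<pi>) = h x" using assms x by blast
qed

lemma junta_permute:
  assumes "junta n U J h" "\<rho> permutes {1..n}" "J \<subseteq> {1..n}"
  shows "junta n U (\<rho> ` J) (\<lambda>x. h (x \<circ> \<rho>))"
proof (rule juntaI)
  show "\<rho> ` J \<subseteq> {1..n}" using assms(2,3) permutes_image by blast
  fix x y assume "x \<in> U" "y \<in> U" "\<And>i. i \<in> \<rho> ` J \<Longrightarrow> x i = y i"
  then show "h (x \<circ> \<rho>) = h (y \<circ> \<rho>)"
    using assms closed by (intro junta_eq[OF assms(1,3)]) auto
qed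

lemma junta_perm_avg:
  assumes "J \<subseteq> {1..n}"
  shows "junta n U J (perm_avg ({1..n} - J) f)"
  by (simp add: junta_def perm_avg_comp)

lemma perm_avg_junta:
  assumes "junta n U J h" "x \<in> U"
  shows "perm_avg ({1..n} - J) h x = h x"
  using assms by (intro perm_avg_eq_self) (auto simp: junta_def)

text \<open>Jensen's inequality at every point, after which all permuted copies of the square have
  the same sum over \<open>U\<close>.\<close>

lemma ip_perm_avg_self_le:
  assumes "A \<subseteq> {1..n}"
  shows "ip U (perm_avg A f) (perm_avg A f) \<le> ip U f f"
proof -
  have finA: "finite A" using assms finite_subset by blast
  let ?P = "{\<pi>. \<pi> permutes A}"
  have cP: "real (card ?P) = fact (card A)" using finA by (simp add: card_permutations)
  have "perm_avg A f x * perm_avg A f x \<le> perm_avg A (\<lambda>x. f x * f x) x" for x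
  proof -
    have "(\<Sum>\<pi>\<in>?P. f (x \<circ> \<pi>))\<^sup>2 \<le> fact (card A) * (\<Sum>\<pi>\<in>?P. (f (x \<circ> \<pi>))\<^sup>2)"
      using Cauchy_Schwarz_ineq_sum[of "\<lambda>_. 1" "\<lambda>\<pi>. f (x \<circ> \<pi>)" ?P] cP by simp
    then show ?thesis by (simp add: perm_avg_def power2_eq_square divide_simps mult.commute)
  qed
  then have "ip U (perm_avg A f) (perm_avg A f) \<le> (\<Sum>x\<in>U. perm_avg A (\<lambda>x. f x * f x) x)"
    unfolding ip_def by (rule sum_mono)
  also have "\<dots> = (\<Sum>\<pi>\<in>?P. (\<Sum>x\<in>U. f (x \<circ> \<pi>) * f (x \<circ> \<pi>))) / fact (card A)"
    unfolding perm_avg_def sum_divide_distrib[symmetric] by (subst sum.swap) simp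
  also have "\<dots> = (\<Sum>\<pi>\<in>?P. ip U f f) / fact (card A)"
  proof -
    have "(\<Sum>x\<in>U. f (x \<circ> \<pi>) * f (x \<circ> \<pi>)) = ip U f f" if "\<pi> \<in> ?P" for \<pi>
      using that ip_permute[OF permutes_subset[OF _ assms], of \<pi> f f] by (simp add: ip_def)
    then show ?thesis by simp
  qed
  also have "\<dots> = ip U f f" using cP by simp
  finally show ?thesis .
qed

lemma pure_permute:
  assumes "pure n U e h" "\<rho> permutes {1..n}"
  shows "pure n U e (\<lambda>x. h (x \<circ> \<rho>))"
  unfolding pure_def
proof (intro allI impI)
  fix J v assume J: "J \<subseteq> {1..n}" "card J < e" "junta n U J v"
  have inv: "inv \<rho> permutes {1..n}" using assms(2) permutes_inv by blast
  have "inj_on (inv \<rho>) J" using permutes_inj[OF inv] inj_on_subset by blast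
  then have "card (inv \<rho> ` J) < e" using J by (simp add: card_image)
  moreover have "inv \<rho> ` J \<subseteq> {1..n}" using J(1) permutes_image[OF inv] by blast
  ultimately show "ip U (\<lambda>x. h (x \<circ> \<rho>)) v = 0"
    using assms(1) junta_permute[OF J(3) inv J(1)] by (simp add: ip_permute_left[OF assms(2)] pure_def)
qed

lemma pure_perm_avg:
  assumes "pure n U e h" "A \<subseteq> {1..n}"
  shows "pure n U e (perm_avg A h)"
  unfolding pure_def
proof (intro allI impI)
  fix J v assume J: "J \<subseteq> {1..n}" "card J < e" "junta n U J v"
  have "ip U (perm_avg A h) v = (\<Sum>\<pi> | \<pi> permutes A. ip U (\<lambda>x. h (x \<circ> \<pi>)) v) / fact (card A)"
    unfolding ip_def perm_avg_def by (subst sum.swap) (simp add: sum_distrib_right sum_divide_distrib)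
  also have "\<dots> = 0"
  proof -
    have "ip U (\<lambda>x. h (x \<circ> \<pi>)) v = 0" if "\<pi> permutes A" for \<pi>
      using pure_permute[OF assms(1) permutes_subset[OF that assms(2)]] J unfolding pure_def by blast
    then show ?thesis by simp
  qed
  finally show "ip U (perm_avg A h) v = 0" .
qed

text \<open>Adding one junta at a time gives an induction principle for the functions of degree
  below \<open>e\<close>. Equality is demanded on \<open>U\<close> only, because values elsewhere
  are arbitrary and invisible to \<open>ip\<close>.\<close>

inductive_set junta_span :: "nat \<Rightarrow> ((nat \<Rightarrow> nat) \<Rightarrow> real) set" for e where
  zero: "\<forall>x\<in>U. f x = 0 \<Longrightarrow> f \<in> junta_span e"
| add: "f \<in> junta_span e \<Longrightarrow> J \<subseteq> {1..n} \<Longrightarrow> card J < e \<Longrightarrow> junta n U J h \<Longrightarrow>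
    \<forall>x\<in>U. g x = f x + h x \<Longrightarrow> g \<in> junta_span e"

lemma junta_span_cong: "f \<in> junta_span e \<Longrightarrow> (\<And>x. x \<in> U \<Longrightarrow> g x = f x) \<Longrightarrow> g \<in> junta_span e"
proof (induction arbitrary: g rule: junta_span.induct)
  case (zero f)
  then show ?case by (intro junta_span.zero) simp
next
  case (add f J h f')
  then show ?case by (intro junta_span.add[OF add(1-4)]) simp
qed

lemma junta_span_junta: "J \<subseteq> {1..n} \<Longrightarrow> card J < e \<Longrightarrow> junta n U J h \<Longrightarrow> h \<in> junta_span e"
  by (rule junta_span.add[OF junta_span.zero, of "\<lambda>_. 0"]) auto

lemma junta_span_plus:
  assumes "f \<in> junta_span e" "g \<in> junta_span e"
  shows "(\<lambda>x. f x + g x) \<in> junta_span e"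
proof -
  have "\<forall>f'. (\<forall>x\<in>U. f' x = f x + g x) \<longrightarrow> f' \<in> junta_span e"
    using assms(2)
  proof induction
    case (zero g)
    from assms(1) show ?case
    proof induction
      case (zero f)
      then show ?case using \<open>\<forall>x\<in>U. g x = 0\<close> by (auto intro: junta_span.zero)
    next
      case (add f J h f')
      then show ?case using \<open>\<forall>x\<in>U. g x = 0\<close> by (auto intro!: junta_span.add[OF add(1-4)])
    qed
  next
    case (add g J h g')
    show ?case
    proof (intro allI impI)
      fix f' assume f': "\<forall>x\<in>U. f' x = f x + g' x"
      have "(\<lambda>x. f x + g x) \<in> junta_span e" using add(6)[rule_format, of "\<lambda>x. f x + g x"] by simp
      from junta_span.add[OF this add(2-4)] show "f' \<in> junta_span e"
        using f' add(5) by simp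
    qed
  qed
  then show ?thesis by simp
qed

lemma junta_span_scale:
  assumes "f \<in> junta_span e"
  shows "(\<lambda>x. c * f x) \<in> junta_span e"
  using assms
proof induction
  case (add f J h g)
  then show ?case
    by (intro junta_span.add[OF add(6) add(2,3) junta_scale[OF add(4), of c]]) (auto simp: algebra_simps)
qed (auto intro: junta_span.zero)

text \<open>Purity quantifies over infinitely many juntas; reducing it to finitely many indicators
  is what lets the projection onto a finite test set produce pure functions.\<close>

lemma pure_of_orthogonal_indicators:
  assumes "\<And>J a. J \<subseteq> {1..n} \<Longrightarrow> card J < e \<Longrightarrow> a \<in> U \<Longrightarrow> ip U r (\<lambda>x. if \<forall>i\<in>J. x i = a i then 1 else 0) = 0"
  shows "pure n U e r"
  unfolding pure_def
proof (intro allI impI)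
  fix J v assume J: "J \<subseteq> {1..n}" "card J < e" "junta n U J v"
  let ?I = "\<lambda>a x. if \<forall>i\<in>J. x i = a i then 1 else (0::real)"
  \<comment> \<open>\<open>N a\<close> is the size of the class of \<open>a\<close> under agreement
    on \<open>J\<close>. The expansion of \<open>v\<close> runs over all of \<open>U\<close>, so
    each class appears \<open>N a\<close> times and the weight \<open>1 / N a\<close>
    compensates.\<close>
  define N where "N a = (\<Sum>b\<in>U. ?I a b)" for a
  have Npos: "N a > 0" if "a \<in> U" for a
    unfolding N_def using that fin by (intro sum_pos2[of _ a]) auto
  have v: "v x = (\<Sum>a\<in>U. v a / N a * ?I a x)" if x: "x \<in> U" for x
  proof -
    have "(\<Sum>a\<in>U. v a / N a * ?I a x) = (\<Sum>a\<in>U. v x / N x * ?I x a)"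
    proof (rule sum.cong)
      fix a assume a: "a \<in> U"
      show "v a / N a * ?I a x = v x / N x * ?I x a"
      proof (cases "\<forall>i\<in>J. x i = a i")
        case True
        have "v a = v x" using junta_eq[OF J(3,1) a x] True by simp
        moreover have "N a = N x" unfolding N_def by (intro sum.cong) (auto simp: True)
        ultimately show ?thesis using True by simp
      qed auto
    qed simp
    also have "\<dots> = v x / N x * N x" unfolding N_def by (simp only: sum_distrib_left[symmetric])
    also have "\<dots> = v x" using Npos[OF x] by simp
    finally show ?thesis by simp
  qed
  have "ip U r v = (\<Sum>a\<in>U. v a / N a * ip U r (?I a))"
  proof -
    have "ip U r v = (\<Sum>x\<in>U. \<Sum>a\<in>U. v a / N a * (r x * ?I a x))"
      unfolding ip_def
    proof (rule sum.cong)
      fix x assume x: "x \<in> U"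
      have "r x * v x = r x * (\<Sum>a\<in>U. v a / N a * ?I a x)" by (rule arg_cong[OF v[OF x]])
      then show "r x * v x = (\<Sum>a\<in>U. v a / N a * (r x * ?I a x))"
        by (simp add: sum_distrib_left mult_ac)
    qed simp
    also have "\<dots> = (\<Sum>a\<in>U. v a / N a * ip U r (?I a))"
      unfolding ip_def by (subst sum.swap) (simp only: sum_distrib_left)
    finally show ?thesis .
  qed
  also have "\<dots> = 0" using assms[OF J(1,2)] by simp
  finally show "ip U r v = 0" .
qed

lemma ex_junta_span_projection:
  "\<exists>v\<in>junta_span e. pure n U e (\<lambda>x. f x - v x)"
proof -
  let ?ind = "\<lambda>(J, a) x. if \<forall>i\<in>J. x i = a i then 1 else (0::real)"
  define B where "B = ?ind ` ({J. J \<subseteq> {1..n} \<and> card J < e} \<times> U)"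
  have "finite {J. J \<subseteq> {1..n} \<and> card J < e}" by (rule finite_subset[of _ "Pow {1..n}"]) auto
  then have "finite B" using fin by (simp add: B_def)
  moreover have "B \<subseteq> junta_span e"
  proof
    fix b assume "b \<in> B"
    then obtain J a where J: "J \<subseteq> {1..n}" "card J < e" and b: "b = ?ind (J, a)"
      unfolding B_def by auto
    have "junta n U J b" unfolding b using J(1) by (intro juntaI) auto
    then show "b \<in> junta_span e" using J junta_span_junta by blast
  qed
  ultimately obtain v where "v \<in> junta_span e" and v: "\<forall>b\<in>B. ip U (\<lambda>x. f x - v x) b = 0"
    using ip_orthogonal_projection[OF fin, of B "junta_span e" f]
      junta_span_plus junta_span_scale junta_span.zero[of "\<lambda>x. 0"] by auto
  moreover have "pure n U e (\<lambda>x. f x - v x)"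
    using v by (intro pure_of_orthogonal_indicators) (force simp: B_def)
  ultimately show ?thesis by blast
qed

text \<open>Write \<open>h = v + r\<close> with \<open>v\<close> of degree below
  \<open>card J\<close> and \<open>r\<close> pure. The remainder \<open>r\<close> need not be a
  \<open>J\<close>-junta, so both parts are averaged over the permutations fixing \<open>J\<close>:
  this fixes \<open>h\<close>, keeps \<open>v\<close> in the span of smaller juntas, where the
  induction hypothesis applies, and turns \<open>r\<close> into a pure
  \<open>J\<close>-junta.\<close>

lemma pure_junta_induct:
  assumes cong: "\<And>f g. (\<And>x. x \<in> U \<Longrightarrow> f x = g x) \<Longrightarrow> P f \<Longrightarrow> P g"
    and zero: "P (\<lambda>x. 0)"
    and add: "\<And>f g. P f \<Longrightarrow> P g \<Longrightarrow> P (\<lambda>x. f x + g x)"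
    and pure: "\<And>J h. J \<subseteq> {1..n} \<Longrightarrow> card J \<le> e \<Longrightarrow> junta n U J h \<Longrightarrow> pure n U (card J) h \<Longrightarrow> P h"
    and J: "J \<subseteq> {1..n}" "card J \<le> e" "junta n U J h"
  shows "P h"
  using J
proof (induction "card J" arbitrary: J h rule: less_induct)
  case less
  obtain v where v: "v \<in> junta_span (card J)" and r: "pure n U (card J) (\<lambda>x. h x - v x)"
    using ex_junta_span_projection by blast
  have Pspan: "P u" if "u \<in> junta_span (card J)" for u
    using that
  proof induction
    case (zero f)
    then show ?case using cong[OF _ assms(2)] by simp
  next
    case (add f I h g)
    have "P h" using less.hyps[OF add(3,2) _ add(4)] add(3) less.prems(2) by simp
    then show ?case using assms(3)[OF add(6)] add(5) by (intro cong[of "\<lambda>x. f x + h x" g]) auto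
  qed
  let ?A = "{1..n} - J"
  have avg_span: "perm_avg ?A u \<in> junta_span (card J)" if "u \<in> junta_span (card J)" for u
    using that
  proof induction
    case (zero f)
    have "perm_avg ?A f x = 0" if "x \<in> U" for x
    proof -
      have "f (x \<circ> \<pi>) = 0" if "\<pi> permutes ?A" for \<pi>
        using zero closed[OF \<open>x \<in> U\<close> permutes_subset[OF that, of "{1..n}"]] by auto
      then show ?thesis by (simp add: perm_avg_def)
    qed
    then show ?case by (simp add: junta_span.zero)
  next
    case (add f I h g)
    have shift: "(\<lambda>x. \<Sum>\<pi>\<in>S. h (x \<circ> \<pi>)) \<in> junta_span (card J)"
      if "finite S" "S \<subseteq> {\<pi>. \<pi> permutes ?A}" for S
      using that
    proof (induction S rule: finite_induct)
      case empty
      then show ?case by (simp add: junta_span.zero)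
    next
      case (insert \<pi> S)
      have \<pi>: "\<pi> permutes {1..n}" using insert.prems permutes_subset[of \<pi> ?A "{1..n}"] by auto
      have "card (\<pi> ` I) = card I"
        using permutes_inj[OF \<pi>] by (intro card_image) (auto intro: inj_on_subset)
      then have "(\<lambda>x. h (x \<circ> \<pi>)) \<in> junta_span (card J)"
        using junta_permute[OF add(4) \<pi> add(2)] add(2,3) permutes_image[OF \<pi>]
        by (intro junta_span_junta[of "\<pi> ` I"]) auto
      then show ?case
        using insert junta_span_plus[of "\<lambda>x. h (x \<circ> \<pi>)" "card J" "\<lambda>x. \<Sum>\<pi>\<in>S. h (x \<circ> \<pi>)"]
        by (simp del: comp_apply)
    qed
    have "(\<lambda>x. perm_avg ?A f x + 1 / fact (card ?A) * (\<Sum>\<pi> | \<pi> permutes ?A. h (x \<circ> \<pi>))) \<in> junta_span (card J)"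
      using shift[of "{\<pi>. \<pi> permutes ?A}"] add(6)
      by (intro junta_span_plus junta_span_scale) (auto simp: finite_permutations)
    moreover have "perm_avg ?A g x = perm_avg ?A f x + 1 / fact (card ?A) * (\<Sum>\<pi> | \<pi> permutes ?A. h (x \<circ> \<pi>))"
      if "x \<in> U" for x
    proof -
      have "g (x \<circ> \<pi>) = f (x \<circ> \<pi>) + h (x \<circ> \<pi>)" if "\<pi> permutes ?A" for \<pi>
        using add(5) closed[OF \<open>x \<in> U\<close> permutes_subset[OF that, of "{1..n}"]] by auto
      then show ?thesis by (simp add: perm_avg_def sum.distrib add_divide_distrib)
    qed
    ultimately show ?case
      by (rule junta_span_cong)
  qed
  have "P (perm_avg ?A v)" using Pspan avg_span v by blast
  moreover have "P (perm_avg ?A (\<lambda>x. h x - v x))"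
    using less.prems r by (intro assms(4)[of J] junta_perm_avg pure_perm_avg) auto
  ultimately have "P (\<lambda>x. perm_avg ?A v x + perm_avg ?A (\<lambda>x. h x - v x) x)" by (rule assms(3))
  moreover have "perm_avg ?A v x + perm_avg ?A (\<lambda>x. h x - v x) x = h x" if "x \<in> U" for x
    using perm_avg_add[of ?A v "\<lambda>x. h x - v x" x] perm_avg_junta[OF less.prems(3) that] by simp
  ultimately show ?case by (rule cong[rotated])
qed

end

section \<open>Shuffling a random set of coordinates\<close>

lemma weighted_Cauchy_Schwarz_sum:
  assumes "\<And>p. p \<in> I \<Longrightarrow> 0 \<le> (k p :: real)"
  shows "(\<Sum>p\<in>I. k p * a p * b p)\<^sup>2 \<le> (\<Sum>p\<in>I. k p * (a p)\<^sup>2) * (\<Sum>p\<in>I. k p * (b p)\<^sup>2)"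
proof -
  have "(\<Sum>p\<in>I. k p * a p * b p) = (\<Sum>p\<in>I. (sqrt (k p) * a p) * (sqrt (k p) * b p))"
    using assms by (intro sum.cong) (auto simp: algebra_simps)
  also have "\<dots>\<^sup>2 \<le> (\<Sum>p\<in>I. (sqrt (k p) * a p)\<^sup>2) * (\<Sum>p\<in>I. (sqrt (k p) * b p)\<^sup>2)"
    by (rule Cauchy_Schwarz_ineq_sum)
  also have "\<dots> = (\<Sum>p\<in>I. k p * (a p)\<^sup>2) * (\<Sum>p\<in>I. k p * (b p)\<^sup>2)"
    using assms by (simp add: power_mult_distrib cong: sum.cong)
  finally show ?thesis .
qed

section \<open>Stabilisers of a vector, and placing a random set independently of it\<close>

definition stab :: "nat \<Rightarrow> (nat \<Rightarrow> 'a) \<Rightarrow> (nat \<Rightarrow> nat) set" where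
  "stab n w = {\<tau>. \<tau> permutes {1..n} \<and> w \<circ> \<tau> = w}"

lemma finite_stab: "finite (stab n w)"
  by (rule finite_subset[of _ "{\<tau>. \<tau> permutes {1..n}}"]) (auto simp: stab_def finite_permutations)

lemma id_in_stab: "id \<in> stab n w"
  by (simp add: stab_def permutes_id)

lemma stab_comp: "\<tau> \<in> stab n w \<Longrightarrow> \<rho> \<in> stab n w \<Longrightarrow> \<tau> \<circ> \<rho> \<in> stab n w"
  unfolding stab_def by (auto simp: permutes_compose comp_assoc[symmetric] simp del: comp_apply)

lemma stab_inv:
  assumes "\<tau> \<in> stab n w"
  shows "inv \<tau> \<in> stab n w"
proof -
  have \<tau>: "\<tau> permutes {1..n}" "w \<circ> \<tau> = w" using assms by (auto simp: stab_def)
  have "w \<circ> inv \<tau> = w \<circ> \<tau> \<circ> inv \<tau>" using \<tau>(2) by simp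
  also have "\<dots> = w" using permutes_inv_o(1)[OF \<tau>(1)] by (simp add: comp_assoc)
  finally show ?thesis using \<tau>(1) by (simp add: stab_def permutes_inv)
qed

lemma stab_inv_comp:
  assumes "\<tau> \<in> stab n w"
  shows "inv \<tau> \<circ> \<tau> = id" "\<tau> \<circ> inv \<tau> = id"
  using assms permutes_inv_o unfolding stab_def by blast+

lemma sum_stab_comp_left:
  assumes "\<tau> \<in> stab n w"
  shows "(\<Sum>\<rho>\<in>stab n w. F (\<tau> \<circ> \<rho>)) = (\<Sum>\<rho>\<in>stab n w. F \<rho>)"
  by (rule sum.reindex_bij_witness[of _ "\<lambda>\<rho>. inv \<tau> \<circ> \<rho>" "\<lambda>\<rho>. \<tau> \<circ> \<rho>"])
    (use assms in \<open>auto simp: comp_assoc[symmetric] stab_inv_comp stab_comp stab_inv simp del: comp_apply\<close>)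

lemma sum_stab_comp_right:
  assumes "\<tau> \<in> stab n w"
  shows "(\<Sum>\<rho>\<in>stab n w. F (\<rho> \<circ> \<tau>)) = (\<Sum>\<rho>\<in>stab n w. F \<rho>)"
  by (rule sum.reindex_bij_witness[of _ "\<lambda>\<rho>. \<rho> \<circ> inv \<tau>" "\<lambda>\<rho>. \<rho> \<circ> \<tau>"])
    (use assms in \<open>auto simp: comp_assoc stab_inv_comp stab_comp stab_inv simp del: comp_apply\<close>)

lemma sum_stab_conj:
  assumes "\<pi> permutes {1..n}"
  shows "(\<Sum>\<rho>\<in>stab n (w \<circ> \<pi>). F \<rho>) = (\<Sum>\<tau>\<in>stab n w. F (inv \<pi> \<circ> \<tau> \<circ> \<pi>))"
proof (rule sum.reindex_bij_witness[of _ "\<lambda>\<tau>. inv \<pi> \<circ> \<tau> \<circ> \<pi>" "\<lambda>\<rho>. \<pi> \<circ> \<rho> \<circ> inv \<pi>"])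
  have inv: "inv \<pi> \<circ> \<pi> = id" "\<pi> \<circ> inv \<pi> = id" "inv \<pi> permutes {1..n}"
    using permutes_inv_o[OF assms] permutes_inv[OF assms] by auto
  have c1: "inv \<pi> \<circ> (\<pi> \<circ> g) = g" "\<pi> \<circ> (inv \<pi> \<circ> g) = g" for g :: "nat \<Rightarrow> nat"
    using inv by (simp_all add: comp_assoc[symmetric])
  fix \<rho>
  show a: "inv \<pi> \<circ> (\<pi> \<circ> \<rho> \<circ> inv \<pi>) \<circ> \<pi> = \<rho>" by (simp add: comp_assoc c1 inv del: comp_apply)
  show "F (inv \<pi> \<circ> (\<pi> \<circ> \<rho> \<circ> inv \<pi>) \<circ> \<pi>) = F \<rho>" by (simp only: a)
  show "\<pi> \<circ> (inv \<pi> \<circ> \<rho> \<circ> \<pi>) \<circ> inv \<pi> = \<rho>" by (simp add: comp_assoc c1 inv del: comp_apply)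
  { assume \<rho>: "\<rho> \<in> stab n (w \<circ> \<pi>)"
    then have "w \<circ> \<pi> \<circ> \<rho> = w \<circ> \<pi>" by (simp add: stab_def)
    then have "w \<circ> (\<pi> \<circ> \<rho> \<circ> inv \<pi>) = w \<circ> \<pi> \<circ> inv \<pi>" by (simp add: comp_assoc[symmetric] del: comp_apply)
    then show "\<pi> \<circ> \<rho> \<circ> inv \<pi> \<in> stab n w"
      using \<rho> assms inv by (simp add: stab_def comp_assoc permutes_compose del: comp_apply) }
  { assume \<rho>: "\<rho> \<in> stab n w"
    have "w \<circ> \<pi> \<circ> (inv \<pi> \<circ> \<rho> \<circ> \<pi>) = w \<circ> \<rho> \<circ> \<pi>" by (simp add: comp_assoc c1 del: comp_apply)
    also have "\<dots> = w \<circ> \<pi>" using \<rho> by (simp add: stab_def)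
    finally show "inv \<pi> \<circ> \<rho> \<circ> \<pi> \<in> stab n (w \<circ> \<pi>)"
      using \<rho> assms inv by (simp add: stab_def permutes_compose del: comp_apply) }
qed

text \<open>Choose inside \<open>b\<close> a set \<open>S'\<close> with the same number of
  occurrences of every letter of \<open>w\<close> as \<open>S\<close>. The labellings of a
  coordinate \<open>i\<close> by \<open>(w i, i \<in> S)\<close> and by
  \<open>(w i, i \<in> S')\<close> have equal fibre sizes, and a permutation matching them preserves
  \<open>w\<close> and carries \<open>S\<close> to \<open>S'\<close>.\<close>

lemma ex_stab_moving_into:
  fixes w :: "nat \<Rightarrow> nat"
  assumes w: "\<And>i. i \<in> {1..n} \<Longrightarrow> w i \<in> {1..m}" and S: "S \<subseteq> {1..n}"
    and b: "b \<subseteq> {1..n}" "\<And>c. c \<in> {1..m} \<Longrightarrow> card S \<le> card {i\<in>b. w i = c}"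
  shows "\<exists>\<tau>\<in>stab n w. \<tau> ` S \<subseteq> b"
proof -
  have finS: "finite S" using S finite_subset by blast
  have "\<exists>T. T \<subseteq> {i\<in>b. w i = c} \<and> card T = card {i\<in>S. w i = c}" if "c \<in> {1..m}" for c
  proof -
    have "card {i\<in>S. w i = c} \<le> card {i\<in>b. w i = c}"
      using card_mono[OF finS, of "{i\<in>S. w i = c}"] b(2)[OF that] by force
    then show ?thesis by (meson obtain_subset_with_card_n)
  qed
  then obtain T where T: "\<And>c. c \<in> {1..m} \<Longrightarrow> T c \<subseteq> {i\<in>b. w i = c}"
    "\<And>c. c \<in> {1..m} \<Longrightarrow> card (T c) = card {i\<in>S. w i = c}" by metis
  define S' where "S' = (\<Union>c\<in>{1..m}. T c)"
  have S'b: "S' \<subseteq> b" using T(1) unfolding S'_def by blast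
  have T': "{i\<in>S'. w i = c} = T c" if "c \<in> {1..m}" for c
    using T(1) that unfolding S'_def by blast
  have eq: "card {i\<in>S. w i = c} = card {i\<in>S'. w i = c}" for c
  proof (cases "c \<in> {1..m}")
    case True then show ?thesis using T' T(2) by simp
  next
    case False
    then have "{i\<in>S. w i = c} = {}" "{i\<in>S'. w i = c} = {}" using w S S'b b(1) by blast+
    then show ?thesis by (simp only:)
  qed
  have fib: "card {i\<in>{1..n}. (w i, i \<in> S) = y} = card {i\<in>{1..n}. (w i, i \<in> S') = y}" for y
  proof (cases y)
    case (Pair c t)
    have *: "{i\<in>{1..n}. (w i, i \<in> X) = (c, True)} = {i\<in>X. w i = c}"
      "{i\<in>{1..n}. (w i, i \<in> X) = (c, False)} = {i\<in>{1..n}. w i = c} - {i\<in>X. w i = c}"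
      if "X \<subseteq> {1..n}" for X using that by auto
    have S': "S' \<subseteq> {1..n}" using S'b b by blast
    have dif: "card ({i\<in>{1..n}. w i = c} - {i\<in>X. w i = c}) = card {i\<in>{1..n}. w i = c} - card {i\<in>X. w i = c}"
      if "X \<subseteq> {1..n}" for X
      using that finite_subset[OF that] by (intro card_Diff_subset) auto
    show ?thesis
    proof (cases t)
      case True
      then have y: "y = (c, True)" using Pair by simp
      show ?thesis unfolding y *[OF S] *[OF S'] by (rule eq)
    next
      case False
      then have y: "y = (c, False)" using Pair by simp
      show ?thesis unfolding y *[OF S] *[OF S'] dif[OF S] dif[OF S'] eq ..
    qed
  qed
  obtain \<tau> where \<tau>: "\<tau> permutes {1..n}" "\<forall>i\<in>{1..n}. (w i, i \<in> S) = (w (\<tau> i), \<tau> i \<in> S')"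
    using ex_permutes_of_card_fibres_eq[OF _ fib] by blast
  have "w (\<tau> i) = w i" for i
    using \<tau> by (cases "i \<in> {1..n}") (auto simp: permutes_not_in)
  then have "\<tau> \<in> stab n w" using \<tau>(1) by (auto simp: stab_def)
  moreover have "\<tau> ` S \<subseteq> b" using \<tau>(2) S S'b by blast
  ultimately show ?thesis by blast
qed

text \<open>Up to the factor \<open>card SS\<close>, \<open>KS\<close> is the joint weight of a
  triple in which the pair of vectors still has weight \<open>K\<close> (\<open>KS_SS\<close>), the
  set \<open>S\<close> is uniform and independent of \<open>w\<close> (\<open>KS_col\<close>), and
  \<open>x\<close> is constantly \<open>c0\<close> on \<open>S\<close>. Shuffling \<open>w\<close>
  inside \<open>S\<close> then does not change the weight, so \<open>h w\<close> may be replaced by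
  its average over \<open>S\<close>. Cauchy-Schwarz over triples finishes, and independence of
  \<open>S\<close> and \<open>w\<close> is what produces the plain average over all \<open>S\<close>
  on the right.\<close>

lemma (in orbit) shuffle_bound:
  fixes K :: "(nat \<Rightarrow> nat) \<Rightarrow> (nat \<Rightarrow> nat) \<Rightarrow> real"
  assumes nonneg: "\<And>x w. x \<in> U \<Longrightarrow> w \<in> U \<Longrightarrow> 0 \<le> K x w"
    and equiv: "\<And>x w \<pi>. x \<in> U \<Longrightarrow> w \<in> U \<Longrightarrow> \<pi> permutes {1..n} \<Longrightarrow> K (x \<circ> \<pi>) (w \<circ> \<pi>) = K x w"
    and row: "\<And>x. x \<in> U \<Longrightarrow> (\<Sum>w\<in>U. K x w) \<le> 1"
    and col: "\<And>w. w \<in> U \<Longrightarrow> (\<Sum>x\<in>U. K x w) \<le> 1"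
    and supp: "\<And>x w c. x \<in> U \<Longrightarrow> w \<in> U \<Longrightarrow> K x w \<noteq> 0 \<Longrightarrow> c \<in> {1..m} \<Longrightarrow>
      s \<le> card {i\<in>{1..n}. x i = c0 \<and> w i = c}"
    and s: "s \<le> n"
  shows "(\<Sum>x\<in>U. \<Sum>w\<in>U. K x w * h x * h w)\<^sup>2 \<le>
    ip U h h * ((\<Sum>S | S \<subseteq> {1..n} \<and> card S = s. ip U (perm_avg S h) (perm_avg S h)) / (n choose s))"
proof -
  define SS where "SS = {S. S \<subseteq> {1..n} \<and> card S = s}"
  have cSS: "card SS = n choose s" using n_subsets[of "{1..n}" s] by (simp add: SS_def)
  have finSS: "finite SS" unfolding SS_def by (rule finite_subset[of _ "Pow {1..n}"]) auto
  have SSpos: "real (card SS) > 0" using s by (simp add: cSS)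
  define A :: "(nat \<Rightarrow> nat) \<Rightarrow> nat set \<Rightarrow> real" where "A x S = of_bool (\<forall>i\<in>S. x i = c0)" for x S
  define Z where "Z w = real (card (stab n w))" for w :: "nat \<Rightarrow> nat"
  \<comment> \<open>The number of stabiliser elements that carry \<open>S\<close> into the positions
    where \<open>x\<close> has the letter \<open>c0\<close>. The factor \<open>Z w / R x w S\<close>
    makes the weight average to 1 over the stabiliser of \<open>w\<close>, and \<open>R\<close>
    itself is unchanged when an element of the stabiliser acts on \<open>x\<close> or on
    \<open>S\<close>.\<close>
  define R where "R x w S = (\<Sum>\<tau>\<in>stab n w. A (x \<circ> \<tau>) S)" for x S and w :: "nat \<Rightarrow> nat"
  define KS where "KS S x w = K x w * (A x S * Z w / R x w S)" for S x w
  have A_comp: "A (x \<circ> \<tau>) S = A x (\<tau> ` S)" for x \<tau> S by (simp add: A_def)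
  have A_nonneg: "A x S \<ge> 0" for x S by (simp add: A_def)
  have R_nonneg: "R x w S \<ge> 0" for x w S unfolding R_def by (simp add: sum_nonneg A_nonneg)
  have Zpos: "Z w > 0" for w
    using id_in_stab[of n w] finite_stab[of n w] by (auto simp: Z_def card_gt_0_iff)
  have Rpos: "R x w S > 0" if x: "x \<in> U" and w: "w \<in> U" and K: "K x w \<noteq> 0" and S: "S \<in> SS" for x w S
  proof -
    have *: "{i \<in> {i\<in>{1..n}. x i = c0}. w i = c} = {i\<in>{1..n}. x i = c0 \<and> w i = c}" for c by auto
    have "\<exists>\<tau>\<in>stab n w. \<tau> ` S \<subseteq> {i\<in>{1..n}. x i = c0}"
      using S supp[OF x w K] letters[OF w] unfolding SS_def
      by (intro ex_stab_moving_into[of n w m]) (simp_all only: *, auto)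
    then obtain \<tau> where \<tau>: "\<tau> \<in> stab n w" "\<tau> ` S \<subseteq> {i\<in>{1..n}. x i = c0}" by blast
    then have "A (x \<circ> \<tau>) S = 1" by (auto simp: A_def)
    then show ?thesis
      unfolding R_def using \<tau> by (intro sum_pos2[OF finite_stab \<tau>(1)]) (auto simp: A_nonneg)
  qed
  have R_comp: "R (x \<circ> \<tau>) w S = R x w S" if "\<tau> \<in> stab n w" for x w S \<tau>
    using sum_stab_comp_left[OF that, of "\<lambda>\<rho>. A (x \<circ> \<rho>) S"]
    by (simp add: R_def comp_assoc del: comp_apply)
  have R_image: "R x w (\<tau> ` S) = R x w S" if "\<tau> \<in> stab n w" for x w S \<tau>
    using sum_stab_comp_right[OF that, of "\<lambda>\<rho>. A (x \<circ> \<rho>) S"]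
    by (simp add: R_def A_comp[symmetric] comp_assoc del: comp_apply)
  have KS_nonneg: "KS S x w \<ge> 0" if "x \<in> U" "w \<in> U" for S x w
    using nonneg[OF that] A_nonneg R_nonneg Zpos[of w] by (simp add: KS_def)
  \<comment> \<open>For \<tau> in the stabiliser of \<open>w\<close>, replacing \<open>x\<close> by
    \<open>x \<circ> \<tau>\<close> alters only the indicator \<open>A\<close>. Averaging over
    \<tau> then cancels \<open>R\<close>.\<close>
  have KS_col: "(\<Sum>x\<in>U. KS S x w) = (\<Sum>x\<in>U. K x w)" if w: "w \<in> U" and S: "S \<in> SS" for w S
  proof -
    have shift: "(\<Sum>x\<in>U. KS S x w) = (\<Sum>x\<in>U. K x w * (A (x \<circ> \<tau>) S * Z w / R x w S))"
      if \<tau>: "\<tau> \<in> stab n w" for \<tau>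
    proof -
      have p: "\<tau> permutes {1..n}" "w \<circ> \<tau> = w" using \<tau> by (auto simp: stab_def)
      have "(\<Sum>x\<in>U. KS S x w) = (\<Sum>x\<in>U. KS S (x \<circ> \<tau>) w)" using sum_permute[OF p(1), of "\<lambda>x. KS S x w"] by simp
      also have "\<dots> = (\<Sum>x\<in>U. K x w * (A (x \<circ> \<tau>) S * Z w / R x w S))"
      proof (rule sum.cong)
        fix x assume "x \<in> U"
        then have "K (x \<circ> \<tau>) w = K x w" using equiv[OF _ w p(1)] p(2) by metis
        then show "KS S (x \<circ> \<tau>) w = K x w * (A (x \<circ> \<tau>) S * Z w / R x w S)"
          by (simp only: KS_def R_comp[OF \<tau>])
      qed simp
      finally show ?thesis .
    qed
    have "Z w * (\<Sum>x\<in>U. KS S x w) = (\<Sum>\<tau>\<in>stab n w. \<Sum>x\<in>U. KS S x w)" by (simp add: Z_def)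
    also have "\<dots> = (\<Sum>\<tau>\<in>stab n w. \<Sum>x\<in>U. K x w * (A (x \<circ> \<tau>) S * Z w / R x w S))"
      by (rule sum.cong[OF refl shift])
    also have "\<dots> = (\<Sum>x\<in>U. K x w * (R x w S * Z w / R x w S))"
      unfolding R_def by (subst sum.swap) (simp add: sum_distrib_left sum_distrib_right sum_divide_distrib)
    also have "\<dots> = (\<Sum>x\<in>U. K x w * Z w)"
    proof (rule sum.cong)
      fix x assume "x \<in> U"
      then show "K x w * (R x w S * Z w / R x w S) = K x w * Z w"
        using Rpos[OF _ w _ S, of x] by (cases "K x w = 0") auto
    qed simp
    finally show ?thesis using Zpos[of w] by (simp add: sum_distrib_right[symmetric])
  qed
  \<comment> \<open>The same averaging, with the stabiliser now moving \<open>S\<close> instead of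
    \<open>x\<close>.\<close>
  have KS_SS: "(\<Sum>S\<in>SS. KS S x w) = K x w * card SS" if x: "x \<in> U" and w: "w \<in> U" for x w
  proof (cases "K x w = 0")
    case True then show ?thesis by (simp add: KS_def)
  next
    case False
    let ?F = "\<lambda>S. A x S * Z w / R x w S"
    have shift: "(\<Sum>S\<in>SS. ?F S) = (\<Sum>S\<in>SS. A (x \<circ> \<tau>) S * Z w / R x w S)" if \<tau>: "\<tau> \<in> stab n w" for \<tau>
    proof -
      have p: "\<tau> permutes {1..n}" using \<tau> by (simp add: stab_def)
      have im: "\<rho> ` S \<in> SS" if "\<rho> permutes {1..n}" "S \<in> SS" for \<rho> S
        using that permutes_image[OF that(1)] card_image[OF inj_on_subset[OF permutes_inj[OF that(1)]], of S]
        by (auto simp: SS_def)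
      have "(\<Sum>S\<in>SS. ?F S) = (\<Sum>S\<in>SS. ?F (\<tau> ` S))"
      proof (rule sum.reindex_bij_witness[of _ "\<lambda>S. \<tau> ` S" "\<lambda>S. inv \<tau> ` S"])
        fix S assume "S \<in> SS"
        then show "\<tau> ` S \<in> SS" "inv \<tau> ` S \<in> SS" using im p permutes_inv[OF p] by auto
        show a: "\<tau> ` inv \<tau> ` S = S" "inv \<tau> ` \<tau> ` S = S"
          using permutes_inv_o[OF p] by (simp_all add: image_comp)
        show "?F (\<tau> ` inv \<tau> ` S) = ?F S" by (simp only: a)
      qed
      then show ?thesis by (simp only: R_image[OF \<tau>] A_comp)
    qed
    have "Z w * (\<Sum>S\<in>SS. ?F S) = (\<Sum>\<tau>\<in>stab n w. \<Sum>S\<in>SS. ?F S)" by (simp add: Z_def)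
    also have "\<dots> = (\<Sum>\<tau>\<in>stab n w. \<Sum>S\<in>SS. A (x \<circ> \<tau>) S * Z w / R x w S)"
      by (rule sum.cong[OF refl shift])
    also have "\<dots> = (\<Sum>S\<in>SS. R x w S * Z w / R x w S)"
      unfolding R_def by (subst sum.swap) (simp add: sum_distrib_left sum_distrib_right sum_divide_distrib)
    also have "\<dots> = (\<Sum>S\<in>SS. Z w)"
      using Rpos[OF x w False] by (intro sum.cong) force+
    finally have "(\<Sum>S\<in>SS. ?F S) = card SS" using Zpos[of w] by simp
    then show ?thesis unfolding KS_def by (simp only: sum_distrib_left[symmetric])
  qed
  \<comment> \<open>As \<open>x\<close> is constant on \<open>S\<close>, \<pi> fixes
    \<open>x\<close>, and equivariance of \<open>K\<close> applies with \<pi> acting on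
    \<open>w\<close> alone. The stabiliser of \<open>w \<circ> \<pi>\<close> is conjugate to that of
    \<open>w\<close>, which takes care of \<open>Z\<close> and \<open>R\<close>.\<close>
  have KS_comp: "KS S x (w \<circ> \<pi>) = KS S x w"
    if x: "x \<in> U" and w: "w \<in> U" and S: "S \<in> SS" and \<pi>: "\<pi> permutes S" for S x w \<pi>
  proof (cases "A x S = 0")
    case True then show ?thesis by (simp add: KS_def)
  next
    case False
    then have xS: "x i = c0" if "i \<in> S" for i using that by (auto simp: A_def)
    have p: "\<pi> permutes {1..n}" using \<pi> S permutes_subset by (auto simp: SS_def)
    have x\<pi>: "x \<circ> \<rho> = x" if "\<rho> permutes S" for \<rho>
    proof
      fix i show "(x \<circ> \<rho>) i = x i"
        using that xS permutes_in_image[OF that, of i] by (cases "i \<in> S") (auto simp: permutes_not_in)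
    qed
    have "K x (w \<circ> \<pi>) = K x w" using equiv[OF x w p] x\<pi>[OF \<pi>] by simp
    moreover have "Z (w \<circ> \<pi>) = Z w" using sum_stab_conj[OF p, of "\<lambda>_. 1::real" w] by (simp add: Z_def)
    moreover have "R x (w \<circ> \<pi>) S = R x w S"
    proof -
      have "A (x \<circ> (inv \<pi> \<circ> \<tau> \<circ> \<pi>)) S = A (x \<circ> \<tau>) S" for \<tau>
      proof -
        have "x \<circ> (inv \<pi> \<circ> \<tau> \<circ> \<pi>) = x \<circ> inv \<pi> \<circ> \<tau> \<circ> \<pi>" by (simp add: comp_assoc)
        also have "\<dots> = x \<circ> \<tau> \<circ> \<pi>" using x\<pi>[OF permutes_inv[OF \<pi>]] by simp
        finally show ?thesis using A_comp[of "x \<circ> \<tau>" \<pi> S] permutes_image[OF \<pi>] by simp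
      qed
      then show ?thesis unfolding R_def by (simp only: sum_stab_conj[OF p])
    qed
    ultimately show ?thesis by (simp add: KS_def)
  qed
  have KS_avg: "(\<Sum>w\<in>U. KS S x w * h w) = (\<Sum>w\<in>U. KS S x w * perm_avg S h w)"
    if x: "x \<in> U" and S: "S \<in> SS" for S x
  proof -
    have finS: "finite S" using S finite_subset by (auto simp: SS_def)
    let ?P = "{\<pi>. \<pi> permutes S}"
    have shift: "(\<Sum>w\<in>U. KS S x w * h (w \<circ> \<pi>)) = (\<Sum>w\<in>U. KS S x w * h w)" if "\<pi> \<in> ?P" for \<pi>
    proof -
      have p: "\<pi> permutes {1..n}" using that S permutes_subset by (auto simp: SS_def)
      have "(\<Sum>w\<in>U. KS S x w * h (w \<circ> \<pi>)) = (\<Sum>w\<in>U. KS S x (w \<circ> \<pi>) * h (w \<circ> \<pi>))"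
        using KS_comp[OF x _ S] that by (intro sum.cong) auto
      then show ?thesis using sum_permute[OF p, of "\<lambda>w. KS S x w * h w"] by simp
    qed
    have "(\<Sum>w\<in>U. KS S x w * perm_avg S h w) = (\<Sum>\<pi>\<in>?P. \<Sum>w\<in>U. KS S x w * h (w \<circ> \<pi>)) / fact (card S)"
      unfolding perm_avg_def by (subst sum.swap) (simp add: sum_distrib_left sum_divide_distrib)
    also have "\<dots> = (\<Sum>w\<in>U. KS S x w * h w)" using shift finS by (simp add: card_permutations)
    finally show ?thesis by simp
  qed
  define k where "k = (\<lambda>(S, x, w). KS S x w)"
  have split3: "(\<Sum>p\<in>SS \<times> U \<times> U. F p) = (\<Sum>S\<in>SS. \<Sum>x\<in>U. \<Sum>w\<in>U. F (S, x, w))"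
    for F :: "nat set \<times> (nat \<Rightarrow> nat) \<times> (nat \<Rightarrow> nat) \<Rightarrow> real"
    by (simp add: sum.cartesian_product split_def)
  let ?N = "real (card SS)"
  have le1: "a * (b * b) \<le> b * b" if "a \<le> 1" for a b :: real
    using mult_right_mono[OF that, of "b * b"] by simp
  have "?N * (\<Sum>x\<in>U. \<Sum>w\<in>U. K x w * h x * h w) = (\<Sum>x\<in>U. \<Sum>w\<in>U. (\<Sum>S\<in>SS. KS S x w) * h x * h w)"
    by (simp add: KS_SS sum_distrib_left mult_ac cong: sum.cong)
  also have "\<dots> = (\<Sum>S\<in>SS. \<Sum>x\<in>U. h x * (\<Sum>w\<in>U. KS S x w * h w))"
    unfolding sum_distrib_right sum_distrib_left
    by (subst sum.swap[of _ SS], subst sum.swap[of _ SS]) (simp add: mult_ac)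
  also have "\<dots> = (\<Sum>S\<in>SS. \<Sum>x\<in>U. h x * (\<Sum>w\<in>U. KS S x w * perm_avg S h w))"
    using KS_avg by (intro sum.cong) auto
  also have "\<dots> = (\<Sum>p\<in>SS \<times> U \<times> U. k p * (\<lambda>(S, x, w). h x) p * (\<lambda>(S, x, w). perm_avg S h w) p)"
    unfolding split3 k_def by (simp add: sum_distrib_left mult_ac)
  finally have eq: "?N * (\<Sum>x\<in>U. \<Sum>w\<in>U. K x w * h x * h w) = \<dots>" .
  have b1: "(\<Sum>p\<in>SS \<times> U \<times> U. k p * ((\<lambda>(S, x, w). h x) p)\<^sup>2) \<le> ?N * ip U h h"
  proof -
    have "(\<Sum>p\<in>SS \<times> U \<times> U. k p * ((\<lambda>(S, x, w). h x) p)\<^sup>2) = (\<Sum>S\<in>SS. \<Sum>x\<in>U. \<Sum>w\<in>U. KS S x w * (h x)\<^sup>2)"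
      unfolding split3 k_def by simp
    also have "\<dots> = (\<Sum>x\<in>U. \<Sum>w\<in>U. (\<Sum>S\<in>SS. KS S x w) * (h x)\<^sup>2)"
      unfolding sum_distrib_right by (subst sum.swap, subst sum.swap[of _ SS]) simp
    also have "\<dots> = ?N * (\<Sum>x\<in>U. (\<Sum>w\<in>U. K x w) * (h x)\<^sup>2)"
      by (simp add: KS_SS sum_distrib_left sum_distrib_right mult_ac cong: sum.cong)
    also have "\<dots> \<le> ?N * ip U h h"
      unfolding ip_def power2_eq_square using row by (intro mult_left_mono sum_mono le1) auto
    finally show ?thesis .
  qed
  have b2: "(\<Sum>p\<in>SS \<times> U \<times> U. k p * ((\<lambda>(S, x, w). perm_avg S h w) p)\<^sup>2) \<le>
      (\<Sum>S\<in>SS. ip U (perm_avg S h) (perm_avg S h))"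
  proof -
    have "(\<Sum>p\<in>SS \<times> U \<times> U. k p * ((\<lambda>(S, x, w). perm_avg S h w) p)\<^sup>2) =
        (\<Sum>S\<in>SS. \<Sum>x\<in>U. \<Sum>w\<in>U. KS S x w * (perm_avg S h w)\<^sup>2)"
      unfolding split3 k_def by simp
    also have "\<dots> = (\<Sum>S\<in>SS. \<Sum>w\<in>U. (\<Sum>x\<in>U. KS S x w) * (perm_avg S h w)\<^sup>2)"
      unfolding sum_distrib_right by (intro sum.cong refl sum.swap)
    also have "\<dots> = (\<Sum>S\<in>SS. \<Sum>w\<in>U. (\<Sum>x\<in>U. K x w) * (perm_avg S h w)\<^sup>2)"
      by (intro sum.cong refl) (simp add: KS_col)
    also have "\<dots> \<le> (\<Sum>S\<in>SS. ip U (perm_avg S h) (perm_avg S h))"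
      unfolding ip_def power2_eq_square using col by (intro sum_mono le1) auto
    finally show ?thesis .
  qed
  have "(?N * (\<Sum>x\<in>U. \<Sum>w\<in>U. K x w * h x * h w))\<^sup>2 \<le>
      (\<Sum>p\<in>SS \<times> U \<times> U. k p * ((\<lambda>(S, x, w). h x) p)\<^sup>2) *
      (\<Sum>p\<in>SS \<times> U \<times> U. k p * ((\<lambda>(S, x, w). perm_avg S h w) p)\<^sup>2)"
    unfolding eq by (rule weighted_Cauchy_Schwarz_sum) (auto simp: k_def KS_nonneg)
  also have "\<dots> \<le> (?N * ip U h h) * (\<Sum>S\<in>SS. ip U (perm_avg S h) (perm_avg S h))"
    using b1 b2 by (intro mult_mono) (auto intro!: sum_nonneg mult_nonneg_nonneg simp: k_def KS_nonneg ip_nonneg)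
  finally have "?N\<^sup>2 * (\<Sum>x\<in>U. \<Sum>w\<in>U. K x w * h x * h w)\<^sup>2 \<le>
      ?N\<^sup>2 * (ip U h h * ((\<Sum>S\<in>SS. ip U (perm_avg S h) (perm_avg S h)) / ?N))"
    using SSpos by (simp add: power2_eq_square mult_ac)
  moreover have "?N\<^sup>2 > 0" using SSpos by simp
  ultimately have "(\<Sum>x\<in>U. \<Sum>w\<in>U. K x w * h x * h w)\<^sup>2 \<le>
      ip U h h * ((\<Sum>S\<in>SS. ip U (perm_avg S h) (perm_avg S h)) / ?N)"
    by (simp only: mult_le_cancel_left_pos)
  then show ?thesis unfolding cSS unfolding SS_def .
qed

section \<open>Random sets of coordinates and their effect on pure juntas\<close>

lemma binomial_avoid_le:
  assumes "s \<le> n" "a \<le> n"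
  shows "real ((n - a) choose s) \<le> (1 - s / n) ^ a * (n choose s)"
  using assms(2)
proof (induction a)
  case (Suc a)
  let ?N = "n - a"
  have N: "?N \<ge> 1" "?N \<le> n" using Suc.prems by auto
  have \<theta>: "0 \<le> 1 - real s / n" using assms(1) by (cases "n = 0") (auto simp: divide_simps)
  have "real ?N * real ((?N - 1) choose s) = real (?N - s) * real (?N choose s)"
    using binomial_absorb_comp[of ?N s] by (metis of_nat_mult)
  then have "real ((?N - 1) choose s) = real (?N - s) / ?N * (?N choose s)"
    using N by (simp add: field_simps)
  \<comment> \<open>Excluding one more point from a ground set of \<open>n - a\<close> points costs
    the factor \<open>1 - s / (n - a)\<close>, which is at most \<open>1 - s / n\<close>.\<close>
  also have "\<dots> \<le> (1 - s / n) * (?N choose s)"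
  proof (cases "s \<le> ?N")
    case True
    have "real (?N - s) / ?N = 1 - s / ?N" using True N by (simp add: field_simps of_nat_diff)
    also have "\<dots> \<le> 1 - s / n" using N by (simp add: divide_left_mono)
    finally show ?thesis by (intro mult_right_mono) auto
  next
    case False
    then show ?thesis using \<theta> by (simp add: binomial_eq_0)
  qed
  also have "\<dots> \<le> (1 - s / n) * ((1 - s / n) ^ a * (n choose s))"
    using Suc \<theta> by (intro mult_left_mono) auto
  finally show ?case by (simp add: mult_ac)
qed simp

lemma card_subsets_avoiding_le:
  assumes "s \<le> n" "A \<subseteq> {1..n}"
  shows "real (card {S. S \<subseteq> {1..n} \<and> card S = s \<and> S \<inter> A = {}}) \<le> (1 - s / n) ^ card A * (n choose s)"
proof -
  have "{S. S \<subseteq> {1..n} \<and> card S = s \<and> S \<inter> A = {}} = {S. S \<subseteq> {1..n} - A \<and> card S = s}" by auto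
  moreover have "card ({1..n} - A) = n - card A" using assms(2) by (simp add: card_Diff_subset finite_subset)
  moreover have "card A \<le> n" using card_mono[OF _ assms(2)] by simp
  ultimately show ?thesis using binomial_avoid_le[OF assms(1)] by (simp add: n_subsets)
qed

lemma ex_permutes_pair:
  assumes "j \<in> X" "j' \<in> X" "l \<in> X" "l' \<in> X" "j \<noteq> j'" "l \<noteq> l'"
  shows "\<exists>\<pi>. \<pi> permutes X \<and> \<pi> j = l \<and> \<pi> j' = l'"
proof (intro exI conjI)
  let ?t = "Transposition.transpose j l j'"
  have t: "?t \<in> X" "?t \<noteq> l" using assms by (auto simp: Transposition.transpose_def)
  show "Transposition.transpose ?t l' \<circ> Transposition.transpose j l permutes X"
    using assms t(1) by (intro permutes_compose permutes_swap_id)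
  show "(Transposition.transpose ?t l' \<circ> Transposition.transpose j l) j = l" using t(2) assms(6) by (simp add: Transposition.transpose_def)
  show "(Transposition.transpose ?t l' \<circ> Transposition.transpose j l) j' = l'" by simp
qed

context orbit
begin

text \<open>The functions obtained from \<open>h\<close> by moving its coordinate \<open>i\<close>
  to the places \<open>j\<close> of \<open>X\<close> form a regular simplex: the permutations of
  \<open>X\<close> are doubly transitive, so all inner products of two different ones agree. Their
  sum depends on \<open>J - {i}\<close> only, hence is orthogonal to \<open>h\<close>, and this
  makes the common value nonpositive.\<close>

lemma pure_junta_transpose_ip_nonpos:
  assumes J: "J \<subseteq> {1..n}" and h: "junta n U J h" "pure n U (card J) h" and i: "i \<in> J"
    and jl: "j \<in> insert i ({1..n} - J)" "j' \<in> insert i ({1..n} - J)" "j \<noteq> j'"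
  shows "ip U (\<lambda>x. h (x \<circ> Transposition.transpose i j)) (\<lambda>x. h (x \<circ> Transposition.transpose i j')) \<le> 0"
proof -
  define X where "X = insert i ({1..n} - J)"
  define u where "u = (\<lambda>j x. h (x \<circ> Transposition.transpose i j))"
  have finX: "finite X" by (simp add: X_def)
  have finJ: "finite J" using J finite_subset by blast
  have X: "X \<subseteq> {1..n}" "{1..n} - (J - {i}) = X" using J i by (auto simp: X_def)
  have tr: "Transposition.transpose i j permutes {1..n}" if "j \<in> X" for j
    using that X i J by (intro permutes_swap_id) auto
  have shift: "u j (x \<circ> \<pi>) = u (\<pi> j) x" if "\<pi> permutes X" "j \<in> X" "x \<in> U" for \<pi> j x
  proof -
    have \<pi>: "\<pi> permutes {1..n}" using permutes_subset[OF that(1) X(1)] .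
    have \<pi>j: "\<pi> j \<in> X" using that permutes_in_image by metis
    have "(x \<circ> \<pi> \<circ> Transposition.transpose i j) k = (x \<circ> Transposition.transpose i (\<pi> j)) k" if k: "k \<in> J" for k
    proof (cases "k = i")
      case False
      then have "k \<notin> X" using k by (auto simp: X_def)
      then have "k \<noteq> j" "k \<noteq> \<pi> j" "\<pi> k = k"
        using \<open>j \<in> X\<close> \<pi>j permutes_not_in[OF \<open>\<pi> permutes X\<close>] by auto
      then show ?thesis using False by (simp add: Transposition.transpose_def)
    qed simp
    then show ?thesis
      unfolding u_def using closed tr \<pi> that(2,3) \<pi>j by (intro junta_eq[OF h(1) J]) auto
  qed
  have eqv: "ip U (u a) (u b) = ip U (u a') (u b')"
    if ab: "a \<in> X" "b \<in> X" "a' \<in> X" "b' \<in> X" "a \<noteq> b" "a' \<noteq> b'" for a b a' b'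
  proof -
    obtain \<pi> where \<pi>: "\<pi> permutes X" "\<pi> a = a'" "\<pi> b = b'"
      using ex_permutes_pair[OF ab] by blast
    have "ip U (u a') (u b') = ip U (\<lambda>x. u a (x \<circ> \<pi>)) (\<lambda>x. u b (x \<circ> \<pi>))"
      using shift[OF \<pi>(1)] ab \<pi> by (intro ip_cong) auto
    then show ?thesis using ip_permute[OF permutes_subset[OF \<pi>(1) X(1)]] by simp
  qed
  have "junta n U (J - {i}) (\<lambda>x. \<Sum>j\<in>X. u j x)"
    unfolding junta_def X
  proof (intro allI impI ballI)
    fix \<pi> x assume \<pi>: "\<pi> permutes X" and x: "x \<in> U"
    have "(\<Sum>j\<in>X. u j (x \<circ> \<pi>)) = (\<Sum>j\<in>X. u (\<pi> j) x)" using shift[OF \<pi> _ x] by simp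
    also have "\<dots> = (\<Sum>j\<in>X. u j x)" using sum.permute[OF \<pi>, of "\<lambda>j. u j x"] by (simp add: comp_def)
    finally show "(\<Sum>j\<in>X. u j (x \<circ> \<pi>)) = (\<Sum>j\<in>X. u j x)" .
  qed
  moreover have "card (J - {i}) < card J" using card_Diff1_less[OF finJ i] .
  ultimately have "ip U h (\<lambda>x. \<Sum>j\<in>X. u j x) = 0"
    using h(2) J unfolding pure_def by blast
  moreover have "ip U h (\<lambda>x. \<Sum>j\<in>X. u j x) = (\<Sum>j\<in>X. ip U h (u j))"
    unfolding ip_def sum_distrib_left by (rule sum.swap)
  moreover have "(\<Sum>j\<in>X. ip U h (u j)) = ip U h (u i) + (\<Sum>j\<in>X - {i}. ip U h (u j))"
    using finX by (intro sum.remove) (auto simp: X_def)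
  moreover have ui: "u i = h" by (simp add: u_def)
  moreover have "ip U h (u b) = ip U (u j) (u j')" if "b \<in> X - {i}" for b
    using eqv[of i b j j'] that jl by (auto simp: ui X_def[symmetric]) (auto simp: X_def)
  ultimately have "ip U h h + real (card (X - {i})) * ip U (u j) (u j') = 0" by simp
  moreover have "card (X - {i}) > 0"
  proof -
    have "X - {i} \<noteq> {}" using jl(1,2)[folded X_def] jl(3) by blast
    then show ?thesis using finX by (simp add: card_gt_0_iff)
  qed
  ultimately have "real (card (X - {i})) * ip U (u j) (u j') \<le> 0" "real (card (X - {i})) > 0"
    using ip_nonneg[of U h] by auto
  then show ?thesis by (simp add: u_def mult_le_0_iff)
qed

text \<open>Averaging over the permutations of \<open>S\<close> does not distinguish
  \<open>h\<close> from its copies with \<open>i\<close> moved to any \<open>j\<close> in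
  \<open>S - J\<close>, so \<open>h\<close> may be replaced by the mean of these copies. Their
  mutual inner products are nonpositive, so the squared norm of the mean is at most that of
  \<open>h\<close> divided by the number of copies.\<close>

lemma ip_perm_avg_pure_junta_le:
  assumes J: "J \<subseteq> {1..n}" and h: "junta n U J h" "pure n U (card J) h"
    and S: "S \<subseteq> {1..n}" "i \<in> S" "i \<in> J"
  shows "ip U (perm_avg S h) (perm_avg S h) \<le> ip U h h / (1 + card (S - J))"
proof -
  define S' where "S' = insert i (S - J)"
  define u where "u = (\<lambda>j x. h (x \<circ> Transposition.transpose i j))"
  have finS: "finite S" using S finite_subset by blast
  then have finS': "finite S'" by (simp add: S'_def)
  have cS': "card S' = 1 + card (S - J)" using finS S(3) by (simp add: S'_def)
  define c where "c = 1 / real (card S')"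
  have tr: "Transposition.transpose i j permutes S" if "j \<in> S'" for j
    using that S by (intro permutes_swap_id) (auto simp: S'_def)
  have "perm_avg S h x = perm_avg S (\<lambda>x. c * (\<Sum>j\<in>S'. u j x)) x" for x
  proof -
    have "perm_avg S (u j) x = perm_avg S h x" if "j \<in> S'" for j
      unfolding u_def by (rule perm_avg_of_comp[OF tr[OF that]])
    then have "perm_avg S (\<lambda>x. c * (\<Sum>j\<in>S'. u j x)) x = c * (\<Sum>j\<in>S'. perm_avg S h x)"
      by (simp only: perm_avg_scale perm_avg_sum cong: sum.cong)
    also have "\<dots> = perm_avg S h x" using cS' by (simp add: c_def)
    finally show ?thesis by simp
  qed
  then have "ip U (perm_avg S h) (perm_avg S h) =
      ip U (perm_avg S (\<lambda>x. c * (\<Sum>j\<in>S'. u j x))) (perm_avg S (\<lambda>x. c * (\<Sum>j\<in>S'. u j x)))"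
    by (intro ip_cong) auto
  also have "\<dots> \<le> ip U (\<lambda>x. c * (\<Sum>j\<in>S'. u j x)) (\<lambda>x. c * (\<Sum>j\<in>S'. u j x))"
    by (rule ip_perm_avg_self_le[OF S(1)])
  also have "\<dots> = c\<^sup>2 * (\<Sum>j\<in>S'. \<Sum>l\<in>S'. ip U (u j) (u l))"
  proof -
    have "ip U (\<lambda>x. c * (\<Sum>j\<in>S'. u j x)) (\<lambda>x. c * (\<Sum>j\<in>S'. u j x)) =
        c\<^sup>2 * (\<Sum>x\<in>U. \<Sum>j\<in>S'. \<Sum>l\<in>S'. u j x * u l x)"
      unfolding ip_scale_self unfolding ip_def sum_product[symmetric] ..
    also have "(\<Sum>x\<in>U. \<Sum>j\<in>S'. \<Sum>l\<in>S'. u j x * u l x) = (\<Sum>j\<in>S'. \<Sum>l\<in>S'. ip U (u j) (u l))"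
      unfolding ip_def by (subst sum.swap) (intro sum.cong refl sum.swap)
    finally show ?thesis .
  qed
  also have "\<dots> \<le> c\<^sup>2 * (\<Sum>j\<in>S'. ip U h h)"
  proof (intro mult_left_mono sum_mono)
    fix j assume j: "j \<in> S'"
    have "(\<Sum>l\<in>S'. ip U (u j) (u l)) = ip U (u j) (u j) + (\<Sum>l\<in>S' - {j}. ip U (u j) (u l))"
      using finS' j by (rule sum.remove)
    also have "ip U (u j) (u j) = ip U h h"
      unfolding u_def by (rule ip_permute[OF permutes_subset[OF tr[OF j] S(1)]])
    also have "(\<Sum>l\<in>S' - {j}. ip U (u j) (u l)) \<le> 0"
      unfolding u_def using j S
      by (intro sum_nonpos pure_junta_transpose_ip_nonpos[OF J h S(3)]) (auto simp: S'_def)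
    finally show "(\<Sum>l\<in>S'. ip U (u j) (u l)) \<le> ip U h h" by simp
  qed simp
  also have "\<dots> = ip U h h / (1 + card (S - J))"
  proof -
    have "1 + real (card (S - J)) = real (card S')" "card S' \<noteq> 0" using cS' by simp_all
    then show ?thesis by (simp add: c_def power2_eq_square)
  qed
  finally show ?thesis .
qed

text \<open>The three terms bound the chance that \<open>S\<close> misses \<open>J\<close>, the
  chance that \<open>S\<close> misses one of \<open>q\<close> disjoint blocks of \<open>D\<close>
  coordinates outside \<open>J\<close>, and the norm in the remaining case, where \<open>S\<close>
  has at least \<open>q\<close> points outside \<open>J\<close>. The blocks give a lower bound on
  \<open>card (S - J)\<close> from avoidance probabilities alone.\<close>

lemma avg_ip_perm_avg_pure_junta_le:
  assumes J: "J \<subseteq> {1..n}" and h: "junta n U J h" "pure n U (card J) h"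
    and s: "s \<le> n" and d: "d \<le> card J" and q: "1 \<le> q" "q * D \<le> n - card J"
  shows "(\<Sum>S | S \<subseteq> {1..n} \<and> card S = s. ip U (perm_avg S h) (perm_avg S h)) / (n choose s) \<le>
    ((1 - s / n) ^ d + q * (1 - s / n) ^ D + 1 / q) * ip U h h"
proof -
  define SS where "SS = {S. S \<subseteq> {1..n} \<and> card S = s}"
  define N where "N = ip U h h"
  let ?\<theta> = "1 - real s / n"
  have N: "N \<ge> 0" by (simp add: N_def ip_nonneg)
  have \<theta>: "0 \<le> ?\<theta>" "?\<theta> \<le> 1" using s by (cases "n = 0"; auto simp: divide_simps)+
  have finSS: "finite SS" unfolding SS_def by (rule finite_subset[of _ "Pow {1..n}"]) auto
  have cSS: "card SS = n choose s" using n_subsets[of "{1..n}" s] by (simp add: SS_def)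
  have "card ({1..n} - J) = n - card J" using J by (simp add: card_Diff_subset finite_subset)
  then obtain f where f: "bij_betw f {0..<n - card J} ({1..n} - J)"
    using ex_bij_betw_nat_finite[of "{1..n} - J"] by auto
  define A where "A r = f ` {r * D..<r * D + D}" for r
  have sub: "{r * D..<r * D + D} \<subseteq> {0..<n - card J}" if "r < q" for r
  proof -
    have "r * D + D \<le> q * D" using mult_le_mono1[of "Suc r" q D] that by simp
    then show ?thesis using q(2) by auto
  qed
  have AJ: "A r \<subseteq> {1..n} - J" if "r < q" for r
    using sub[OF that] f unfolding A_def bij_betw_def by blast
  have cA: "card (A r) = D" if "r < q" for r
    using f sub[OF that] unfolding A_def bij_betw_def by (subst card_image) (auto intro: inj_on_subset)
  have disjA: "A r \<inter> A r' = {}" if "r < q" "r' < q" "r \<noteq> r'" for r r'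
  proof -
    have "{r * D..<r * D + D} \<inter> {r' * D..<r' * D + D} = {}"
    proof (cases "r < r'")
      case True
      then have "r * D + D \<le> r' * D" using mult_le_mono1[of "Suc r" r' D] by simp
      then show ?thesis by auto
    next
      case False
      then have "r' * D + D \<le> r * D" using mult_le_mono1[of "Suc r'" r D] that by simp
      then show ?thesis by auto
    qed
    moreover have "inj_on f ({r * D..<r * D + D} \<union> {r' * D..<r' * D + D})"
      using f sub that unfolding bij_betw_def by (meson Un_least inj_on_subset)
    ultimately show ?thesis unfolding A_def by (metis image_empty inj_on_image_Int sup_ge1 sup_ge2)
  qed
  have point: "ip U (perm_avg S h) (perm_avg S h) \<le>
      N * (of_bool (S \<inter> J = {}) + (\<Sum>r<q. of_bool (S \<inter> A r = {})) + 1 / q)" if "S \<in> SS" for S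
  proof (cases "S \<inter> J = {} \<or> (\<exists>r<q. S \<inter> A r = {})")
    case True
    have "1 \<le> of_bool (S \<inter> J = {}) + (\<Sum>r<q. of_bool (S \<inter> A r = {})) + 1 / real q"
    proof (cases "S \<inter> J = {}")
      case False
      then obtain r where "r < q" "S \<inter> A r = {}" using True by blast
      then have "1 \<le> (\<Sum>r<q. of_bool (S \<inter> A r = {}) :: real)"
        using member_le_sum[of r "{..<q}" "\<lambda>r. of_bool (S \<inter> A r = {}) :: real"] by simp
      moreover have "0 \<le> 1 / real q" "0 \<le> (of_bool (S \<inter> J = {}) :: real)" by simp_all
      ultimately show ?thesis using False by linarith
    qed (simp add: sum_nonneg)
    then have "N * 1 \<le> N * (of_bool (S \<inter> J = {}) + (\<Sum>r<q. of_bool (S \<inter> A r = {})) + 1 / real q)"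
      using N by (intro mult_left_mono) auto
    then show ?thesis using ip_perm_avg_self_le[of S h] that by (simp add: N_def SS_def)
  next
    case False
    then obtain i where i: "i \<in> S" "i \<in> J" by blast
    have finS: "finite S" using that finite_subset by (auto simp: SS_def)
    have "q = (\<Sum>r<q. 1)" by simp
    also have "\<dots> \<le> (\<Sum>r<q. card (S \<inter> A r))"
      using False finS by (intro sum_mono) (simp add: Suc_le_eq card_gt_0_iff)
    also have "\<dots> = card (\<Union>r<q. S \<inter> A r)"
      using finS disjA by (intro card_UN_disjoint[symmetric]) auto
    also have "\<dots> \<le> card (S - J)" using finS AJ by (intro card_mono) auto
    finally have qle: "q \<le> card (S - J)" .
    have "ip U (perm_avg S h) (perm_avg S h) \<le> N / (1 + card (S - J))"
      using ip_perm_avg_pure_junta_le[OF J h _ i] that by (simp add: SS_def N_def)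
    also have "\<dots> \<le> N / q" using qle q(1) N by (intro divide_left_mono) auto
    also have "\<dots> \<le> N * (of_bool (S \<inter> J = {}) + (\<Sum>r<q. of_bool (S \<inter> A r = {})) + 1 / q)"
      using N by (simp add: algebra_simps sum_nonneg)
    finally show ?thesis .
  qed
  have avoid: "(\<Sum>S\<in>SS. of_bool (S \<inter> X = {}) :: real) \<le> ?\<theta> ^ card X * (n choose s)" if "X \<subseteq> {1..n}" for X
  proof -
    have "(\<Sum>S\<in>SS. of_bool (S \<inter> X = {}) :: real) = card (SS \<inter> {S. S \<inter> X = {}})"
      using finSS by (simp add: sum_of_bool_eq)
    also have "SS \<inter> {S. S \<inter> X = {}} = {S. S \<subseteq> {1..n} \<and> card S = s \<and> S \<inter> X = {}}"
      by (auto simp: SS_def)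
    finally show ?thesis using card_subsets_avoiding_le[OF s that] by simp
  qed
  let ?B = "real (n choose s)"
  have B: "?B > 0" using s by simp
  have "(\<Sum>S\<in>SS. ip U (perm_avg S h) (perm_avg S h)) \<le>
      (\<Sum>S\<in>SS. N * (of_bool (S \<inter> J = {}) + (\<Sum>r<q. of_bool (S \<inter> A r = {})) + 1 / q))"
    by (rule sum_mono[OF point])
  also have "\<dots> = N * ((\<Sum>S\<in>SS. of_bool (S \<inter> J = {})) + (\<Sum>r<q. \<Sum>S\<in>SS. of_bool (S \<inter> A r = {})) + ?B / q)"
    unfolding sum_distrib_left[symmetric] sum.distrib
    by (subst sum.swap[of _ "{..<q}"]) (simp add: cSS)
  also have "\<dots> \<le> N * (?\<theta> ^ d * ?B + (\<Sum>r<q. ?\<theta> ^ D * ?B) + ?B / q)"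
  proof (intro mult_left_mono add_mono sum_mono N order_refl)
    have "?\<theta> ^ card J * ?B \<le> ?\<theta> ^ d * ?B"
      using \<theta> d by (intro mult_right_mono power_decreasing) auto
    then show "(\<Sum>S\<in>SS. of_bool (S \<inter> J = {})) \<le> ?\<theta> ^ d * ?B" using avoid[OF J] by linarith
    fix r assume "r \<in> {..<q}"
    then show "(\<Sum>S\<in>SS. of_bool (S \<inter> A r = {})) \<le> ?\<theta> ^ D * ?B"
      using avoid[of "A r"] AJ[of r] cA[of r] by auto
  qed
  finally have "(\<Sum>S\<in>SS. ip U (perm_avg S h) (perm_avg S h)) / ?B \<le>
      N * (?\<theta> ^ d * ?B + (\<Sum>r<q. ?\<theta> ^ D * ?B) + ?B / q) / ?B"
    using B by (intro divide_right_mono) auto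
  also have "\<dots> = (?\<theta> ^ d + q * ?\<theta> ^ D + 1 / q) * N" using B by (simp add: field_simps)
  finally show ?thesis unfolding SS_def N_def .
qed

end

section \<open>Equivariant Markov kernels\<close>

text \<open>A stochastic kernel that commutes with the symmetric group; the column sums say that it
  carries the uniform law on \<open>A\<close> to the uniform law on \<open>B\<close>.\<close>

definition markov :: "nat \<Rightarrow> (nat \<Rightarrow> nat) set \<Rightarrow> (nat \<Rightarrow> nat) set \<Rightarrow>
    ((nat \<Rightarrow> nat) \<Rightarrow> (nat \<Rightarrow> nat) \<Rightarrow> real) \<Rightarrow> bool" where
  "markov n A B K \<longleftrightarrow> (\<forall>a\<in>A. \<forall>b\<in>B. 0 \<le> K a b) \<and> (\<forall>a\<in>A. (\<Sum>b\<in>B. K a b) = 1) \<and>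
    (\<forall>b\<in>B. (\<Sum>a\<in>A. K a b) = card A / card B) \<and>
    (\<forall>\<pi>. \<pi> permutes {1..n} \<longrightarrow> (\<forall>a\<in>A. \<forall>b\<in>B. K (a \<circ> \<pi>) (b \<circ> \<pi>) = K a b))"

definition app :: "'b set \<Rightarrow> ('a \<Rightarrow> 'b \<Rightarrow> real) \<Rightarrow> ('b \<Rightarrow> real) \<Rightarrow> 'a \<Rightarrow> real" where
  "app B K g a = (\<Sum>b\<in>B. K a b * g b)"

definition kcomp :: "'b set \<Rightarrow> ('a \<Rightarrow> 'b \<Rightarrow> real) \<Rightarrow> ('b \<Rightarrow> 'c \<Rightarrow> real) \<Rightarrow> 'a \<Rightarrow> 'c \<Rightarrow> real" where
  "kcomp B K L a c = (\<Sum>b\<in>B. K a b * L b c)"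

definition letter :: "nat \<Rightarrow> nat \<Rightarrow> (nat \<Rightarrow> nat) \<Rightarrow> real" where
  "letter i c x = of_bool (x i = c)"

lemma letter_bounds: "0 \<le> letter i c x" "letter i c x \<le> 1"
  by (simp_all add: letter_def)

lemma app_kcomp: "app C (kcomp B K L) g a = app B K (app C L g) a"
  unfolding app_def kcomp_def sum_distrib_left sum_distrib_right
  by (subst sum.swap) (simp add: mult_ac)

lemma app_sum: "app B K (\<lambda>b. \<Sum>i\<in>I. f i b) a = (\<Sum>i\<in>I. app B K (f i) a)"
  unfolding app_def sum_distrib_left by (rule sum.swap)

lemma app_scale: "app B K (\<lambda>b. c * f b) a = c * app B K f a"
  by (simp add: app_def sum_distrib_left mult_ac)

lemma app_diff: "app B K (\<lambda>b. f b - g b) a = app B K f a - app B K g a"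
  by (simp add: app_def right_diff_distrib sum_subtractf)

lemma app_cong: "(\<And>b. b \<in> B \<Longrightarrow> f b = g b) \<Longrightarrow> app B K f a = app B K g a"
  by (simp add: app_def cong: sum.cong)

lemma markovD:
  assumes "markov n A B K"
  shows "\<And>a b. a \<in> A \<Longrightarrow> b \<in> B \<Longrightarrow> 0 \<le> K a b" "\<And>a. a \<in> A \<Longrightarrow> (\<Sum>b\<in>B. K a b) = 1"
    "\<And>b. b \<in> B \<Longrightarrow> (\<Sum>a\<in>A. K a b) = card A / card B"
    "\<And>\<pi> a b. \<pi> permutes {1..n} \<Longrightarrow> a \<in> A \<Longrightarrow> b \<in> B \<Longrightarrow> K (a \<circ> \<pi>) (b \<circ> \<pi>) = K a b"
  using assms unfolding markov_def by blast+

lemma app_mono: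
  assumes "markov n A B K" "a \<in> A" "\<And>b. b \<in> B \<Longrightarrow> f b \<le> g b"
  shows "app B K f a \<le> app B K g a"
  unfolding app_def using assms markovD(1)[OF assms(1,2)] by (intro sum_mono mult_left_mono) auto

lemma app_bounds:
  assumes "markov n A B K" "a \<in> A" "\<And>b. b \<in> B \<Longrightarrow> 0 \<le> f b" "\<And>b. b \<in> B \<Longrightarrow> f b \<le> 1"
  shows "0 \<le> app B K f a" "app B K f a \<le> 1"
proof -
  show "0 \<le> app B K f a" using app_mono[OF assms(1,2), of "\<lambda>_. 0" f] assms(3) by (simp add: app_def)
  show "app B K f a \<le> 1"
    using app_mono[OF assms(1,2), of f "\<lambda>_. 1"] assms(4) markovD(2)[OF assms(1,2)] by (simp add: app_def)
qed

lemma sum_abs_app_le: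
  assumes "markov n A B K"
  shows "(\<Sum>a\<in>A. \<bar>app B K g a\<bar>) \<le> card A / card B * (\<Sum>b\<in>B. \<bar>g b\<bar>)"
proof -
  have "(\<Sum>a\<in>A. \<bar>app B K g a\<bar>) \<le> (\<Sum>a\<in>A. \<Sum>b\<in>B. K a b * \<bar>g b\<bar>)"
    unfolding app_def using markovD(1)[OF assms]
    by (intro sum_mono order_trans[OF sum_abs]) (auto simp: abs_mult intro!: sum_mono)
  also have "\<dots> = (\<Sum>b\<in>B. (\<Sum>a\<in>A. K a b) * \<bar>g b\<bar>)" unfolding sum_distrib_right by (rule sum.swap)
  also have "\<dots> = card A / card B * (\<Sum>b\<in>B. \<bar>g b\<bar>)"
    by (simp add: markovD(3)[OF assms] sum_distrib_left cong: sum.cong)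
  finally show ?thesis .
qed

lemma markov_kcomp:
  assumes "orbit n mA A" "orbit n mB B" "orbit n mC C" and K: "markov n A B K" and L: "markov n B C L"
  shows "markov n A C (kcomp B K L)"
  unfolding markov_def
proof (intro conjI ballI allI impI)
  interpret B: orbit n mB B by fact
  fix a assume a: "a \<in> A"
  { fix c assume c: "c \<in> C"
    show "0 \<le> kcomp B K L a c"
      unfolding kcomp_def using a c markovD(1)[OF K] markovD(1)[OF L] by (intro sum_nonneg) auto }
  have "(\<Sum>c\<in>C. kcomp B K L a c) = (\<Sum>b\<in>B. K a b * (\<Sum>c\<in>C. L b c))"
    unfolding kcomp_def sum_distrib_left by (rule sum.swap)
  also have "\<dots> = 1" using markovD(2)[OF L] markovD(2)[OF K a] by simp
  finally show "(\<Sum>c\<in>C. kcomp B K L a c) = 1" .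
next
  interpret B: orbit n mB B by fact
  fix c assume c: "c \<in> C"
  have "(\<Sum>a\<in>A. kcomp B K L a c) = (\<Sum>b\<in>B. (\<Sum>a\<in>A. K a b) * L b c)"
    unfolding kcomp_def sum_distrib_right by (rule sum.swap)
  also have "\<dots> = card A / card B * (\<Sum>b\<in>B. L b c)"
    using markovD(3)[OF K] by (simp add: sum_distrib_left)
  also have "\<dots> = card A / card C" using markovD(3)[OF L c] B.card_pos by simp
  finally show "(\<Sum>a\<in>A. kcomp B K L a c) = card A / card C" .
next
  interpret B: orbit n mB B by fact
  fix \<pi> a c assume \<pi>: "\<pi> permutes {1..n}" and "a \<in> A" "c \<in> C"
  have "kcomp B K L (a \<circ> \<pi>) (c \<circ> \<pi>) = (\<Sum>b\<in>B. K (a \<circ> \<pi>) (b \<circ> \<pi>) * L (b \<circ> \<pi>) (c \<circ> \<pi>))"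
    unfolding kcomp_def using B.sum_permute[OF \<pi>, of "\<lambda>b. K (a \<circ> \<pi>) b * L b (c \<circ> \<pi>)"] by simp
  also have "\<dots> = kcomp B K L a c"
    unfolding kcomp_def using markovD(4)[OF K \<pi> \<open>a \<in> A\<close>] markovD(4)[OF L \<pi> _ \<open>c \<in> C\<close>] by simp
  finally show "kcomp B K L (a \<circ> \<pi>) (c \<circ> \<pi>) = kcomp B K L a c" .
qed

lemma junta_app:
  assumes "orbit n mB B" and equiv: "\<And>\<pi> a b. \<pi> permutes {1..n} \<Longrightarrow> a \<in> A \<Longrightarrow> b \<in> B \<Longrightarrow> K (a \<circ> \<pi>) (b \<circ> \<pi>) = K a b"
    and g: "junta n B J g"
  shows "junta n A J (app B K g)"
  unfolding junta_def
proof (intro allI impI ballI)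
  interpret B: orbit n mB B by fact
  fix \<pi> a assume \<pi>: "\<pi> permutes {1..n} - J" and a: "a \<in> A"
  have p: "\<pi> permutes {1..n}" using \<pi> by (rule permutes_subset) auto
  have "app B K g (a \<circ> \<pi>) = (\<Sum>b\<in>B. K (a \<circ> \<pi>) (b \<circ> \<pi>) * g (b \<circ> \<pi>))"
    unfolding app_def using B.sum_permute[OF p, of "\<lambda>b. K (a \<circ> \<pi>) b * g b"] by simp
  also have "\<dots> = app B K g a"
    unfolding app_def using g \<pi> equiv[OF p a] by (intro sum.cong) (auto simp: junta_def)
  finally show "app B K g (a \<circ> \<pi>) = app B K g a" .
qed

lemma (in orbit) junta_letter: "i \<in> {1..n} \<Longrightarrow> junta n U {i} (letter i c)"
  by (rule juntaI) (auto simp: letter_def)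

lemma (in orbit) single_junta_expand:
  assumes u: "junta n U {i} u" and i: "i \<in> {1..n}" and bnd: "\<And>x. x \<in> U \<Longrightarrow> 0 \<le> u x \<and> u x \<le> 1"
  shows "\<exists>p. (\<forall>l. 0 \<le> p l \<and> p l \<le> 1) \<and> (\<forall>x\<in>U. u x = (\<Sum>l\<in>{1..m}. p l * letter i l x))"
proof -
  \<comment> \<open>A letter that never occurs at \<open>i\<close> gets the coefficient 0, so that
    all coefficients stay between 0 and 1.\<close>
  define p where "p l = (if \<exists>x\<in>U. x i = l then u (SOME x. x \<in> U \<and> x i = l) else 0)" for l
  have px: "p (x i) = u x" if "x \<in> U" for x
  proof -
    have ex: "\<exists>y. y \<in> U \<and> y i = x i" using that by blast
    from someI_ex[OF this] have "u (SOME y. y \<in> U \<and> y i = x i) = u x"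
      using that i by (intro junta_eq[OF u]) auto
    then show ?thesis using ex by (auto simp: p_def)
  qed
  have "0 \<le> p l \<and> p l \<le> 1" for l
    using px bnd by (cases "\<exists>x\<in>U. x i = l") (force, simp add: p_def)
  moreover have "u x = (\<Sum>l\<in>{1..m}. p l * letter i l x)" if "x \<in> U" for x
  proof -
    have "(\<Sum>l\<in>{1..m}. p l * letter i l x) = (\<Sum>l\<in>{1..m}. if x i = l then p l else 0)"
      by (intro sum.cong) (auto simp: letter_def)
    also have "\<dots> = p (x i)" using letters[OF that i] by (simp add: sum.delta')
    finally show ?thesis using px[OF that] by simp
  qed
  ultimately show ?thesis by blast
qed

section \<open>Letter transitions and near-independence of two coordinates\<close>

definition letter_bound :: "nat \<Rightarrow> (nat \<Rightarrow> nat) set \<Rightarrow> (nat \<Rightarrow> nat) set \<Rightarrow>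
    ((nat \<Rightarrow> nat) \<Rightarrow> (nat \<Rightarrow> nat) \<Rightarrow> real) \<Rightarrow> real \<Rightarrow> nat \<Rightarrow> nat \<Rightarrow> bool" where
  "letter_bound n A B K \<beta> l c \<longleftrightarrow> (\<forall>i\<in>{1..n}. \<forall>a\<in>A. a i = l \<longrightarrow> \<beta> \<le> app B K (letter i c) a)"

text \<open>Only the transitions through the intermediate letter \<open>b\<close> are kept.\<close>

lemma letter_bound_kcomp:
  assumes K: "markov n A B K" and L: "markov n B C L" and "0 \<le> \<beta>'"
    and bK: "letter_bound n A B K \<beta> l b" and bL: "letter_bound n B C L \<beta>' b c"
  shows "letter_bound n A C (kcomp B K L) (\<beta> * \<beta>') l c"
  unfolding letter_bound_def
proof (intro ballI impI)
  fix i a assume i: "i \<in> {1..n}" and a: "a \<in> A" "a i = l"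
  have pos: "0 \<le> app C L (letter i c) y" if "y \<in> B" for y
    by (rule app_bounds(1)[OF L that letter_bounds])
  have "\<beta> * \<beta>' \<le> app B K (letter i b) a * \<beta>'"
    using bK i a \<open>0 \<le> \<beta>'\<close> by (intro mult_right_mono) (auto simp: letter_bound_def)
  also have "\<dots> = app B K (\<lambda>y. \<beta>' * letter i b y) a" by (simp add: app_scale)
  also have "\<dots> \<le> app B K (app C L (letter i c)) a"
    using bL i pos by (intro app_mono[OF K a(1)]) (auto simp: letter_bound_def letter_def)
  finally show "\<beta> * \<beta>' \<le> app C (kcomp B K L) (letter i c) a" by (simp add: app_kcomp)
qed

text \<open>How far a kernel is from acting independently on two distinct coordinates, in \<open>L\<^sup>1\<close>.\<close>

definition defect_le :: "nat \<Rightarrow> (nat \<Rightarrow> nat) set \<Rightarrow> (nat \<Rightarrow> nat) set \<Rightarrow>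
    ((nat \<Rightarrow> nat) \<Rightarrow> (nat \<Rightarrow> nat) \<Rightarrow> real) \<Rightarrow> real \<Rightarrow> bool" where
  "defect_le n A B K \<eta> \<longleftrightarrow> (\<forall>i\<in>{1..n}. \<forall>j\<in>{1..n}. i \<noteq> j \<longrightarrow> (\<forall>c c'.
    (\<Sum>a\<in>A. \<bar>app B K (\<lambda>w. letter i c w * letter j c' w) a - app B K (letter i c) a * app B K (letter j c') a\<bar>)
      \<le> \<eta> * card A))"

text \<open>The defect of the composition splits in two. The defect of \<open>L\<close>, pushed
  through \<open>K\<close>, does not grow because \<open>K\<close> contracts the
  \<open>L\<^sup>1\<close> norm. In the other part \<open>L\<close> sends the indicator of a letter
  at \<open>i\<close> to a function of the letter at \<open>i\<close>; expanding it in letters with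
  coefficients in the unit interval leaves \<open>mB * mB\<close> defects of
  \<open>K\<close>.\<close>

lemma defect_le_kcomp:
  assumes A: "orbit n mA A" and B: "orbit n mB B" and C: "orbit n mC C"
    and K: "markov n A B K" and L: "markov n B C L"
    and dK: "defect_le n A B K \<eta>" and dL: "defect_le n B C L \<eta>'"
  shows "defect_le n A C (kcomp B K L) (\<eta>' + (real mB)\<^sup>2 * \<eta>)"
  unfolding defect_le_def
proof (intro ballI impI allI)
  interpret B: orbit n mB B by fact
  interpret C: orbit n mC C by fact
  fix i j c c' assume i: "i \<in> {1..n}" and j: "j \<in> {1..n}" and ij: "i \<noteq> j"
  define u where "u = app C L (letter i c)"
  define v where "v = app C L (letter j c')"
  define w where "w = app C L (\<lambda>x. letter i c x * letter j c' x)"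
  have exp: "\<exists>p. (\<forall>l. 0 \<le> p l \<and> p l \<le> 1) \<and> (\<forall>x\<in>B. app C L (letter i c) x = (\<Sum>l\<in>{1..mB}. p l * letter i l x))"
    if "i \<in> {1..n}" for i c
  proof (rule B.single_junta_expand[OF _ that])
    show "junta n B {i} (app C L (letter i c))"
      using markovD(4)[OF L] by (intro junta_app[OF C _ C.junta_letter[OF that]])
    show "0 \<le> app C L (letter i c) x \<and> app C L (letter i c) x \<le> 1" if "x \<in> B" for x
      using app_bounds[OF L that, of "letter i c"] letter_bounds by blast
  qed
  obtain p where p: "\<And>l. 0 \<le> p l \<and> p l \<le> 1" "\<And>x. x \<in> B \<Longrightarrow> u x = (\<Sum>l\<in>{1..mB}. p l * letter i l x)"
    using exp[OF i] unfolding u_def by metis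
  obtain p' where p': "\<And>l. 0 \<le> p' l \<and> p' l \<le> 1" "\<And>x. x \<in> B \<Longrightarrow> v x = (\<Sum>l\<in>{1..mB}. p' l * letter j l x)"
    using exp[OF j] unfolding v_def by metis
  define E where "E l l' a = app B K (\<lambda>w. letter i l w * letter j l' w) a - app B K (letter i l) a * app B K (letter j l') a"
    for l l' a
  have uv: "app B K (\<lambda>x. u x * v x) a - app B K u a * app B K v a = (\<Sum>l\<in>{1..mB}. \<Sum>l'\<in>{1..mB}. p l * p' l' * E l l' a)"
    for a
  proof -
    have "app B K (\<lambda>x. u x * v x) a = app B K (\<lambda>x. \<Sum>l\<in>{1..mB}. \<Sum>l'\<in>{1..mB}. (p l * p' l') * (letter i l x * letter j l' x)) a"
      by (intro app_cong, simp only: p(2) p'(2) sum_product, intro sum.cong refl) (simp only: mult_ac)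
    also have "\<dots> = (\<Sum>l\<in>{1..mB}. \<Sum>l'\<in>{1..mB}. (p l * p' l') * app B K (\<lambda>x. letter i l x * letter j l' x) a)"
      by (simp only: app_sum app_scale)
    finally have 1: "app B K (\<lambda>x. u x * v x) a = \<dots>" .
    have "app B K u a = app B K (\<lambda>x. \<Sum>l\<in>{1..mB}. p l * letter i l x) a" by (rule app_cong[OF p(2)])
    then have u': "app B K u a = (\<Sum>l\<in>{1..mB}. p l * app B K (letter i l) a)" by (simp only: app_sum app_scale)
    have "app B K v a = app B K (\<lambda>x. \<Sum>l\<in>{1..mB}. p' l * letter j l x) a" by (rule app_cong[OF p'(2)])
    then have v': "app B K v a = (\<Sum>l\<in>{1..mB}. p' l * app B K (letter j l) a)" by (simp only: app_sum app_scale)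
    have 2: "app B K u a * app B K v a =
        (\<Sum>l\<in>{1..mB}. \<Sum>l'\<in>{1..mB}. (p l * p' l') * (app B K (letter i l) a * app B K (letter j l') a))"
      unfolding u' v' sum_product by (intro sum.cong refl) (simp only: mult_ac)
    show ?thesis unfolding 1 2 E_def by (simp add: sum_subtractf right_diff_distrib)
  qed
  have "(\<Sum>a\<in>A. \<bar>app C (kcomp B K L) (\<lambda>w. letter i c w * letter j c' w) a -
      app C (kcomp B K L) (letter i c) a * app C (kcomp B K L) (letter j c') a\<bar>)
    \<le> (\<Sum>a\<in>A. \<bar>app B K (\<lambda>x. w x - u x * v x) a\<bar> + \<bar>app B K (\<lambda>x. u x * v x) a - app B K u a * app B K v a\<bar>)"
    by (intro sum_mono) (simp add: app_kcomp app_diff u_def[symmetric] v_def[symmetric] w_def[symmetric])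
  also have "\<dots> = (\<Sum>a\<in>A. \<bar>app B K (\<lambda>x. w x - u x * v x) a\<bar>) +
      (\<Sum>a\<in>A. \<bar>\<Sum>l\<in>{1..mB}. \<Sum>l'\<in>{1..mB}. p l * p' l' * E l l' a\<bar>)"
    unfolding uv sum.distrib ..
  also have "\<dots> \<le> card A / card B * (\<Sum>b\<in>B. \<bar>w b - u b * v b\<bar>) + (\<Sum>a\<in>A. \<Sum>l\<in>{1..mB}. \<Sum>l'\<in>{1..mB}. \<bar>E l l' a\<bar>)"
  proof (intro add_mono sum_abs_app_le[OF K] sum_mono)
    fix a
    have "\<bar>p l * p' l' * E l l' a\<bar> \<le> \<bar>E l l' a\<bar>" for l l'
    proof -
      have "p l * p' l' \<le> 1" using p(1)[of l] p'(1)[of l'] by (simp add: mult_le_one)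
      then show ?thesis using p(1)[of l] p'(1)[of l'] by (simp add: abs_mult mult_left_le_one_le)
    qed
    then show "\<bar>\<Sum>l\<in>{1..mB}. \<Sum>l'\<in>{1..mB}. p l * p' l' * E l l' a\<bar> \<le> (\<Sum>l\<in>{1..mB}. \<Sum>l'\<in>{1..mB}. \<bar>E l l' a\<bar>)"
      by (intro order_trans[OF sum_abs] sum_mono)
  qed
  also have "(\<Sum>a\<in>A. \<Sum>l\<in>{1..mB}. \<Sum>l'\<in>{1..mB}. \<bar>E l l' a\<bar>) = (\<Sum>l\<in>{1..mB}. \<Sum>l'\<in>{1..mB}. \<Sum>a\<in>A. \<bar>E l l' a\<bar>)"
    by (subst sum.swap) (intro sum.cong refl sum.swap)
  also have "card A / card B * (\<Sum>b\<in>B. \<bar>w b - u b * v b\<bar>) + \<dots> \<le>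
      card A / card B * (\<eta>' * card B) + (\<Sum>l\<in>{1..mB}. \<Sum>l'\<in>{1..mB}. \<eta> * card A)"
  proof (intro add_mono mult_left_mono sum_mono)
    show "(\<Sum>b\<in>B. \<bar>w b - u b * v b\<bar>) \<le> \<eta>' * card B"
      unfolding u_def v_def w_def by (rule dL[unfolded defect_le_def, rule_format, OF i j ij])
    fix l l'
    show "(\<Sum>a\<in>A. \<bar>E l l' a\<bar>) \<le> \<eta> * card A"
      unfolding E_def by (rule dK[unfolded defect_le_def, rule_format, OF i j ij])
  qed simp
  also have "\<dots> = (\<eta>' + (real mB)\<^sup>2 * \<eta>) * card A"
    using B.card_pos by (simp add: field_simps power2_eq_square)
  finally show "(\<Sum>a\<in>A. \<bar>app C (kcomp B K L) (\<lambda>w. letter i c w * letter j c' w) a -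
      app C (kcomp B K L) (letter i c) a * app C (kcomp B K L) (letter j c') a\<bar>) \<le> (\<eta>' + (real mB)\<^sup>2 * \<eta>) * card A" .
qed

section \<open>Second moments of letter counts, and kernels that reach every letter\<close>

lemma card_letter_pair_eq_sum:
  "real (card {i\<in>{1..n}. x i = c0 \<and> w i = c}) = (\<Sum>i | i \<in> {1..n} \<and> x i = c0. letter i c w)"
proof -
  have "(\<Sum>i | i \<in> {1..n} \<and> x i = c0. letter i c w) = real (card ({i. i \<in> {1..n} \<and> x i = c0} \<inter> {i. w i = c}))"
    unfolding letter_def by (subst sum_of_bool_eq) auto
  also have "{i. i \<in> {1..n} \<and> x i = c0} \<inter> {i. w i = c} = {i\<in>{1..n}. x i = c0 \<and> w i = c}" by auto
  finally show ?thesis by simp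
qed

text \<open>Chebyshev's inequality for the number of \<open>c\<close>-letters of \<open>w\<close>
  among the \<open>c0\<close>-positions of \<open>x\<close>. The conditional mean is at least
  \<open>\<beta> * \<kappa> * n\<close> and the threshold is half of that, whence the 4. Diagonal
  terms of the variance contribute at most \<open>n\<close>; the off-diagonal ones are controlled
  only after summing over \<open>x\<close>, because the defect is an average over
  \<open>x\<close>.\<close>

lemma (in orbit) few_letter_pairs_prob_le:
  fixes \<beta> \<kappa> \<eta> :: real
  assumes K: "markov n U U K" and d: "defect_le n U U K \<eta>" and b: "letter_bound n U U K \<beta> c0 c"
    and cnt: "\<And>x. x \<in> U \<Longrightarrow> \<kappa> * real n \<le> card {i\<in>{1..n}. x i = c0}"
    and pos: "0 < \<beta>" "0 < \<kappa>" "0 < n" "0 \<le> \<eta>"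
  shows "(\<Sum>x\<in>U. \<Sum>w\<in>U. K x w * of_bool (card {i\<in>{1..n}. x i = c0 \<and> w i = c} < \<beta> * \<kappa> * n / 2))
    \<le> 4 * (1 / n + \<eta>) / (\<beta> * \<kappa>)\<^sup>2 * card U"
proof -
  define t where "t = \<beta> * \<kappa> * n / 2"
  have t: "t > 0" using pos by (simp add: t_def)
  define I where "I x = {i. i \<in> {1..n} \<and> x i = c0}" for x :: "nat \<Rightarrow> nat"
  have finI: "finite (I x)" for x by (simp add: I_def)
  define N where "N x w = (\<Sum>i\<in>I x. letter i c w)" for x w
  define E where "E i j x = app U K (\<lambda>w. letter i c w * letter j c w) x - app U K (letter i c) x * app U K (letter j c) x"
    for i j x
  have Np: "real (card {i\<in>{1..n}. x i = c0 \<and> w i = c}) = N x w" for x w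
    by (simp only: card_letter_pair_eq_sum N_def I_def)
  have main: "t\<^sup>2 * (\<Sum>w\<in>U. K x w * of_bool (N x w < t)) \<le> n + (\<Sum>i\<in>{1..n}. \<Sum>j\<in>{1..n}. if i = j then 0 else \<bar>E i j x\<bar>)"
    if x: "x \<in> U" for x
  proof -
    define \<mu> where "\<mu> = app U K (N x) x"
    have \<mu>: "\<mu> = (\<Sum>i\<in>I x. app U K (letter i c) x)" unfolding \<mu>_def N_def by (rule app_sum)
    have "2 * t \<le> \<beta> * card (I x)"
      using cnt[OF x] pos by (simp add: t_def I_def mult.assoc)
    also have "\<dots> = (\<Sum>i\<in>I x. \<beta>)" by simp
    also have "\<dots> \<le> \<mu>"
      unfolding \<mu> using b x by (intro sum_mono) (auto simp: letter_bound_def I_def)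
    finally have \<mu>t: "2 * t \<le> \<mu>" .
    have "t\<^sup>2 * (\<Sum>w\<in>U. K x w * of_bool (N x w < t)) = (\<Sum>w\<in>U. K x w * (t\<^sup>2 * of_bool (N x w < t)))"
      by (simp add: sum_distrib_left mult_ac)
    also have "\<dots> \<le> (\<Sum>w\<in>U. K x w * (N x w - \<mu>)\<^sup>2)"
    proof (intro sum_mono mult_left_mono)
      fix w assume "w \<in> U"
      then show "0 \<le> K x w" using markovD(1)[OF K x] by simp
      show "t\<^sup>2 * of_bool (N x w < t) \<le> (N x w - \<mu>)\<^sup>2"
      proof (cases "N x w < t")
        case True
        then have "t \<le> \<mu> - N x w" using \<mu>t by linarith
        then have "t\<^sup>2 \<le> (\<mu> - N x w)\<^sup>2" using t by (intro power_mono) auto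
        then show ?thesis using True by (simp add: power2_commute)
      qed simp
    qed
    also have "\<dots> = (\<Sum>w\<in>U. K x w * (N x w * N x w)) - 2 * \<mu> * (\<Sum>w\<in>U. K x w * N x w) + \<mu>\<^sup>2 * (\<Sum>w\<in>U. K x w)"
      by (simp add: power2_eq_square algebra_simps sum.distrib sum_subtractf sum_distrib_left)
    also have "\<dots> = app U K (\<lambda>w. N x w * N x w) x - \<mu> * \<mu>"
      using markovD(2)[OF K x] by (simp add: \<mu>_def app_def power2_eq_square algebra_simps)
    also have "\<dots> = (\<Sum>i\<in>I x. \<Sum>j\<in>I x. E i j x)"
      unfolding \<mu> E_def N_def sum_product app_sum sum_subtractf ..
    also have "\<dots> \<le> (\<Sum>i\<in>I x. \<Sum>j\<in>I x. of_bool (i = j) + (if i = j then 0 else \<bar>E i j x\<bar>))"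
    proof (intro sum_mono)
      fix i j
      show "E i j x \<le> of_bool (i = j) + (if i = j then 0 else \<bar>E i j x\<bar>)"
      proof (cases "i = j")
        case True
        have "app U K (\<lambda>w. letter i c w * letter i c w) x \<le> 1"
          by (intro app_bounds(2)[OF K x]) (auto simp: letter_def)
        moreover have "0 \<le> app U K (letter i c) x * app U K (letter i c) x" by simp
        ultimately have "E i i x \<le> 1" unfolding E_def by linarith
        then show ?thesis using True by simp
      qed auto
    qed
    also have "\<dots> = (\<Sum>i\<in>I x. 1) + (\<Sum>i\<in>I x. \<Sum>j\<in>I x. if i = j then 0 else \<bar>E i j x\<bar>)"
      unfolding sum.distrib using finI[of x] by (simp add: of_bool_def)
    also have "\<dots> \<le> (\<Sum>i\<in>{1..n}. 1) + (\<Sum>i\<in>{1..n}. \<Sum>j\<in>{1..n}. if i = j then 0 else \<bar>E i j x\<bar>)"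
    proof (intro add_mono)
      show "(\<Sum>i\<in>I x. 1::real) \<le> (\<Sum>i\<in>{1..n}. 1)" by (rule sum_mono2) (auto simp: I_def)
      have "(\<Sum>i\<in>I x. \<Sum>j\<in>I x. if i = j then 0 else \<bar>E i j x\<bar>) \<le>
          (\<Sum>i\<in>I x. \<Sum>j\<in>{1..n}. if i = j then 0 else \<bar>E i j x\<bar>)"
        by (intro sum_mono sum_mono2) (auto simp: I_def)
      also have "\<dots> \<le> (\<Sum>i\<in>{1..n}. \<Sum>j\<in>{1..n}. if i = j then 0 else \<bar>E i j x\<bar>)"
        by (intro sum_mono2) (auto simp: I_def intro!: sum_nonneg)
      finally show "(\<Sum>i\<in>I x. \<Sum>j\<in>I x. if i = j then 0 else \<bar>E i j x\<bar>) \<le> \<dots>" .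
    qed
    finally show ?thesis by simp
  qed
  have "t\<^sup>2 * (\<Sum>x\<in>U. \<Sum>w\<in>U. K x w * of_bool (N x w < t)) \<le>
      (\<Sum>x\<in>U. real n + (\<Sum>i\<in>{1..n}. \<Sum>j\<in>{1..n}. if i = j then 0 else \<bar>E i j x\<bar>))"
    by (subst sum_distrib_left) (rule sum_mono[OF main])
  also have "\<dots> = real n * card U + (\<Sum>i\<in>{1..n}. \<Sum>j\<in>{1..n}. \<Sum>x\<in>U. if i = j then 0 else \<bar>E i j x\<bar>)"
  proof -
    have "(\<Sum>x\<in>U. \<Sum>i\<in>{1..n}. \<Sum>j\<in>{1..n}. if i = j then 0 else \<bar>E i j x\<bar>) =
        (\<Sum>i\<in>{1..n}. \<Sum>j\<in>{1..n}. \<Sum>x\<in>U. if i = j then 0 else \<bar>E i j x\<bar>)"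
      by (subst sum.swap) (intro sum.cong refl sum.swap)
    then show ?thesis by (simp add: sum.distrib)
  qed
  also have "\<dots> \<le> real n * card U + (\<Sum>i\<in>{1..n}. \<Sum>j\<in>{1..n}. if i = j then 0 else \<eta> * card U)"
  proof (intro add_left_mono sum_mono)
    fix i j assume ij: "i \<in> {1..n}" "j \<in> {1..n}"
    show "(\<Sum>x\<in>U. if i = j then 0 else \<bar>E i j x\<bar>) \<le> (if i = j then 0 else \<eta> * card U)"
    proof (cases "i = j")
      case False
      then show ?thesis
        using d[unfolded defect_le_def, rule_format, OF ij False, of c c] by (simp add: E_def)
    qed simp
  qed
  also have "\<dots> \<le> real n * card U + (\<Sum>i\<in>{1..n}. \<Sum>j\<in>{1..n}. \<eta> * card U)"
    using pos(4) by (intro add_left_mono sum_mono) auto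
  also have "\<dots> = (real n + n\<^sup>2 * \<eta>) * card U" by (simp add: power2_eq_square algebra_simps)
  finally have "(\<Sum>x\<in>U. \<Sum>w\<in>U. K x w * of_bool (N x w < t)) \<le> (real n + n\<^sup>2 * \<eta>) * card U / t\<^sup>2"
    using t by (simp add: pos_le_divide_eq mult.commute)
  also have "\<dots> = 4 * (1 / n + \<eta>) / (\<beta> * \<kappa>)\<^sup>2 * card U"
    using pos by (simp add: t_def field_simps power2_eq_square)
  finally show ?thesis unfolding Np t_def .
qed

lemma card_letter_pair_permute:
  assumes "\<pi> permutes {1..n}"
  shows "card {i\<in>{1..n}. (x \<circ> \<pi>) i = c0 \<and> (w \<circ> \<pi>) i = c} = card {i\<in>{1..n}. x i = c0 \<and> w i = c}"
proof -
  have *: "\<pi> ` {i\<in>{1..n}. (x \<circ> \<pi>) i = c0 \<and> (w \<circ> \<pi>) i = c} = {i\<in>{1..n}. x i = c0 \<and> w i = c}"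
  proof (intro equalityI subsetI)
    fix k assume k: "k \<in> {i\<in>{1..n}. x i = c0 \<and> w i = c}"
    then obtain i where "i \<in> {1..n}" "k = \<pi> i" using permutes_image[OF assms] by blast
    then show "k \<in> \<pi> ` {i\<in>{1..n}. (x \<circ> \<pi>) i = c0 \<and> (w \<circ> \<pi>) i = c}" using k by auto
  next
    fix k assume "k \<in> \<pi> ` {i\<in>{1..n}. (x \<circ> \<pi>) i = c0 \<and> (w \<circ> \<pi>) i = c}"
    then show "k \<in> {i\<in>{1..n}. x i = c0 \<and> w i = c}" using permutes_in_image[OF assms] by auto
  qed
  have "inj_on \<pi> {i\<in>{1..n}. (x \<circ> \<pi>) i = c0 \<and> (w \<circ> \<pi>) i = c}"
    using permutes_inj[OF assms] inj_on_subset by blast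
  from card_image[OF this] show ?thesis using * by simp
qed

text \<open>By transitivity all rows of an equivariant kernel have the same sum, and likewise all columns;
  hence a small total mass already makes the operator norm small.\<close>

lemma (in orbit) equivariant_form_le_mass:
  fixes k :: "(nat \<Rightarrow> nat) \<Rightarrow> (nat \<Rightarrow> nat) \<Rightarrow> real" and \<gamma> :: real
  assumes nonneg: "\<And>x w. x \<in> U \<Longrightarrow> w \<in> U \<Longrightarrow> 0 \<le> k x w"
    and equiv: "\<And>x w \<pi>. x \<in> U \<Longrightarrow> w \<in> U \<Longrightarrow> \<pi> permutes {1..n} \<Longrightarrow> k (x \<circ> \<pi>) (w \<circ> \<pi>) = k x w"
    and mass: "(\<Sum>x\<in>U. \<Sum>w\<in>U. k x w) \<le> \<gamma> * card U"
  shows "(\<Sum>x\<in>U. \<Sum>w\<in>U. k x w * h x * h w) \<le> \<gamma> * ip U h h"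
proof -
  have trans: "\<exists>\<pi>. \<pi> permutes {1..n} \<and> y = x \<circ> \<pi>" if "x \<in> U" "y \<in> U" for x y
    using transitive[OF that, of "{}"] by simp
  have row: "(\<Sum>w\<in>U. k x w) \<le> \<gamma>" if x: "x \<in> U" for x
  proof -
    have "(\<Sum>w\<in>U. k y w) = (\<Sum>w\<in>U. k x w)" if y: "y \<in> U" for y
    proof -
      obtain \<pi> where \<pi>: "\<pi> permutes {1..n}" "y = x \<circ> \<pi>" using trans x y by blast
      have "(\<Sum>w\<in>U. k y w) = (\<Sum>w\<in>U. k (x \<circ> \<pi>) (w \<circ> \<pi>))"
        using sum_permute[OF \<pi>(1), of "k y"] \<pi>(2) by simp
      then show ?thesis using equiv[OF x _ \<pi>(1)] by simp
    qed
    then have "(\<Sum>w\<in>U. k x w) * card U \<le> \<gamma> * card U" using mass by (simp add: mult.commute)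
    then show ?thesis using card_pos by simp
  qed
  have col: "(\<Sum>x\<in>U. k x w) \<le> \<gamma>" if w: "w \<in> U" for w
  proof -
    have "(\<Sum>x\<in>U. k x y) = (\<Sum>x\<in>U. k x w)" if y: "y \<in> U" for y
    proof -
      obtain \<pi> where \<pi>: "\<pi> permutes {1..n}" "y = w \<circ> \<pi>" using trans w y by blast
      have "(\<Sum>x\<in>U. k x y) = (\<Sum>x\<in>U. k (x \<circ> \<pi>) (w \<circ> \<pi>))"
        using sum_permute[OF \<pi>(1), of "\<lambda>x. k x y"] \<pi>(2) by simp
      then show ?thesis using equiv[OF _ w \<pi>(1)] by simp
    qed
    moreover have "(\<Sum>y\<in>U. \<Sum>x\<in>U. k x y) \<le> \<gamma> * card U" using mass by (subst sum.swap)
    ultimately have "(\<Sum>x\<in>U. k x w) * card U \<le> \<gamma> * card U" by (simp add: mult.commute)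
    then show ?thesis using card_pos by simp
  qed
  have "(\<Sum>x\<in>U. \<Sum>w\<in>U. k x w * h x * h w) \<le> (\<Sum>x\<in>U. \<Sum>w\<in>U. k x w * (h x * h x) / 2 + k x w * (h w * h w) / 2)"
  proof (intro sum_mono)
    fix x w assume "x \<in> U" "w \<in> U"
    have "h x * h w \<le> (h x * h x + h w * h w) / 2"
      using sum_squares_bound[of "h x" "h w"] by (simp add: power2_eq_square)
    then have "k x w * (h x * h w) \<le> k x w * ((h x * h x + h w * h w) / 2)"
      using nonneg[OF \<open>x \<in> U\<close> \<open>w \<in> U\<close>] by (intro mult_left_mono)
    then show "k x w * h x * h w \<le> k x w * (h x * h x) / 2 + k x w * (h w * h w) / 2"
      by (simp add: algebra_simps add_divide_distrib)
  qed
  also have "\<dots> = (\<Sum>x\<in>U. (\<Sum>w\<in>U. k x w) * (h x * h x)) / 2 + (\<Sum>w\<in>U. (\<Sum>x\<in>U. k x w) * (h w * h w)) / 2"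
    unfolding sum.distrib sum_divide_distrib[symmetric] sum_distrib_right
    by (subst (2) sum.swap) simp
  also have "\<dots> \<le> (\<Sum>x\<in>U. \<gamma> * (h x * h x)) / 2 + (\<Sum>w\<in>U. \<gamma> * (h w * h w)) / 2"
    using row col by (intro add_mono divide_right_mono sum_mono mult_right_mono) auto
  also have "\<dots> = \<gamma> * ip U h h" by (simp add: ip_def sum_distrib_left)
  finally show ?thesis .
qed

text \<open>A pair is good when every letter of \<open>w\<close> occurs at least \<open>s\<close>
  times on the \<open>c0\<close>-positions of \<open>x\<close>. The bad pairs have small total mass,
  by a union bound over the \<open>m\<close> letters, and enter through
  \<open>equivariant_form_le_mass\<close>; on the good pairs \<open>shuffle_bound\<close> applies,
  and its square is the source of the root.\<close>

lemma (in orbit) full_support_kernel_pure_junta_le: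
  fixes \<beta> \<kappa> \<eta> :: real
  assumes K: "markov n U U K" and def: "defect_le n U U K \<eta>"
    and b: "\<And>c. c \<in> {1..m} \<Longrightarrow> letter_bound n U U K \<beta> c0 c"
    and cnt: "\<And>x. x \<in> U \<Longrightarrow> \<kappa> * real n \<le> card {i\<in>{1..n}. x i = c0}"
    and pos: "0 < \<beta>" "0 < \<kappa>" "0 < n" "0 \<le> \<eta>"
    and J: "J \<subseteq> {1..n}" and h: "junta n U J h" "pure n U (card J) h"
    and s: "s \<le> n" "s \<le> \<beta> * \<kappa> * n / 2" and d: "d \<le> card J" and q: "1 \<le> q" "q * D \<le> n - card J"
  shows "ip U h (app U K h) \<le>
    (m * (4 * (1 / n + \<eta>) / (\<beta> * \<kappa>)\<^sup>2) + sqrt ((1 - s / n) ^ d + q * (1 - s / n) ^ D + 1 / q)) * ip U h h"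
proof -
  let ?N = "\<lambda>x w c. card {i\<in>{1..n}. x i = c0 \<and> w i = c}"
  define G where "G x w \<longleftrightarrow> (\<forall>c\<in>{1..m}. s \<le> ?N x w c)" for x w :: "nat \<Rightarrow> nat"
  have G_equiv: "G (x \<circ> \<pi>) (w \<circ> \<pi>) = G x w" if "\<pi> permutes {1..n}" for x w \<pi>
    unfolding G_def by (simp only: card_letter_pair_permute[OF that])
  define \<gamma> where "\<gamma> = 4 * (1 / n + \<eta>) / (\<beta> * \<kappa>)\<^sup>2"
  define \<theta> where "\<theta> = (1 - s / n) ^ d + q * (1 - s / n) ^ D + 1 / q"
  note Kn = markovD(1)[OF K] and Ke = markovD(4)[OF K]
  have bad: "(\<Sum>x\<in>U. \<Sum>w\<in>U. K x w * of_bool (\<not> G x w) * h x * h w) \<le> (m * \<gamma>) * ip U h h"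
  proof (rule equivariant_form_le_mass[where k = "\<lambda>x w. K x w * of_bool (\<not> G x w)"])
    have "(\<Sum>x\<in>U. \<Sum>w\<in>U. K x w * of_bool (\<not> G x w)) \<le>
        (\<Sum>x\<in>U. \<Sum>w\<in>U. \<Sum>c\<in>{1..m}. K x w * of_bool (?N x w c < \<beta> * \<kappa> * n / 2))"
    proof (intro sum_mono)
      fix x w assume xw: "x \<in> U" "w \<in> U"
      show "K x w * of_bool (\<not> G x w) \<le> (\<Sum>c\<in>{1..m}. K x w * of_bool (?N x w c < \<beta> * \<kappa> * n / 2))"
      proof (cases "G x w")
        case True
        then show ?thesis using Kn[OF xw] by (simp add: sum_nonneg)
      next
        case False
        then obtain c where c: "c \<in> {1..m}" "?N x w c < s" by (auto simp: G_def not_le)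
        then have "real (?N x w c) < \<beta> * \<kappa> * n / 2" using s(2) by linarith
        then have "K x w * of_bool (\<not> G x w) = K x w * of_bool (?N x w c < \<beta> * \<kappa> * n / 2)" using False by simp
        also have "\<dots> \<le> (\<Sum>c\<in>{1..m}. K x w * of_bool (?N x w c < \<beta> * \<kappa> * n / 2))"
          using c(1) Kn[OF xw] by (intro member_le_sum) auto
        finally show ?thesis .
      qed
    qed
    also have "\<dots> = (\<Sum>c\<in>{1..m}. \<Sum>x\<in>U. \<Sum>w\<in>U. K x w * of_bool (?N x w c < \<beta> * \<kappa> * n / 2))"
      by (subst sum.swap[of _ "{1..m}"], subst sum.swap[of _ "{1..m}"]) simp
    also have "\<dots> \<le> (\<Sum>c\<in>{1..m}. \<gamma> * card U)"
      unfolding \<gamma>_def using few_letter_pairs_prob_le[OF K def b cnt pos] by (intro sum_mono) simp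
    finally show "(\<Sum>x\<in>U. \<Sum>w\<in>U. K x w * of_bool (\<not> G x w)) \<le> m * \<gamma> * card U" by simp
  qed (simp_all only: G_equiv Ke, simp add: Kn)
  have good: "(\<Sum>x\<in>U. \<Sum>w\<in>U. K x w * of_bool (G x w) * h x * h w)\<^sup>2 \<le> \<theta> * (ip U h h)\<^sup>2"
  proof -
    have sub: "(\<Sum>w\<in>U. K x w * of_bool (G x w)) \<le> (\<Sum>w\<in>U. K x w)"
      "(\<Sum>w\<in>U. K w x * of_bool (G w x)) \<le> (\<Sum>w\<in>U. K w x)" if "x \<in> U" for x
      using Kn that by (auto intro!: sum_mono)
    have "(\<Sum>x\<in>U. \<Sum>w\<in>U. K x w * of_bool (G x w) * h x * h w)\<^sup>2 \<le>
        ip U h h * ((\<Sum>S | S \<subseteq> {1..n} \<and> card S = s. ip U (perm_avg S h) (perm_avg S h)) / (n choose s))"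
    proof (rule shuffle_bound[where K = "\<lambda>x w. K x w * of_bool (G x w)" and ?c0.0 = c0])
      fix x assume x: "x \<in> U"
      show "(\<Sum>w\<in>U. K x w * of_bool (G x w)) \<le> 1" using sub(1)[OF x] markovD(2)[OF K x] by simp
      show "(\<Sum>w\<in>U. K w x * of_bool (G w x)) \<le> 1" using sub(2)[OF x] markovD(3)[OF K x] card_pos by simp
      fix w c assume "w \<in> U" "K x w * of_bool (G x w) \<noteq> 0" "c \<in> {1..m}"
      then show "s \<le> ?N x w c" by (auto simp: G_def)
    qed (simp_all only: G_equiv Ke s(1), simp add: Kn)
    also have "\<dots> \<le> ip U h h * (\<theta> * ip U h h)"
      unfolding \<theta>_def using avg_ip_perm_avg_pure_junta_le[OF J h s(1) d q]
      by (intro mult_left_mono ip_nonneg)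
    finally show ?thesis by (simp add: power2_eq_square mult_ac)
  qed
  have "\<theta> \<ge> 0"
    unfolding \<theta>_def using s(1) pos(3) by (intro add_nonneg_nonneg mult_nonneg_nonneg zero_le_power) (auto simp: field_simps)
  then have "(\<Sum>x\<in>U. \<Sum>w\<in>U. K x w * of_bool (G x w) * h x * h w) \<le> sqrt \<theta> * ip U h h"
    using real_le_rsqrt[OF good] ip_nonneg[of U h] by (simp add: real_sqrt_mult)
  moreover have "ip U h (app U K h) = (\<Sum>x\<in>U. \<Sum>w\<in>U. K x w * of_bool (\<not> G x w) * h x * h w) +
      (\<Sum>x\<in>U. \<Sum>w\<in>U. K x w * of_bool (G x w) * h x * h w)"
    unfolding ip_def app_def sum_distrib_left sum.distrib[symmetric] by (intro sum.cong refl) auto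
  ultimately show ?thesis using bad unfolding \<theta>_def[symmetric] \<gamma>_def[symmetric] by (simp add: algebra_simps)
qed

text \<open>The power of \<open>M\<close> with exponent \<open>2 ^ r\<close>, by repeated squaring.
  Doubling exponents are what Cauchy-Schwarz on moments needs.\<close>

primrec kpow :: "'a set \<Rightarrow> ('a \<Rightarrow> 'a \<Rightarrow> real) \<Rightarrow> nat \<Rightarrow> 'a \<Rightarrow> 'a \<Rightarrow> real" where
  "kpow U M 0 = M"
| "kpow U M (Suc r) = kcomp U (kpow U M r) (kpow U M r)"

lemma ip_app_symmetric:
  assumes "\<And>x w. x \<in> U \<Longrightarrow> w \<in> U \<Longrightarrow> K x w = K w x"
  shows "ip U f (app U K g) = ip U (app U K f) g"
proof -
  have "ip U f (app U K g) = (\<Sum>w\<in>U. \<Sum>x\<in>U. f x * (K x w * g w))"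
    unfolding ip_def app_def sum_distrib_left by (rule sum.swap)
  also have "\<dots> = ip U (app U K f) g"
    unfolding ip_def app_def sum_distrib_right using assms by (intro sum.cong refl) (simp add: mult_ac)
  finally show ?thesis .
qed

lemma kpow_symmetric:
  assumes "\<And>x w. x \<in> U \<Longrightarrow> w \<in> U \<Longrightarrow> M x w = M w x" "x \<in> U" "w \<in> U"
  shows "kpow U M r x w = kpow U M r w x"
  using assms(2,3)
proof (induction r arbitrary: x w)
  case (Suc r)
  then show ?case by (auto simp: kcomp_def mult.commute intro!: sum.cong)
qed (simp add: assms)

text \<open>By self-adjointness and Cauchy-Schwarz, the square of the normalised form of one power
  is at most the form of its square. Starting from a nonnegative form of \<open>M\<close>,
  \<open>P\<close> doublings bound its power with exponent \<open>2 ^ P\<close>, and roots may be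
  compared.\<close>

lemma ip_app_kpow_power_le:
  assumes sym: "\<And>x w. x \<in> U \<Longrightarrow> w \<in> U \<Longrightarrow> M x w = M w x"
    and pos: "0 \<le> ip U h (app U M h)" and l: "0 \<le> l"
    and bnd: "ip U h (app U (kpow U M P) h) \<le> l ^ 2 ^ P * ip U h h"
  shows "ip U h (app U M h) \<le> l * ip U h h"
proof (cases "ip U h h = 0")
  case True
  then show ?thesis using ip_Cauchy_Schwarz[of U h "app U M h"] by simp
next
  case False
  define N where "N = ip U h h"
  have N: "N > 0" using False ip_nonneg[of U h] by (simp add: N_def)
  define b where "b r = ip U h (app U (kpow U M r) h) / N" for r
  have step: "(b r)\<^sup>2 \<le> b (Suc r)" for r
  proof -
    let ?K = "kpow U M r"
    have "(ip U h (app U ?K h))\<^sup>2 \<le> N * ip U (app U ?K h) (app U ?K h)"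
      using ip_Cauchy_Schwarz[of U h "app U ?K h"] by (simp add: N_def)
    also have "ip U (app U ?K h) (app U ?K h) = ip U h (app U ?K (app U ?K h))"
      by (rule ip_app_symmetric[OF kpow_symmetric[OF sym], symmetric])
    also have "\<dots> = ip U h (app U (kpow U M (Suc r)) h)"
      by (simp add: ip_def app_kcomp)
    finally show ?thesis using N by (simp add: b_def power_divide field_simps power2_eq_square)
  qed
  have b0: "b 0 \<ge> 0" using pos N by (simp add: b_def)
  have "b 0 ^ 2 ^ r \<le> b r" for r
  proof (induction r)
    case (Suc r)
    have "b 0 ^ 2 ^ Suc r = (b 0 ^ 2 ^ r)\<^sup>2" by (simp add: power_mult[symmetric] mult.commute)
    also have "\<dots> \<le> (b r)\<^sup>2" using Suc b0 by (intro power_mono) auto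
    also have "\<dots> \<le> b (Suc r)" by (rule step)
    finally show ?case .
  qed simp
  also have "b P \<le> l ^ 2 ^ P"
    using bnd N by (simp add: b_def N_def[symmetric] pos_divide_le_eq)
  finally have "b 0 \<le> l" using b0 l by (simp add: power_mono_iff)
  then show ?thesis using N by (simp add: b_def N_def[symmetric] field_simps)
qed

text \<open>One squaring multiplies the defect by \<open>1 + m\<^sup>2\<close>, by
  \<open>defect_le_kcomp\<close> with both factors equal. A walk of length \<open>2 ^ Suc r\<close>
  is cut in the middle, and the letter bounds of its halves multiply.\<close>

lemma (in orbit) kpow_properties:
  assumes M: "markov n U U M" and d: "defect_le n U U M \<eta>" and "0 \<le> \<beta>"
    and b: "\<And>c c'. (c, c') \<in> R \<Longrightarrow> letter_bound n U U M \<beta> c c'"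
  shows "markov n U U (kpow U M r)"
    and "defect_le n U U (kpow U M r) ((1 + (real m)\<^sup>2) ^ r * \<eta>)"
    and "(c, c') \<in> R ^^ (2 ^ r) \<Longrightarrow> letter_bound n U U (kpow U M r) (\<beta> ^ 2 ^ r) c c'"
proof -
  have o: "orbit n m U" ..
  show m: "markov n U U (kpow U M r)" for r
    by (induction r) (auto intro: M markov_kcomp[OF o o o])
  show "defect_le n U U (kpow U M r) ((1 + (real m)\<^sup>2) ^ r * \<eta>)"
  proof (induction r)
    case (Suc r)
    from defect_le_kcomp[OF o o o m m Suc Suc] show ?case by (simp add: algebra_simps)
  qed (simp add: d)
  show "(c, c') \<in> R ^^ (2 ^ r) \<Longrightarrow> letter_bound n U U (kpow U M r) (\<beta> ^ 2 ^ r) c c'"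
  proof (induction r arbitrary: c c')
    case (Suc r)
    have "R ^^ (2 ^ Suc r) = R ^^ (2 ^ r) O R ^^ (2 ^ r)" by (simp add: mult_2 relpow_add)
    then obtain e where "(c, e) \<in> R ^^ (2 ^ r)" "(e, c') \<in> R ^^ (2 ^ r)" using Suc.prems by blast
    then have "letter_bound n U U (kpow U M (Suc r)) (\<beta> ^ 2 ^ r * \<beta> ^ 2 ^ r) c c'"
      using letter_bound_kcomp[OF m m _ Suc.IH Suc.IH] \<open>0 \<le> \<beta>\<close> by simp
    then show ?case by (simp add: mult_2 power_add)
  qed (simp add: b)
qed

text \<open>The choices are made in the order \<open>q\<close>, then \<open>D\<close> depending on
  \<open>q\<close>, then \<open>d\<close>. A large \<open>n\<close> is not assumed but follows from
  \<open>d \<le> e\<close> and \<open>e \<le> n\<close>; the bound on \<open>e\<close> leaves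
  \<open>\<kappa> * n\<close> coordinates outside a set of size \<open>e\<close>, enough for
  \<open>q\<close> blocks of size \<open>D\<close>.\<close>

lemma high_degree_parameters:
  fixes \<beta> \<kappa> \<delta> :: real and m :: nat
  assumes "0 < \<beta>" "\<beta> \<le> 1" "0 < \<kappa>" "\<kappa> \<le> 1" "0 < \<delta>"
  shows "\<exists>d\<ge>1. \<exists>\<eta>\<^sub>0>0. \<exists>(q::nat) (D::nat). 1 \<le> q \<and> (\<forall>(n::nat) (e::nat). d \<le> e \<longrightarrow> real e \<le> (1 - \<kappa>) * n \<longrightarrow>
    0 < n \<and> q * D \<le> n - e \<and> (\<exists>s::nat. s \<le> n \<and> s \<le> \<beta> * \<kappa> * n / 2 \<and> (\<forall>\<eta>. 0 \<le> \<eta> \<longrightarrow> \<eta> \<le> \<eta>\<^sub>0 \<longrightarrow>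
      m * (4 * (1 / n + \<eta>) / (\<beta> * \<kappa>)\<^sup>2) + sqrt ((1 - s / n) ^ d + q * (1 - s / n) ^ D + 1 / q) \<le> \<delta>)))"
proof -
  \<comment> \<open>\<open>s\<close> will be the integer part of
    \<open>\<beta> * \<kappa> * n / 2\<close>. Once that number is at least 1, \<open>s\<close> is
    at least half of it, so \<open>1 - s / n\<close> is at most \<theta>.\<close>
  define \<theta> where "\<theta> = 1 - \<beta> * \<kappa> / 4"
  have bk: "0 < \<beta> * \<kappa>" "\<beta> * \<kappa> \<le> 1" using assms by (auto simp: mult_le_one)
  have \<theta>: "0 \<le> \<theta>" "\<theta> < 1" using bk by (auto simp: \<theta>_def)
  \<comment> \<open>Three terms under the root, each at most \<open>\<delta>\<^sup>2 / 12\<close>,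
    make the root at most \<open>\<delta> / 2\<close>.\<close>
  define \<delta>' where "\<delta>' = \<delta>\<^sup>2 / 12"
  have \<delta>': "\<delta>' > 0" using assms by (simp add: \<delta>'_def)
  obtain q :: nat where q: "1 / \<delta>' < q" using reals_Archimedean2 by blast
  have q0: "0 < real q" using q \<delta>' by (meson divide_pos_pos less_trans zero_less_one)
  have q1: "1 \<le> q" using q0 by simp
  have qd: "1 / real q \<le> \<delta>'"
  proof -
    have "1 < real q * \<delta>'" using q \<delta>' by (simp add: pos_divide_less_eq)
    then show ?thesis using q0 by (simp add: pos_divide_le_eq mult.commute)
  qed
  obtain D where D: "\<theta> ^ D < \<delta>' / q" using real_arch_pow_inv[of "\<delta>' / q" \<theta>] \<delta>' q0 \<theta> by auto
  obtain d0 where d0: "\<theta> ^ d0 < \<delta>'" using real_arch_pow_inv[of \<delta>' \<theta>] \<delta>' \<theta> by auto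
  \<comment> \<open>With both \<open>1 / n\<close> and \<eta> at most this value, the summand
    outside the root is at most \<open>\<delta> / 2\<close>. The \<open>1\<close> added to
    \<open>m\<close> keeps the denominator positive.\<close>
  define \<eta>\<^sub>0 where "\<eta>\<^sub>0 = \<delta> * (\<beta> * \<kappa>)\<^sup>2 / (16 * (real m + 1))"
  have \<eta>0: "\<eta>\<^sub>0 > 0" using assms by (simp add: \<eta>\<^sub>0_def)
  \<comment> \<open>The three terms give, for \<open>n\<close> at least \<open>d1\<close>, that
    \<open>1 / n\<close> is at most \<open>\<eta>\<^sub>0\<close>, that the blocks fit outside the
    set of size \<open>e\<close>, and that \<open>\<beta> * \<kappa> * n / 2\<close> is at least
    1.\<close>
  obtain d1 :: nat where d1: "1 / \<eta>\<^sub>0 + real (q * D) / \<kappa> + 4 / (\<beta> * \<kappa>) < d1" using reals_Archimedean2 by blast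
  define d where "d = max 1 (max d0 d1)"
  have nonneg: "0 \<le> 1 / \<eta>\<^sub>0" "0 \<le> real (q * D) / \<kappa>" "0 \<le> 4 / (\<beta> * \<kappa>)" using \<eta>0 assms by auto
  show ?thesis
  proof (rule exI[of _ d], rule conjI[OF _ exI[of _ \<eta>\<^sub>0]], simp add: d_def,
      rule conjI[OF \<eta>0 exI[of _ q]], rule exI[of _ D], rule conjI[OF q1])
    show "\<forall>(n::nat) (e::nat). d \<le> e \<longrightarrow> real e \<le> (1 - \<kappa>) * n \<longrightarrow>
    0 < n \<and> q * D \<le> n - e \<and> (\<exists>s::nat. s \<le> n \<and> s \<le> \<beta> * \<kappa> * n / 2 \<and> (\<forall>\<eta>. 0 \<le> \<eta> \<longrightarrow> \<eta> \<le> \<eta>\<^sub>0 \<longrightarrow>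
      m * (4 * (1 / n + \<eta>) / (\<beta> * \<kappa>)\<^sup>2) + sqrt ((1 - s / n) ^ d + q * (1 - s / n) ^ D + 1 / q) \<le> \<delta>))"
    proof (intro allI impI conjI)
      fix n e :: nat assume e: "d \<le> e" "real e \<le> (1 - \<kappa>) * n"
      have "(1 - \<kappa>) * n \<le> 1 * real n" using assms by (intro mult_right_mono) auto
      then have en: "e \<le> n" using e(2) by simp
      then show n0: "0 < n" using e(1) by (simp add: d_def)
      have nd1: "real d1 \<le> n" using e(1) en by (simp add: d_def)
      have n1: "1 / \<eta>\<^sub>0 < n" "real (q * D) / \<kappa> < n" "4 / (\<beta> * \<kappa>) < n"
        using d1 nd1 nonneg by linarith+
      have "real (q * D) \<le> \<kappa> * n" using n1(2) assms by (simp add: pos_divide_less_eq mult.commute)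
      then have "real (q * D) \<le> real (n - e)" using e(2) en by (simp add: of_nat_diff algebra_simps)
      then show "q * D \<le> n - e" by (simp only: of_nat_le_iff)
      define y where "y = \<beta> * \<kappa> * n / 2"
      have y: "y \<ge> 1" using n1(3) bk by (simp add: y_def pos_divide_less_eq mult.commute)
      define s where "s = nat \<lfloor>y\<rfloor>"
      have sy: "real s \<le> y" "y - 1 < real s" using y by (auto simp: s_def)
      have s2: "y / 2 \<le> s"
      proof (cases "y < 2")
        case True
        have "1 \<le> \<lfloor>y\<rfloor>" using y by simp
        then have "1 \<le> real s" using y by (simp add: s_def)
        then show ?thesis using True by simp
      next
        case False then show ?thesis using sy by simp
      qed
      have "y \<le> 1 * real n / 2" unfolding y_def using bk by (intro divide_right_mono mult_right_mono) auto
      then have sn: "s \<le> n" using sy(1) by simp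
      have "\<beta> * \<kappa> / 4 * n \<le> s" using s2 by (simp add: y_def)
      then have "\<beta> * \<kappa> / 4 \<le> s / n" using n0 by (simp add: pos_le_divide_eq)
      then have th: "1 - s / n \<le> \<theta>" "0 \<le> 1 - s / n" using sn n0 by (auto simp: \<theta>_def pos_divide_le_eq)
      show "\<exists>s::nat. s \<le> n \<and> s \<le> \<beta> * \<kappa> * n / 2 \<and> (\<forall>\<eta>. 0 \<le> \<eta> \<longrightarrow> \<eta> \<le> \<eta>\<^sub>0 \<longrightarrow>
        m * (4 * (1 / n + \<eta>) / (\<beta> * \<kappa>)\<^sup>2) + sqrt ((1 - s / n) ^ d + q * (1 - s / n) ^ D + 1 / q) \<le> \<delta>)"
      proof (intro exI[of _ s] conjI allI impI)
        show "s \<le> n" by (rule sn)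
        show "s \<le> \<beta> * \<kappa> * n / 2" using sy(1) by (simp add: y_def)
        fix \<eta> :: real assume \<eta>: "0 \<le> \<eta>" "\<eta> \<le> \<eta>\<^sub>0"
        have "1 / n \<le> \<eta>\<^sub>0" using n1(1) \<eta>0 n0 by (simp add: field_simps)
        then have "4 * (1 / n + \<eta>) \<le> 8 * \<eta>\<^sub>0" using \<eta> by simp
        then have "m * (4 * (1 / n + \<eta>) / (\<beta> * \<kappa>)\<^sup>2) \<le> m * (8 * \<eta>\<^sub>0 / (\<beta> * \<kappa>)\<^sup>2)"
          by (intro mult_left_mono divide_right_mono) auto
        also have "\<dots> \<le> (real m + 1) * (8 * \<eta>\<^sub>0 / (\<beta> * \<kappa>)\<^sup>2)" using \<eta>0 by (intro mult_right_mono) auto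
        also have "\<dots> = \<delta> / 2"
        proof -
          have "a * (8 * (\<delta> * B / (16 * a)) / B) = \<delta> / 2" if "a > 0" "B > 0" for a B :: real
            using that by (simp add: field_simps)
          moreover have "real m + 1 > 0" by simp
          ultimately show ?thesis using zero_less_power[OF bk(1), of 2] unfolding \<eta>\<^sub>0_def by blast
        qed
        finally have A: "m * (4 * (1 / n + \<eta>) / (\<beta> * \<kappa>)\<^sup>2) \<le> \<delta> / 2" .
        have "(1 - s / n) ^ d \<le> \<theta> ^ d" using th by (intro power_mono) auto
        also have "\<dots> \<le> \<theta> ^ d0" using \<theta> by (intro power_decreasing) (auto simp: d_def)
        finally have 1: "(1 - s / n) ^ d \<le> \<delta>'" using d0 by simp
        have "q * (1 - s / n) ^ D \<le> q * \<theta> ^ D" using th by (intro mult_left_mono power_mono) auto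
        also have "\<dots> \<le> q * (\<delta>' / q)" using D by (intro mult_left_mono) auto
        finally have 2: "q * (1 - s / n) ^ D \<le> \<delta>'" using q0 by simp
        have "sqrt ((1 - s / n) ^ d + q * (1 - s / n) ^ D + 1 / q) \<le> sqrt ((\<delta> / 2)\<^sup>2)"
          using 1 2 qd by (intro real_sqrt_le_mono) (simp add: \<delta>'_def power2_eq_square)
        then have "sqrt ((1 - s / n) ^ d + q * (1 - s / n) ^ D + 1 / q) \<le> \<delta> / 2" using assms(5) by simp
        with A show "m * (4 * (1 / n + \<eta>) / (\<beta> * \<kappa>)\<^sup>2) + sqrt ((1 - s / n) ^ d + q * (1 - s / n) ^ D + 1 / q) \<le> \<delta>"
          by linarith
      qed
    qed
  qed
qed

text \<open>Only after \<open>2\<^sup>P\<close> steps does \<open>M\<close> connect \<open>c0\<close> to every letter; since \<open>M\<close> is self-adjoint, the resulting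
  bound on its powers transfers back to a single step.\<close>

lemma chain_pure_junta_contraction:
  fixes \<beta> \<kappa> \<delta> :: real
  assumes "0 < \<beta>" "\<beta> \<le> 1" "0 < \<kappa>" "\<kappa> \<le> 1" "0 < \<delta>"
  shows "\<exists>d\<ge>1. \<exists>\<eta>\<^sub>0>0. \<forall>n U M R \<eta> c0 J h.
    orbit n m U \<longrightarrow> markov n U U M \<longrightarrow> (\<forall>x\<in>U. \<forall>w\<in>U. M x w = M w x) \<longrightarrow>
    defect_le n U U M \<eta> \<longrightarrow> 0 \<le> \<eta> \<longrightarrow> \<eta> \<le> \<eta>\<^sub>0 \<longrightarrow>
    (\<forall>(c, c')\<in>R. letter_bound n U U M \<beta> c c') \<longrightarrow> (\<forall>c\<in>{1..m}. (c0, c) \<in> R ^^ (2 ^ P)) \<longrightarrow>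
    (\<forall>x\<in>U. \<kappa> * n \<le> card {i\<in>{1..n}. x i = c0}) \<longrightarrow>
    J \<subseteq> {1..n} \<longrightarrow> d \<le> card J \<longrightarrow> card J \<le> (1 - \<kappa>) * n \<longrightarrow> junta n U J h \<longrightarrow> pure n U (card J) h \<longrightarrow>
    0 \<le> ip U h (app U M h) \<longrightarrow> ip U h (app U M h) \<le> \<delta> * ip U h h"
proof -
  \<comment> \<open>The letter bound and the growth of the defect after \<open>P\<close> squarings.
    The parameters are therefore requested for \<open>\<delta> ^ 2 ^ P\<close>, and the admissible
    defect is divided by \<open>?a\<close>.\<close>
  let ?\<beta> = "\<beta> ^ 2 ^ P" and ?a = "(1 + (real m)\<^sup>2) ^ P"
  have b: "0 < ?\<beta>" "?\<beta> \<le> 1" using assms by (auto simp: power_le_one)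
  have a: "?a > 0" by (intro zero_less_power) (simp add: add_pos_nonneg)
  obtain d \<eta>\<^sub>0 and q D :: nat where d: "1 \<le> d" "0 < \<eta>\<^sub>0" "1 \<le> q" and par: "\<forall>(n::nat) (e::nat). d \<le> e \<longrightarrow> real e \<le> (1 - \<kappa>) * n \<longrightarrow>
    0 < n \<and> q * D \<le> n - e \<and> (\<exists>s::nat. s \<le> n \<and> s \<le> ?\<beta> * \<kappa> * n / 2 \<and> (\<forall>\<eta>. 0 \<le> \<eta> \<longrightarrow> \<eta> \<le> \<eta>\<^sub>0 \<longrightarrow>
      m * (4 * (1 / n + \<eta>) / (?\<beta> * \<kappa>)\<^sup>2) + sqrt ((1 - s / n) ^ d + q * (1 - s / n) ^ D + 1 / q) \<le> \<delta> ^ 2 ^ P))"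
    using high_degree_parameters[OF b assms(3,4) zero_less_power[OF assms(5), of "2 ^ P"], of m]
    by (elim exE conjE) (rule that)
  show ?thesis
  proof (intro exI[of _ d] conjI exI[of _ "\<eta>\<^sub>0 / ?a"] allI impI)
    show "1 \<le> d" "0 < \<eta>\<^sub>0 / ?a" using d a by auto
    fix n U M R \<eta> c0 J h
    assume o: "orbit n m U" and M: "markov n U U M" and sym: "\<forall>x\<in>U. \<forall>w\<in>U. M x w = M w x"
      and def: "defect_le n U U M \<eta>" and \<eta>: "0 \<le> \<eta>" "\<eta> \<le> \<eta>\<^sub>0 / ?a"
      and lb: "\<forall>(c, c')\<in>R. letter_bound n U U M \<beta> c c'" and R: "\<forall>c\<in>{1..m}. (c0, c) \<in> R ^^ (2 ^ P)"
      and cnt: "\<forall>x\<in>U. \<kappa> * n \<le> card {i\<in>{1..n}. x i = c0}"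
      and J: "J \<subseteq> {1..n}" "d \<le> card J" "card J \<le> (1 - \<kappa>) * n"
      and h: "junta n U J h" "pure n U (card J) h" and pos: "0 \<le> ip U h (app U M h)"
    interpret orbit n m U by fact
    note kp = kpow_properties[OF M def less_imp_le[OF assms(1)], of R]
    obtain s where s: "s \<le> n" "s \<le> ?\<beta> * \<kappa> * n / 2" and n: "0 < n" "q * D \<le> n - card J" and
      sb: "\<And>\<eta>. 0 \<le> \<eta> \<Longrightarrow> \<eta> \<le> \<eta>\<^sub>0 \<Longrightarrow>
      m * (4 * (1 / n + \<eta>) / (?\<beta> * \<kappa>)\<^sup>2) + sqrt ((1 - s / n) ^ d + q * (1 - s / n) ^ D + 1 / q) \<le> \<delta> ^ 2 ^ P"
      using par[rule_format, OF J(2,3)] by blast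
    have a\<eta>: "0 \<le> ?a * \<eta>" "?a * \<eta> \<le> \<eta>\<^sub>0" using \<eta> a by (auto simp: pos_le_divide_eq mult.commute)
    have "ip U h (app U (kpow U M P) h) \<le> (m * (4 * (1 / n + ?a * \<eta>) / (?\<beta> * \<kappa>)\<^sup>2) +
        sqrt ((1 - s / n) ^ d + q * (1 - s / n) ^ D + 1 / q)) * ip U h h"
      using cnt R lb
      by (intro full_support_kernel_pure_junta_le[OF kp(1,2) kp(3), where ?c0.0 = c0 and J = J] s n d J h a\<eta> b assms) auto
    also have "\<dots> \<le> \<delta> ^ 2 ^ P * ip U h h" by (intro mult_right_mono sb a\<eta> ip_nonneg)
    finally show "ip U h (app U M h) \<le> \<delta> * ip U h h"
      using ip_app_kpow_power_le[OF sym[rule_format] pos less_imp_le[OF assms(5)]] by blast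
  qed
qed

section \<open>Symmetric laws\<close>

definition adj :: "'a set \<Rightarrow> ('a \<Rightarrow> 'b \<Rightarrow> real) \<Rightarrow> ('a \<Rightarrow> real) \<Rightarrow> 'b \<Rightarrow> real" where
  "adj U D f y = (\<Sum>x\<in>U. D x y * f x)"

lemma adj_eq_app: "adj U D f = app U (\<lambda>y x. D x y) f"
  by (simp add: adj_def app_def fun_eq_iff)

lemma ip_adj: "ip V (adj U D f) g = (\<Sum>x\<in>U. \<Sum>y\<in>V. D x y * f x * g y)"
  unfolding ip_def adj_def sum_distrib_right by (rule sum.swap)

lemma ip_gram: "ip U f (app U (\<lambda>x w. \<Sum>y\<in>V. D x y * D w y) g) = ip V (adj U D f) (adj U D g)"
proof -
  have "ip U f (app U (\<lambda>x w. \<Sum>y\<in>V. D x y * D w y) g) =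
      (\<Sum>x\<in>U. \<Sum>w\<in>U. \<Sum>y\<in>V. D x y * f x * (D w y * g w))"
    unfolding ip_def app_def sum_distrib_left sum_distrib_right by (simp add: mult_ac)
  also have "\<dots> = (\<Sum>x\<in>U. \<Sum>y\<in>V. \<Sum>w\<in>U. D x y * f x * (D w y * g w))"
    by (intro sum.cong refl sum.swap)
  also have "\<dots> = (\<Sum>x\<in>U. \<Sum>y\<in>V. D x y * f x * adj U D g y)"
    by (simp add: adj_def sum_distrib_left)
  finally show ?thesis by (simp add: ip_adj)
qed

text \<open>On a pure \<open>J\<close>-junta all iterates of \<open>Q\<close> remain pure
  \<open>J\<close>-juntas, so their norms grow at most like \<open>l ^ r\<close>. A sum of such
  functions has the same growth rate with a worse constant, and
  \<open>quadratic_form_le_of_growth\<close> forgets the constant.\<close>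

lemma (in orbit) equivariant_form_bound_from_pure_juntas:
  fixes D :: "(nat \<Rightarrow> nat) \<Rightarrow> (nat \<Rightarrow> nat) \<Rightarrow> real"
  assumes V: "orbit n m' V"
    and equiv: "\<And>\<pi> x y. \<pi> permutes {1..n} \<Longrightarrow> x \<in> U \<Longrightarrow> y \<in> V \<Longrightarrow> D (x \<circ> \<pi>) (y \<circ> \<pi>) = D x y"
    and l: "0 < l"
    and pj: "\<And>J h. J \<subseteq> {1..n} \<Longrightarrow> card J \<le> e \<Longrightarrow> junta n U J h \<Longrightarrow> pure n U (card J) h \<Longrightarrow>
      ip V (adj U D h) (adj U D h) \<le> l * ip U h h"
    and e: "\<And>x. x \<in> U \<Longrightarrow> \<exists>J\<subseteq>{1..n}. card J \<le> e \<and> (\<forall>y\<in>U. (\<forall>i\<in>J. y i = x i) \<longrightarrow> y = x)"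
  shows "ip V (adj U D f) (adj U D f) \<le> l * ip U f f"
proof -
  interpret V: orbit n m' V by fact
  define M where "M x w = (\<Sum>y\<in>V. D x y * D w y)" for x w
  define Q where "Q = app U M"
  have Mequiv: "M (x \<circ> \<pi>) (w \<circ> \<pi>) = M x w" if "\<pi> permutes {1..n}" "x \<in> U" "w \<in> U" for \<pi> x w
  proof -
    have "M (x \<circ> \<pi>) (w \<circ> \<pi>) = (\<Sum>y\<in>V. D (x \<circ> \<pi>) (y \<circ> \<pi>) * D (w \<circ> \<pi>) (y \<circ> \<pi>))"
      unfolding M_def using V.sum_permute[OF that(1), of "\<lambda>y. D (x \<circ> \<pi>) y * D (w \<circ> \<pi>) y"] by simp
    then show ?thesis unfolding M_def using equiv[OF that(1)] that(2,3) by simp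
  qed
  have sa: "ip U f (Q g) = ip U (Q f) g" for f g
    unfolding Q_def by (rule ip_app_symmetric) (simp add: M_def mult.commute)
  have ipQ: "ip U f (Q g) = ip V (adj U D f) (adj U D g)" for f g
    unfolding Q_def M_def by (rule ip_gram)
  have o: "orbit n m U" ..
  have Qj: "junta n U J (Q h)" if "junta n U J h" for J h
    unfolding Q_def using Mequiv by (intro junta_app[OF o _ that])
  have Qp: "pure n U k (Q h)" if "pure n U k h" for k h
    unfolding pure_def
  proof (intro allI impI)
    fix J v assume "J \<subseteq> {1..n}" "card J < k" "junta n U J v"
    then show "ip U (Q h) v = 0" using that Qj[of J v] by (simp add: sa[symmetric] pure_def)
  qed
  have Qcong: "(Q ^^ r) f x = (Q ^^ r) g x" if "x \<in> U" "\<And>x. x \<in> U \<Longrightarrow> f x = g x" for r f g x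
    using that
  proof (induction r arbitrary: x)
    case (Suc r)
    then show ?case by (simp add: Q_def app_def)
  qed simp
  have Qadd: "(Q ^^ r) (\<lambda>x. f x + g x) = (\<lambda>x. (Q ^^ r) f x + (Q ^^ r) g x)" for r f g
    by (induction r) (auto simp: Q_def app_def fun_eq_iff algebra_simps sum.distrib)
  have Qzero: "(Q ^^ r) (\<lambda>x. 0) = (\<lambda>x. 0)" for r
    by (induction r) (auto simp: Q_def app_def fun_eq_iff)
  \<comment> \<open>The constant may depend on \<open>f\<close> and on the number of summands in its
    decomposition; only the rate matters, and this is what makes the property additive.\<close>
  define good where "good f \<longleftrightarrow> (\<exists>c\<ge>0. \<forall>r. ip U ((Q ^^ r) f) ((Q ^^ r) f) \<le> c * (l ^ r)\<^sup>2)" for f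
  have good_add: "good (\<lambda>x. f x + g x)" if fg: "good f" "good g" for f g
  proof -
    obtain c where c: "c \<ge> 0" "\<And>r. ip U ((Q ^^ r) f) ((Q ^^ r) f) \<le> c * (l ^ r)\<^sup>2" using fg(1) by (auto simp: good_def)
    obtain c' where c': "c' \<ge> 0" "\<And>r. ip U ((Q ^^ r) g) ((Q ^^ r) g) \<le> c' * (l ^ r)\<^sup>2" using fg(2) by (auto simp: good_def)
    have "ip U ((Q ^^ r) (\<lambda>x. f x + g x)) ((Q ^^ r) (\<lambda>x. f x + g x)) \<le> (2 * c + 2 * c') * (l ^ r)\<^sup>2" for r
      unfolding Qadd using ip_self_add_le[of U "(Q ^^ r) f" "(Q ^^ r) g"] c(2)[of r] c'(2)[of r]
      by (simp add: algebra_simps)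
    then show ?thesis using c(1) c'(1) unfolding good_def by (intro exI[of _ "2 * c + 2 * c'"]) auto
  qed
  have good_cong: "good g" if "\<And>x. x \<in> U \<Longrightarrow> f x = g x" "good f" for f g
  proof -
    have "ip U ((Q ^^ r) g) ((Q ^^ r) g) = ip U ((Q ^^ r) f) ((Q ^^ r) f)" for r
      using Qcong[OF _ that(1)] by (intro ip_cong) auto
    then show ?thesis using that(2) by (simp add: good_def)
  qed
  have good_zero: "good (\<lambda>x. 0)"
    unfolding good_def by (intro exI[of _ 0]) (simp add: Qzero ip_def)
  have good_pure: "good h" if J: "J \<subseteq> {1..n}" "card J \<le> e" and h: "junta n U J h" "pure n U (card J) h" for J h
  proof -
    have jp: "junta n U J ((Q ^^ r) h) \<and> pure n U (card J) ((Q ^^ r) h)" for r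
      by (induction r) (auto simp: h Qj Qp)
    \<comment> \<open>The hypothesis bounds a quadratic form, whereas iteration needs the norm of
      \<open>Q u\<close>. Its square is the inner product of \<open>adj U D u\<close> and
      \<open>adj U D (Q u)\<close>, and the hypothesis applies to both because \<open>Q u\<close> is
      again a pure \<open>J\<close>-junta.\<close>
    have step: "ip U (Q u) (Q u) \<le> l\<^sup>2 * ip U u u"
      if u: "junta n U J u" "pure n U (card J) u" for u
    proof -
      have pQ: "ip V (adj U D (Q u)) (adj U D (Q u)) \<le> l * ip U (Q u) (Q u)"
        by (rule pj[OF J Qj[OF u(1)] Qp[OF u(2)]])
      have pu: "ip V (adj U D u) (adj U D u) \<le> l * ip U u u" by (rule pj[OF J u])
      have "ip U (Q u) (Q u) = ip V (adj U D u) (adj U D (Q u))"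
        using sa[of u "Q u"] by (simp add: ipQ)
      then have "(ip U (Q u) (Q u))\<^sup>2 \<le> ip V (adj U D u) (adj U D u) * ip V (adj U D (Q u)) (adj U D (Q u))"
        using ip_Cauchy_Schwarz[of V "adj U D u" "adj U D (Q u)"] by simp
      also have "\<dots> \<le> (l * ip U u u) * (l * ip U (Q u) (Q u))"
        using pQ pu l by (intro mult_mono) (auto simp: ip_nonneg)
      finally have "ip U (Q u) (Q u) * ip U (Q u) (Q u) \<le> (l\<^sup>2 * ip U u u) * ip U (Q u) (Q u)"
        by (simp add: power2_eq_square mult_ac)
      then show ?thesis
        using ip_nonneg[of U "Q u"] ip_nonneg[of U u]
        by (cases "ip U (Q u) (Q u) = 0") (auto simp: mult_le_cancel_right)
    qed
    have "ip U ((Q ^^ r) h) ((Q ^^ r) h) \<le> ip U h h * (l ^ r)\<^sup>2" for r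
    proof (induction r)
      case (Suc r)
      have "ip U ((Q ^^ Suc r) h) ((Q ^^ Suc r) h) \<le> l\<^sup>2 * ip U ((Q ^^ r) h) ((Q ^^ r) h)"
        using step jp by simp
      also have "\<dots> \<le> l\<^sup>2 * (ip U h h * (l ^ r)\<^sup>2)" using Suc by (intro mult_left_mono) auto
      finally show ?case by (simp add: power_mult_distrib mult_ac)
    qed simp
    then show ?thesis unfolding good_def using ip_nonneg by blast
  qed
  have good_junta: "good h" if J: "J \<subseteq> {1..n}" "card J \<le> e" "junta n U J h" for J h
    by (rule pure_junta_induct[OF good_cong good_zero good_add good_pure J])
  \<comment> \<open>By the hypothesis \<open>e\<close> a point mass is a junta on at most
    \<open>e\<close> coordinates, and every function on \<open>U\<close> is a combination of point
    masses.\<close>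
  have good_sum: "good (\<lambda>x. \<Sum>a\<in>S. f a * of_bool (x = a))" if "finite S" "S \<subseteq> U" for S
    using that
  proof (induction S rule: finite_induct)
    case empty then show ?case using good_zero by simp
  next
    case (insert a S)
    then have a: "a \<in> U" by simp
    obtain J where J: "J \<subseteq> {1..n}" "card J \<le> e" "\<forall>y\<in>U. (\<forall>i\<in>J. y i = a i) \<longrightarrow> y = a" using e[OF a] by blast
    have "junta n U J (\<lambda>x. f a * of_bool (x = a))"
      using J(3) by (intro juntaI[OF J(1)]) (auto simp: of_bool_def)
    then have "good (\<lambda>x. f a * of_bool (x = a))" by (rule good_junta[OF J(1,2)])
    from good_add[OF this insert.IH] show ?case
      unfolding sum.insert[OF insert.hyps] using insert.prems by blast
  qed
  have "good f"
  proof (rule good_cong[OF _ good_sum[OF fin order_refl]])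
    fix x assume "x \<in> U"
    then show "(\<Sum>a\<in>U. f a * of_bool (x = a)) = f x" using fin by (simp add: Int_insert_right)
  qed
  then obtain c where "\<And>r. ip U ((Q ^^ r) f) ((Q ^^ r) f) \<le> c * (l ^ r)\<^sup>2" by (auto simp: good_def)
  from quadratic_form_le_of_growth[OF sa this l] show ?thesis by (simp add: ipQ)
qed

section \<open>Symmetric laws close to a product, and their high-degree contraction\<close>

definition sym_law :: "nat \<Rightarrow> (nat \<Rightarrow> nat) set \<Rightarrow> (nat \<Rightarrow> nat) set \<Rightarrow> ((nat \<Rightarrow> nat) \<Rightarrow> (nat \<Rightarrow> nat) \<Rightarrow> real) \<Rightarrow> bool" where
  "sym_law n A B p \<longleftrightarrow> (\<forall>a\<in>A. \<forall>b\<in>B. 0 \<le> p a b) \<and> (\<forall>a\<in>A. (\<Sum>b\<in>B. p a b) = 1 / card A) \<and>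
    (\<forall>b\<in>B. (\<Sum>a\<in>A. p a b) = 1 / card B) \<and>
    (\<forall>\<pi>. \<pi> permutes {1..n} \<longrightarrow> (\<forall>a\<in>A. \<forall>b\<in>B. p (a \<circ> \<pi>) (b \<circ> \<pi>) = p a b))"

definition expec :: "'a set \<Rightarrow> 'b set \<Rightarrow> ('a \<Rightarrow> 'b \<Rightarrow> real) \<Rightarrow> ('a \<Rightarrow> 'b \<Rightarrow> real) \<Rightarrow> real" where
  "expec A B p F = (\<Sum>a\<in>A. \<Sum>b\<in>B. p a b * F a b)"

text \<open>Here \<open>q i P\<close> is the probability of \<open>P\<close> under a reference law for the pair of letters at coordinate \<open>i\<close>.\<close>

definition near_product :: "nat \<Rightarrow> (nat \<Rightarrow> nat) set \<Rightarrow> (nat \<Rightarrow> nat) set \<Rightarrow> ((nat \<Rightarrow> nat) \<Rightarrow> (nat \<Rightarrow> nat) \<Rightarrow> real) \<Rightarrow>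
    real \<Rightarrow> (nat \<Rightarrow> (nat \<Rightarrow> nat \<Rightarrow> bool) \<Rightarrow> real) \<Rightarrow> bool" where
  "near_product n A B p \<tau> q \<longleftrightarrow> (\<forall>i P. 0 \<le> q i P \<and> q i P \<le> 1) \<and>
    (\<forall>i\<in>{1..n}. \<forall>P. \<bar>expec A B p (\<lambda>x y. of_bool (P (x i) (y i))) - q i P\<bar> \<le> \<tau>) \<and>
    (\<forall>i\<in>{1..n}. \<forall>j\<in>{1..n}. i \<noteq> j \<longrightarrow> (\<forall>P P'.
      \<bar>expec A B p (\<lambda>x y. of_bool (P (x i) (y i)) * of_bool (P' (x j) (y j))) - q i P * q j P'\<bar> \<le> \<tau>))"

lemma sym_law_swap: "sym_law n A B p \<Longrightarrow> sym_law n B A (\<lambda>b a. p a b)"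
  unfolding sym_law_def by blast

lemma expec_swap: "expec A B p F = expec B A (\<lambda>b a. p a b) (\<lambda>b a. F a b)"
  unfolding expec_def by (rule sum.swap)

lemma near_product_swap:
  assumes "near_product n A B p \<tau> q"
  shows "near_product n B A (\<lambda>b a. p a b) \<tau> (\<lambda>i P. q i (\<lambda>a b. P b a))"
proof -
  note np = assms[unfolded near_product_def]
  have sw: "expec B A (\<lambda>b a. p a b) F = expec A B p (\<lambda>a b. F b a)" for F
    by (rule expec_swap)
  show ?thesis
    unfolding near_product_def sw
  proof (intro conjI allI ballI impI)
    fix i j P P' assume "i \<in> {1..n}" "j \<in> {1..n}" "i \<noteq> j"
    then show "\<bar>expec A B p (\<lambda>a b. of_bool (P (b i) (a i)) * of_bool (P' (b j) (a j))) -
        q i (\<lambda>a b. P b a) * q j (\<lambda>a b. P' b a)\<bar> \<le> \<tau>"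
      using np[THEN conjunct2, THEN conjunct2, rule_format, of i j "\<lambda>a b. P b a" "\<lambda>a b. P' b a"] by simp
  next
    fix i P assume "i \<in> {1..n}"
    then show "\<bar>expec A B p (\<lambda>a b. of_bool (P (b i) (a i))) - q i (\<lambda>a b. P b a)\<bar> \<le> \<tau>"
      using np[THEN conjunct2, THEN conjunct1, rule_format, of i "\<lambda>a b. P b a"] by simp
  qed (use np in auto)
qed

lemma markov_of_sym_law:
  assumes "sym_law n A B p" "card A > 0"
  shows "markov n A B (\<lambda>a b. real (card A) * p a b)"
  using assms by (auto simp: markov_def sym_law_def sum_distrib_left[symmetric])

text \<open>The conditional probability of the letter \<open>b\<close> at \<open>i\<close> depends
  only on the letter of \<open>x\<close> at \<open>i\<close>, and it is at least the joint
  probability, since the event conditioned on has probability at most 1.\<close>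

lemma letter_bound_of_sym_law:
  assumes "orbit n mA A" "orbit n mB B" and p: "sym_law n A B p"
    and ex: "\<And>i. i \<in> {1..n} \<Longrightarrow> \<alpha> \<le> expec A B p (\<lambda>x y. of_bool (x i = c \<and> y i = b))"
  shows "letter_bound n A B (\<lambda>a b. real (card A) * p a b) \<alpha> c b"
  unfolding letter_bound_def
proof (intro ballI impI)
  interpret A: orbit n mA A by fact
  interpret B: orbit n mB B by fact
  let ?K = "\<lambda>a b. real (card A) * p a b"
  note K = markov_of_sym_law[OF p A.card_pos]
  fix i a assume i: "i \<in> {1..n}" and a: "a \<in> A" "a i = c"
  define v where "v = app B ?K (letter i b)"
  have vj: "junta n A {i} v"
    unfolding v_def using markovD(4)[OF K] by (intro junta_app[OF assms(2)] B.junta_letter i)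
  have v0: "0 \<le> v a" unfolding v_def by (rule app_bounds(1)[OF K a(1) letter_bounds])
  have "expec A B p (\<lambda>x y. of_bool (x i = c \<and> y i = b)) = (\<Sum>x\<in>A. letter i c x * v x) / card A"
    using A.card_pos unfolding expec_def v_def app_def letter_def sum_divide_distrib sum_distrib_left
    by (intro sum.cong refl) auto
  also have "(\<Sum>x\<in>A. letter i c x * v x) = (\<Sum>x\<in>A. letter i c x * v a)"
  proof (intro sum.cong refl)
    fix x assume "x \<in> A"
    then have "v x = v a" if "x i = c" using A.junta_eq[OF vj _ _ a(1), of x] that i a(2) by simp
    then show "letter i c x * v x = letter i c x * v a" by (auto simp: letter_def)
  qed
  also have "\<dots> \<le> (\<Sum>x\<in>A. 1 * v a)" using letter_bounds v0 by (intro sum_mono mult_right_mono) auto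
  finally have "expec A B p (\<lambda>x y. of_bool (x i = c \<and> y i = b)) \<le> v a"
    using A.card_pos by (simp add: divide_right_mono field_simps)
  then show "\<alpha> \<le> app B ?K (letter i b) a" using ex[OF i] unfolding v_def by linarith
qed

lemma abs_prod_diff_le:
  fixes a b c d :: real
  assumes "\<bar>a - c\<bar> \<le> t" "\<bar>b - d\<bar> \<le> t" "0 \<le> b" "b \<le> 1" "0 \<le> c" "c \<le> 1"
  shows "\<bar>a * b - c * d\<bar> \<le> 2 * t"
proof -
  have "a * b - c * d = (a - c) * b + c * (b - d)" by (simp add: algebra_simps)
  moreover have "\<bar>(a - c) * b\<bar> \<le> t * 1" unfolding abs_mult using assms by (intro mult_mono) auto
  moreover have "\<bar>c * (b - d)\<bar> \<le> 1 * t" unfolding abs_mult using assms by (intro mult_mono) auto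
  ultimately show ?thesis by linarith
qed

text \<open>On the class of vectors with given letters at \<open>i\<close> and \<open>j\<close> the
  three conditional expectations are constant, so the defect on a class is the difference of two
  numbers. Both are compared with products of the reference probabilities \<open>q\<close>, weighted
  by the mass of the class instead of divided by it, so that rare classes do no harm. Each of the
  \<open>mA * mA\<close> classes contributes at most \<open>6 * \<tau>\<close>.\<close>

lemma defect_le_of_sym_law:
  assumes "orbit n mA A" "orbit n mB B" and p: "sym_law n A B p" and np: "near_product n A B p \<tau> q"
  shows "defect_le n A B (\<lambda>a b. real (card A) * p a b) (6 * (real mA)\<^sup>2 * \<tau>)"
  unfolding defect_le_def
proof (intro ballI impI allI)
  interpret A: orbit n mA A by fact
  interpret B: orbit n mB B by fact
  let ?K = "\<lambda>a b. real (card A) * p a b" and ?N = "real (card A)"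
  note K = markov_of_sym_law[OF p A.card_pos]
  have N: "?N > 0" using A.card_pos by simp
  fix i j b b' assume i: "i \<in> {1..n}" and j: "j \<in> {1..n}" and ij: "i \<noteq> j"
  define u where "u = app B ?K (letter i b)"
  define v where "v = app B ?K (letter j b')"
  define w where "w = app B ?K (\<lambda>y. letter i b y * letter j b' y)"
  have uj: "junta n A {i} u"
    unfolding u_def using markovD(4)[OF K] by (intro junta_app[OF assms(2)] B.junta_letter i)
  have vj: "junta n A {j} v"
    unfolding v_def using markovD(4)[OF K] by (intro junta_app[OF assms(2)] B.junta_letter j)
  have wj: "junta n A {i, j} w"
  proof -
    have "junta n B {i, j} (\<lambda>y. letter i b y * letter j b' y)"
      using i j by (intro B.juntaI) (auto simp: letter_def)
    then show ?thesis unfolding w_def using markovD(4)[OF K] by (intro junta_app[OF assms(2)])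
  qed
  have ub: "0 \<le> u a" "u a \<le> 1" and vb: "0 \<le> v a" "v a \<le> 1" if "a \<in> A" for a
    unfolding u_def v_def using app_bounds[OF K that letter_bounds] by auto
  have marg: "expec A B p (\<lambda>x y. F x) = (\<Sum>x\<in>A. F x) / ?N" for F
    using p unfolding expec_def sum_divide_distrib
    by (intro sum.cong refl) (simp add: sum_distrib_right[symmetric] sym_law_def)
  have joint: "expec A B p (\<lambda>x y. F x * G y) = (\<Sum>x\<in>A. F x * app B ?K G x) / ?N" for F G
    using N unfolding expec_def app_def sum_divide_distrib sum_distrib_left
    by (intro sum.cong refl) simp
  note np1 = np[unfolded near_product_def, THEN conjunct2, THEN conjunct1, rule_format]
  note np2 = np[unfolded near_product_def, THEN conjunct2, THEN conjunct2, rule_format, OF i j ij]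
  note q01 = np[unfolded near_product_def, THEN conjunct1, rule_format]
  have cls: "(\<Sum>a\<in>A. letter i c a * letter j c' a * \<bar>w a - u a * v a\<bar>) \<le> 6 * \<tau> * ?N" for c c'
  proof (cases "\<exists>a\<in>A. a i = c \<and> a j = c'")
    case False
    then have "letter i c a * letter j c' a * \<bar>w a - u a * v a\<bar> = 0" if "a \<in> A" for a
      using that by (auto simp: letter_def)
    then have "(\<Sum>a\<in>A. letter i c a * letter j c' a * \<bar>w a - u a * v a\<bar>) = 0" by (rule sum.neutral[OF ballI])
    moreover have "0 \<le> \<tau>" using np1[OF i] abs_ge_zero order_trans by blast
    ultimately show ?thesis by simp
  next
    case True
    then obtain a0 where a0: "a0 \<in> A" "a0 i = c" "a0 j = c'" by blast
    define L where "L a = letter i c a * letter j c' a" for a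
    have L: "L a \<ge> 0" for a by (simp add: L_def letter_bounds)
    have const: "u a = u a0" "v a = v a0" "w a = w a0" if "a \<in> A" "L a \<noteq> 0" for a
    proof -
      have "a i = c" "a j = c'" using that by (auto simp: L_def letter_def)
      then show "u a = u a0" "v a = v a0" "w a = w a0"
        using i j a0 by (auto intro: A.junta_eq[OF uj _ that(1) a0(1)] A.junta_eq[OF vj _ that(1) a0(1)]
            A.junta_eq[OF wj _ that(1) a0(1)])
    qed
    have constu: "u a = u a0" if "a \<in> A" "a i = c" for a
      using A.junta_eq[OF uj _ that(1) a0(1)] that i a0 by auto
    have constv: "v a = v a0" if "a \<in> A" "a j = c'" for a
      using A.junta_eq[OF vj _ that(1) a0(1)] that j a0 by auto
    define P2 where "P2 = (\<Sum>a\<in>A. L a * w a) / ?N"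
    define Pi2 where "Pi2 = (\<Sum>a\<in>A. L a) / ?N"
    define Pi where "Pi = (\<Sum>a\<in>A. letter i c a) / ?N"
    define Pj where "Pj = (\<Sum>a\<in>A. letter j c' a) / ?N"
    have Pi01: "0 \<le> Pi" "Pi \<le> 1" and Pj01: "0 \<le> Pj" "Pj \<le> 1"
      using sum_mono[of A "letter i c" "\<lambda>_. 1"] sum_mono[of A "letter j c'" "\<lambda>_. 1"] N letter_bounds
      by (auto simp: Pi_def Pj_def sum_nonneg pos_divide_le_eq)
    define qi qj qc qc' where "qi = q i (\<lambda>x y. x = c \<and> y = b)" and "qj = q j (\<lambda>x y. x = c' \<and> y = b')"
      and "qc = q i (\<lambda>x y. x = c)" and "qc' = q j (\<lambda>x y. x = c')"
    have e1: "\<bar>P2 - qi * qj\<bar> \<le> \<tau>"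
    proof -
      have "P2 = expec A B p (\<lambda>x y. L x * (letter i b y * letter j b' y))" unfolding joint P2_def w_def ..
      also have "\<dots> = expec A B p (\<lambda>x y. of_bool (x i = c \<and> y i = b) * of_bool (x j = c' \<and> y j = b'))"
        unfolding expec_def L_def letter_def by (intro sum.cong refl) (auto simp: of_bool_def)
      finally show ?thesis using np2[of "\<lambda>x y. x = c \<and> y = b" "\<lambda>x y. x = c' \<and> y = b'"] by (simp add: qi_def qj_def)
    qed
    have Piu: "Pi * u a0 = expec A B p (\<lambda>x y. of_bool (x i = c \<and> y i = b))"
    proof -
      have "Pi * u a0 = (\<Sum>a\<in>A. letter i c a * u a) / ?N"
        unfolding Pi_def times_divide_eq_left sum_distrib_right
        by (intro arg_cong2[where f = "(/)"] refl sum.cong) (auto simp: letter_def constu)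
      also have "\<dots> = expec A B p (\<lambda>x y. letter i c x * letter i b y)" unfolding joint u_def ..
      also have "\<dots> = expec A B p (\<lambda>x y. of_bool (x i = c \<and> y i = b))"
        unfolding expec_def letter_def by (intro sum.cong refl) (auto simp: of_bool_def)
      finally show ?thesis .
    qed
    have Pjv: "Pj * v a0 = expec A B p (\<lambda>x y. of_bool (x j = c' \<and> y j = b'))"
    proof -
      have "Pj * v a0 = (\<Sum>a\<in>A. letter j c' a * v a) / ?N"
        unfolding Pj_def times_divide_eq_left sum_distrib_right
        by (intro arg_cong2[where f = "(/)"] refl sum.cong) (auto simp: letter_def constv)
      also have "\<dots> = expec A B p (\<lambda>x y. letter j c' x * letter j b' y)" unfolding joint v_def ..
      also have "\<dots> = expec A B p (\<lambda>x y. of_bool (x j = c' \<and> y j = b'))"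
        unfolding expec_def letter_def by (intro sum.cong refl) (auto simp: of_bool_def)
      finally show ?thesis .
    qed
    have e2: "\<bar>(Pi * u a0) * (Pj * v a0) - qi * qj\<bar> \<le> 2 * \<tau>"
      using np1[OF i, of "\<lambda>x y. x = c \<and> y = b"] np1[OF j, of "\<lambda>x y. x = c' \<and> y = b'"] q01 Pj01 vb[OF a0(1)]
      by (intro abs_prod_diff_le) (auto simp: Piu[symmetric] Pjv[symmetric] qi_def qj_def mult_le_one)
    have "\<bar>Pi - qc\<bar> \<le> \<tau>" "\<bar>Pj - qc'\<bar> \<le> \<tau>"
      using np1[OF i, of "\<lambda>x y. x = c"] np1[OF j, of "\<lambda>x y. x = c'"]
      by (simp_all add: marg Pi_def Pj_def qc_def qc'_def letter_def)
    then have e3: "\<bar>Pi * Pj - qc * qc'\<bar> \<le> 2 * \<tau>"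
      using q01 Pj01 by (intro abs_prod_diff_le) (auto simp: qc_def)
    have e4: "\<bar>Pi2 - qc * qc'\<bar> \<le> \<tau>"
      using np2[of "\<lambda>x y. x = c" "\<lambda>x y. x = c'"]
      by (simp add: marg[of "\<lambda>x. of_bool (x i = c) * of_bool (x j = c')"] Pi2_def L_def letter_def qc_def qc'_def)
    have e5: "\<bar>(Pi * Pj - Pi2) * (u a0 * v a0)\<bar> \<le> 3 * \<tau>"
    proof -
      have uv1: "\<bar>u a0 * v a0\<bar> \<le> 1" using ub[OF a0(1)] vb[OF a0(1)] by (simp add: mult_le_one)
      have "\<bar>(Pi * Pj - Pi2) * (u a0 * v a0)\<bar> \<le> \<bar>Pi * Pj - Pi2\<bar> * 1"
        unfolding abs_mult[of "Pi * Pj - Pi2"] using uv1 by (intro mult_left_mono) auto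
      moreover have "\<bar>a - b\<bar> \<le> 3 * \<tau>" if "\<bar>a - c\<bar> \<le> 2 * \<tau>" "\<bar>b - c\<bar> \<le> \<tau>" for a b c
        using that by linarith
      note this[OF e3 e4]
      ultimately show ?thesis by simp
    qed
    have "(\<Sum>a\<in>A. L a * \<bar>w a - u a * v a\<bar>) = (\<Sum>a\<in>A. L a * \<bar>w a0 - u a0 * v a0\<bar>)"
      using const by (intro sum.cong refl) (metis mult_zero_left)
    also have "\<dots> = \<bar>(\<Sum>a\<in>A. L a) * (w a0 - u a0 * v a0)\<bar>"
      using L by (simp only: abs_mult sum_distrib_right[symmetric] abs_of_nonneg[OF sum_nonneg[of A L]])
    also have "(\<Sum>a\<in>A. L a) * (w a0 - u a0 * v a0) = ?N * (P2 - Pi2 * (u a0 * v a0))"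
    proof -
      have "(\<Sum>a\<in>A. L a) * w a0 = (\<Sum>a\<in>A. L a * w a)"
        unfolding sum_distrib_right using const(3) by (intro sum.cong refl) (metis mult_zero_left)
      then show ?thesis using N by (simp add: P2_def Pi2_def right_diff_distrib)
    qed
    \<comment> \<open>The three differences are at most \<tau>, \<open>2 * \<tau>\<close> and
      \<open>3 * \<tau>\<close>, by \<open>e1\<close>, \<open>e2\<close> and
      \<open>e5\<close>.\<close>
    also have "P2 - Pi2 * (u a0 * v a0) = (P2 - qi * qj) - ((Pi * u a0) * (Pj * v a0) - qi * qj) +
        (Pi * Pj - Pi2) * (u a0 * v a0)" by (simp add: algebra_simps)
    also have "\<bar>?N * \<dots>\<bar> \<le> ?N * (6 * \<tau>)"
    proof -
      have "\<bar>a - b + c\<bar> \<le> 6 * \<tau>" if "\<bar>a\<bar> \<le> \<tau>" "\<bar>b\<bar> \<le> 2 * \<tau>" "\<bar>c\<bar> \<le> 3 * \<tau>" for a b c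
        using that by linarith
      from this[OF e1 e2 e5] show ?thesis unfolding abs_mult[of ?N] by (simp add: mult_left_mono)
    qed
    finally show ?thesis by (simp add: L_def mult_ac)
  qed
  have "(\<Sum>a\<in>A. \<bar>w a - u a * v a\<bar>) =
      (\<Sum>a\<in>A. \<Sum>c\<in>{1..mA}. \<Sum>c'\<in>{1..mA}. letter i c a * letter j c' a * \<bar>w a - u a * v a\<bar>)"
  proof (intro sum.cong refl)
    fix a assume a: "a \<in> A"
    have one: "(\<Sum>c\<in>{1..mA}. letter k c a) = 1" if "k \<in> {1..n}" for k
    proof -
      have "(\<Sum>c\<in>{1..mA}. letter k c a) = (\<Sum>c\<in>{1..mA}. if a k = c then 1 else 0)"
        by (intro sum.cong) (auto simp: letter_def)
      then show ?thesis using A.letters[OF a that] by (simp add: sum.delta')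
    qed
    have "(\<Sum>c\<in>{1..mA}. \<Sum>c'\<in>{1..mA}. letter i c a * letter j c' a * \<bar>w a - u a * v a\<bar>) =
        (\<Sum>c\<in>{1..mA}. letter i c a) * (\<Sum>c'\<in>{1..mA}. letter j c' a) * \<bar>w a - u a * v a\<bar>"
      unfolding sum_product by (simp only: sum_distrib_right)
    then show "\<bar>w a - u a * v a\<bar> = (\<Sum>c\<in>{1..mA}. \<Sum>c'\<in>{1..mA}. letter i c a * letter j c' a * \<bar>w a - u a * v a\<bar>)"
      by (simp only: one[OF i] one[OF j] mult_1)
  qed
  also have "\<dots> = (\<Sum>c\<in>{1..mA}. \<Sum>c'\<in>{1..mA}. \<Sum>a\<in>A. letter i c a * letter j c' a * \<bar>w a - u a * v a\<bar>)"
    by (subst sum.swap) (intro sum.cong refl sum.swap)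
  also have "\<dots> \<le> (\<Sum>c\<in>{1..mA}. \<Sum>c'\<in>{1..mA}. 6 * \<tau> * ?N)" by (intro sum_mono cls)
  also have "\<dots> = 6 * (real mA)\<^sup>2 * \<tau> * ?N" by (simp add: power2_eq_square)
  finally show "(\<Sum>a\<in>A. \<bar>app B ?K (\<lambda>y. letter i b y * letter j b' y) a - app B ?K (letter i b) a * app B ?K (letter j b') a\<bar>)
      \<le> 6 * (real mA)\<^sup>2 * \<tau> * ?N"
    unfolding u_def v_def w_def .
qed

text \<open>Going from \<open>U\<close> to \<open>U'\<close> and back along the law gives a
  symmetric kernel \<open>M\<close> whose quadratic form is the scaled squared norm of
  \<open>adj U p h\<close>, in particular nonnegative. Two edges of \<open>E\<close> with a common
  second letter give one letter transition of \<open>M\<close>, with probability at least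
  \<open>\<alpha>\<^sub>1 * \<alpha>\<^sub>1\<close>.\<close>

lemma high_degree_law_contraction:
  fixes \<alpha>\<^sub>1 \<kappa> \<delta> :: real and m m' P :: nat
  assumes "0 < \<alpha>\<^sub>1" "\<alpha>\<^sub>1 \<le> 1" "0 < \<kappa>" "\<kappa> \<le> 1" "0 < \<delta>"
  shows "\<exists>d\<ge>1. \<exists>\<tau>\<^sub>0>0. \<forall>n U U' p q E \<tau> c0 J h.
    orbit n m U \<longrightarrow> orbit n m' U' \<longrightarrow> sym_law n U U' p \<longrightarrow> near_product n U U' p \<tau> q \<longrightarrow> 0 \<le> \<tau> \<longrightarrow> \<tau> \<le> \<tau>\<^sub>0 \<longrightarrow>
    (\<forall>(c, b)\<in>E. \<forall>i\<in>{1..n}. \<alpha>\<^sub>1 \<le> expec U U' p (\<lambda>x y. of_bool (x i = c \<and> y i = b))) \<longrightarrow>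
    (\<forall>c\<in>{1..m}. (c0, c) \<in> (E O E\<inverse>) ^^ (2 ^ P)) \<longrightarrow>
    (\<forall>x\<in>U. \<kappa> * n \<le> card {i\<in>{1..n}. x i = c0}) \<longrightarrow>
    J \<subseteq> {1..n} \<longrightarrow> d \<le> card J \<longrightarrow> card J \<le> (1 - \<kappa>) * n \<longrightarrow> junta n U J h \<longrightarrow> pure n U (card J) h \<longrightarrow>
    real (card U) * real (card U') * ip U' (adj U p h) (adj U p h) \<le> \<delta> * ip U h h"
proof -
  have a2: "0 < \<alpha>\<^sub>1 * \<alpha>\<^sub>1" "\<alpha>\<^sub>1 * \<alpha>\<^sub>1 \<le> 1" using assms by (auto simp: mult_le_one)
  obtain d \<eta>\<^sub>0 where d: "1 \<le> d" "0 < \<eta>\<^sub>0" and contr: "\<forall>n U M R \<eta> c0 J h.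
    orbit n m U \<longrightarrow> markov n U U M \<longrightarrow> (\<forall>x\<in>U. \<forall>w\<in>U. M x w = M w x) \<longrightarrow>
    defect_le n U U M \<eta> \<longrightarrow> 0 \<le> \<eta> \<longrightarrow> \<eta> \<le> \<eta>\<^sub>0 \<longrightarrow>
    (\<forall>(c, c')\<in>R. letter_bound n U U M (\<alpha>\<^sub>1 * \<alpha>\<^sub>1) c c') \<longrightarrow> (\<forall>c\<in>{1..m}. (c0, c) \<in> R ^^ (2 ^ P)) \<longrightarrow>
    (\<forall>x\<in>U. \<kappa> * n \<le> card {i\<in>{1..n}. x i = c0}) \<longrightarrow>
    J \<subseteq> {1..n} \<longrightarrow> d \<le> card J \<longrightarrow> card J \<le> (1 - \<kappa>) * n \<longrightarrow> junta n U J h \<longrightarrow> pure n U (card J) h \<longrightarrow>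
    0 \<le> ip U h (app U M h) \<longrightarrow> ip U h (app U M h) \<le> \<delta> * ip U h h"
    using chain_pure_junta_contraction[OF a2 assms(3-5), of m P] by (elim exE conjE) (rule that)
  \<comment> \<open>The defect of the two-step kernel, by \<open>defect_le_kcomp\<close> applied to
    the two one-step defects, is \<open>C - 1\<close> times \<tau>; the summand 1 keeps
    \<open>C\<close> positive.\<close>
  define C where "C = 6 * (real m')\<^sup>2 + (real m')\<^sup>2 * (6 * (real m)\<^sup>2) + 1"
  have C: "C > 0" by (auto simp: C_def intro!: add_nonneg_pos)
  show ?thesis
  proof (rule exI[of _ d], rule conjI[OF d(1) exI[of _ "\<eta>\<^sub>0 / C"]], rule conjI)
    show "0 < \<eta>\<^sub>0 / C" using d C by simp
    show "\<forall>n U U' p q E \<tau> c0 J h.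
    orbit n m U \<longrightarrow> orbit n m' U' \<longrightarrow> sym_law n U U' p \<longrightarrow> near_product n U U' p \<tau> q \<longrightarrow> 0 \<le> \<tau> \<longrightarrow> \<tau> \<le> \<eta>\<^sub>0 / C \<longrightarrow>
    (\<forall>(c, b)\<in>E. \<forall>i\<in>{1..n}. \<alpha>\<^sub>1 \<le> expec U U' p (\<lambda>x y. of_bool (x i = c \<and> y i = b))) \<longrightarrow>
    (\<forall>c\<in>{1..m}. (c0, c) \<in> (E O E\<inverse>) ^^ (2 ^ P)) \<longrightarrow>
    (\<forall>x\<in>U. \<kappa> * n \<le> card {i\<in>{1..n}. x i = c0}) \<longrightarrow>
    J \<subseteq> {1..n} \<longrightarrow> d \<le> card J \<longrightarrow> card J \<le> (1 - \<kappa>) * n \<longrightarrow> junta n U J h \<longrightarrow> pure n U (card J) h \<longrightarrow>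
    real (card U) * real (card U') * ip U' (adj U p h) (adj U p h) \<le> \<delta> * ip U h h"
    proof (intro allI impI)
      fix n U U' p q E \<tau> c0 J h
      assume o: "orbit n m U" and o': "orbit n m' U'" and p: "sym_law n U U' p" and np: "near_product n U U' p \<tau> q"
        and \<tau>: "0 \<le> \<tau>" "\<tau> \<le> \<eta>\<^sub>0 / C"
        and E: "\<forall>(c, b)\<in>E. \<forall>i\<in>{1..n}. \<alpha>\<^sub>1 \<le> expec U U' p (\<lambda>x y. of_bool (x i = c \<and> y i = b))"
        and con: "\<forall>c\<in>{1..m}. (c0, c) \<in> (E O E\<inverse>) ^^ (2 ^ P)"
        and cnt: "\<forall>x\<in>U. \<kappa> * n \<le> card {i\<in>{1..n}. x i = c0}"
        and J: "J \<subseteq> {1..n}" "d \<le> card J" "card J \<le> (1 - \<kappa>) * n" and h: "junta n U J h" "pure n U (card J) h"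
      interpret U: orbit n m U by fact
      interpret U': orbit n m' U' by fact
      let ?S = "\<lambda>x y. real (card U) * p x y" and ?T = "\<lambda>y x. real (card U') * p x y"
      define M where "M = kcomp U' ?S ?T"
      have mS: "markov n U U' ?S" by (rule markov_of_sym_law[OF p U.card_pos])
      have mT: "markov n U' U ?T" by (rule markov_of_sym_law[OF sym_law_swap[OF p] U'.card_pos])
      have M: "markov n U U M" unfolding M_def by (rule markov_kcomp[OF o o' o mS mT])
      have "defect_le n U U M (6 * (real m')\<^sup>2 * \<tau> + (real m')\<^sup>2 * (6 * (real m)\<^sup>2 * \<tau>))"
        unfolding M_def
        by (rule defect_le_kcomp[OF o o' o mS mT defect_le_of_sym_law[OF o o' p np]
              defect_le_of_sym_law[OF o' o sym_law_swap[OF p] near_product_swap[OF np]]])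
      then have dM: "defect_le n U U M ((C - 1) * \<tau>)" by (simp add: C_def algebra_simps)
      have C1: "0 \<le> (C - 1) * \<tau>" using \<tau> by (intro mult_nonneg_nonneg) (auto simp: C_def)
      have "(C - 1) * \<tau> \<le> C * \<tau>" using \<tau> by (intro mult_right_mono) auto
      also have "\<dots> \<le> \<eta>\<^sub>0" using \<tau> C by (simp add: pos_le_divide_eq mult.commute)
      finally have C2: "(C - 1) * \<tau> \<le> \<eta>\<^sub>0" .
      have lb: "letter_bound n U U M (\<alpha>\<^sub>1 * \<alpha>\<^sub>1) c c'" if cc: "(c, c') \<in> E O E\<inverse>" for c c'
      proof -
        obtain b where b: "(c, b) \<in> E" "(c', b) \<in> E" using cc by blast
        have "letter_bound n U U' ?S \<alpha>\<^sub>1 c b"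
          using E b(1) by (intro letter_bound_of_sym_law[OF o o' p]) blast
        moreover have "letter_bound n U' U ?T \<alpha>\<^sub>1 b c'"
        proof (rule letter_bound_of_sym_law[OF o' o sym_law_swap[OF p]])
          fix i assume "i \<in> {1..n}"
          then have "\<alpha>\<^sub>1 \<le> expec U U' p (\<lambda>x y. of_bool (x i = c' \<and> y i = b))" using E b(2) by blast
          then show "\<alpha>\<^sub>1 \<le> expec U' U (\<lambda>b a. p a b) (\<lambda>x y. of_bool (x i = b \<and> y i = c'))"
            by (subst (asm) expec_swap) (simp add: conj_commute)
        qed
        ultimately show ?thesis
          unfolding M_def using assms(1) by (intro letter_bound_kcomp[OF mS mT]) auto
      qed
      have Mg: "M x w = real (card U) * real (card U') * (\<Sum>y\<in>U'. p x y * p w y)" for x w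
        unfolding M_def kcomp_def sum_distrib_left by (simp add: mult_ac)
      have ipM: "ip U h (app U M h) = real (card U) * real (card U') * ip U' (adj U p h) (adj U p h)"
      proof -
        have "ip U h (app U M h) = real (card U) * real (card U') * ip U h (app U (\<lambda>x w. \<Sum>y\<in>U'. p x y * p w y) h)"
          unfolding ip_def app_def Mg sum_distrib_left sum_distrib_right by (simp add: mult_ac)
        then show ?thesis by (simp only: ip_gram)
      qed
      have "ip U h (app U M h) \<le> \<delta> * ip U h h"
      proof (rule contr[rule_format, of n U M "(C - 1) * \<tau>" "E O E\<inverse>" c0 J h])
        show "0 \<le> ip U h (app U M h)" unfolding ipM by (simp add: ip_nonneg)
        show "M x w = M w x" for x w by (simp add: Mg mult.commute)
      qed (use o M dM C1 C2 lb con cnt J h in auto)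
      then show "real (card U) * real (card U') * ip U' (adj U p h) (adj U p h) \<le> \<delta> * ip U h h"
        by (simp only: ipM)
    qed
  qed
qed

text \<open>A \<open>J\<close>-junta repeats its value on the whole class of \<open>x\<close>, so a
  large value shows up in the quadratic norm with the mass of that class.\<close>

lemma (in orbit) junta_sup_le:
  fixes \<rho> :: real
  assumes J: "J \<subseteq> {1..n}" "junta n U J h" and x: "x \<in> U"
    and \<rho>: "0 < \<rho>" "\<rho> * card U \<le> card {y\<in>U. \<forall>i\<in>J. y i = x i}"
  shows "\<bar>h x\<bar> \<le> sqrt (ip U h h / (\<rho> * card U))"
proof (rule real_le_rsqrt)
  have pos: "0 < \<rho> * card U" using \<rho> card_pos by simp
  have "(h x)\<^sup>2 * (\<rho> * card U) \<le> (h x)\<^sup>2 * card {y\<in>U. \<forall>i\<in>J. y i = x i}"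
    using \<rho> by (intro mult_left_mono) auto
  also have "\<dots> = (\<Sum>y | y \<in> U \<and> (\<forall>i\<in>J. y i = x i). h y * h y)"
  proof -
    have "h y = h x" if "y \<in> U" "\<forall>i\<in>J. y i = x i" for y
      using junta_eq[OF J(2,1) that(1) x] that(2) by blast
    then show ?thesis by (simp add: power2_eq_square)
  qed
  also have "\<dots> \<le> ip U h h" unfolding ip_def using fin by (intro sum_mono2) auto
  finally show "\<bar>h x\<bar>\<^sup>2 \<le> ip U h h / (\<rho> * card U)" using pos by (simp add: pos_le_divide_eq)
qed

text \<open>The image \<open>v\<close> of \<open>h\<close> is itself a \<open>J\<close>-junta and
  can be used as the second test function. Both supremum norms are converted into quadratic norms;
  that of \<open>v\<close> appears on both sides and cancels.\<close>

lemma low_degree_difference: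
  fixes \<rho> l :: real
  assumes o: "orbit n m U" and o': "orbit n m' U'"
    and equiv: "\<And>\<pi> x y. \<pi> permutes {1..n} \<Longrightarrow> x \<in> U \<Longrightarrow> y \<in> U' \<Longrightarrow> D (x \<circ> \<pi>) (y \<circ> \<pi>) = D x y"
    and J: "J \<subseteq> {1..n}" "junta n U J h"
    and \<rho>: "0 < \<rho>" "\<And>x. x \<in> U \<Longrightarrow> \<rho> * card U \<le> card {y\<in>U. \<forall>i\<in>J. y i = x i}"
      "\<And>x. x \<in> U' \<Longrightarrow> \<rho> * card U' \<le> card {y\<in>U'. \<forall>i\<in>J. y i = x i}"
    and close: "\<And>h g H G. junta n U J h \<Longrightarrow> junta n U' J g \<Longrightarrow> (\<And>x. x \<in> U \<Longrightarrow> \<bar>h x\<bar> \<le> H) \<Longrightarrow>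
      (\<And>x. x \<in> U' \<Longrightarrow> \<bar>g x\<bar> \<le> G) \<Longrightarrow> \<bar>expec U U' D (\<lambda>x y. h x * g y)\<bar> \<le> l * H * G"
    and l: "0 \<le> l"
  shows "real (card U) * real (card U') * ip U' (adj U D h) (adj U D h) \<le> (l / \<rho>)\<^sup>2 * ip U h h"
proof -
  interpret U: orbit n m U by fact
  interpret U': orbit n m' U' by fact
  define v where "v = adj U D h"
  have v: "junta n U' J v"
    unfolding v_def adj_eq_app using equiv by (intro junta_app[OF o _ J(2)])
  define H where "H = sqrt (ip U h h / (\<rho> * card U))"
  define V where "V = sqrt (ip U' v v / (\<rho> * card U'))"
  have "ip U' v v = expec U U' D (\<lambda>x y. h x * v y)"
    unfolding v_def ip_adj by (simp add: expec_def mult_ac)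
  also have "\<dots> \<le> l * H * V"
    using close[OF J(2) v, of H V] U.junta_sup_le[OF J _ \<rho>(1,2)] U'.junta_sup_le[OF J(1) v _ \<rho>(1,3)]
    by (force simp: H_def V_def)
  finally have "(ip U' v v)\<^sup>2 \<le> (l * H * V)\<^sup>2" using ip_nonneg[of U' v] by (intro power_mono) auto
  also have "\<dots> = l\<^sup>2 * (ip U h h / (\<rho> * card U)) * (ip U' v v / (\<rho> * card U'))"
    using \<rho>(1) ip_nonneg[of U h] ip_nonneg[of U' v] by (simp add: H_def V_def power_mult_distrib)
  finally have sq: "ip U' v v * ip U' v v \<le> (l\<^sup>2 * (ip U h h / (\<rho> * card U)) / (\<rho> * card U')) * ip U' v v"
    by (simp add: power2_eq_square)
  have k: "0 \<le> l\<^sup>2 * (ip U h h / (\<rho> * card U)) / (\<rho> * card U')" using \<rho>(1) ip_nonneg[of U h] by simp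
  have "x \<le> k" if "x * x \<le> k * x" "0 \<le> k" "0 \<le> x" for x k :: real
    using that by (cases "x = 0") (auto simp: mult_le_cancel_right)
  from this[OF sq k ip_nonneg] have "ip U' v v \<le> l\<^sup>2 * (ip U h h / (\<rho> * card U)) / (\<rho> * card U')" .
  then show ?thesis
    using \<rho>(1) U.card_pos U'.card_pos unfolding v_def[symmetric] by (simp add: field_simps power2_eq_square)
qed

lemma abs_le_of_square_le: "x\<^sup>2 \<le> y\<^sup>2 \<Longrightarrow> 0 \<le> y \<Longrightarrow> \<bar>x\<bar> \<le> (y::real)"
  using abs_le_square_iff[of x y] by simp

text \<open>The threshold \<open>d\<close> is delivered before \<rho> and \<open>l\<close> are
  fixed, since the class masses, and with them the accuracy demanded in low degree, depend on it.
  From \<open>d\<close> on the two laws are each small; below \<open>d\<close> only their difference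
  is.\<close>

lemma two_law_comparison:
  fixes \<alpha>\<^sub>1 \<kappa> \<epsilon> :: real and m m' P :: nat
  assumes a: "0 < \<alpha>\<^sub>1" "\<alpha>\<^sub>1 \<le> 1" "0 < \<kappa>" "\<kappa> \<le> 1" "0 < \<epsilon>"
  obtains d \<tau>\<^sub>0 where "0 < \<tau>\<^sub>0" and "\<And>n U U' p p' q E \<tau> c0 l \<rho> e f g.
    orbit n m U \<Longrightarrow> orbit n m' U' \<Longrightarrow> sym_law n U U' p \<Longrightarrow> sym_law n U U' p' \<Longrightarrow>
    near_product n U U' p \<tau> q \<Longrightarrow> near_product n U U' p' \<tau> q \<Longrightarrow> 0 \<le> \<tau> \<Longrightarrow> \<tau> \<le> \<tau>\<^sub>0 \<Longrightarrow>
    (\<And>c b i. (c, b) \<in> E \<Longrightarrow> i \<in> {1..n} \<Longrightarrow> \<alpha>\<^sub>1 \<le> expec U U' p (\<lambda>x y. of_bool (x i = c \<and> y i = b))) \<Longrightarrow>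
    (\<And>c b i. (c, b) \<in> E \<Longrightarrow> i \<in> {1..n} \<Longrightarrow> \<alpha>\<^sub>1 \<le> expec U U' p' (\<lambda>x y. of_bool (x i = c \<and> y i = b))) \<Longrightarrow>
    (\<And>c. c \<in> {1..m} \<Longrightarrow> (c0, c) \<in> (E O E\<inverse>) ^^ (2 ^ P)) \<Longrightarrow>
    (\<And>x. x \<in> U \<Longrightarrow> \<kappa> * real n \<le> card {i\<in>{1..n}. x i = c0}) \<Longrightarrow>
    real e \<le> (1 - \<kappa>) * n \<Longrightarrow>
    (\<And>x. x \<in> U \<Longrightarrow> \<exists>J\<subseteq>{1..n}. card J \<le> e \<and> (\<forall>y\<in>U. (\<forall>i\<in>J. y i = x i) \<longrightarrow> y = x)) \<Longrightarrow>
    0 < \<rho> \<Longrightarrow> 0 \<le> l \<Longrightarrow> l \<le> \<epsilon> * \<rho> \<Longrightarrow>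
    (\<And>J x. J \<subseteq> {1..n} \<Longrightarrow> card J < d \<Longrightarrow> x \<in> U \<Longrightarrow> \<rho> * card U \<le> card {y\<in>U. \<forall>i\<in>J. y i = x i}) \<Longrightarrow>
    (\<And>J x. J \<subseteq> {1..n} \<Longrightarrow> card J < d \<Longrightarrow> x \<in> U' \<Longrightarrow> \<rho> * card U' \<le> card {y\<in>U'. \<forall>i\<in>J. y i = x i}) \<Longrightarrow>
    (\<And>J h g H G. J \<subseteq> {1..n} \<Longrightarrow> card J < d \<Longrightarrow> junta n U J h \<Longrightarrow> junta n U' J g \<Longrightarrow>
      (\<And>x. x \<in> U \<Longrightarrow> \<bar>h x\<bar> \<le> H) \<Longrightarrow> (\<And>x. x \<in> U' \<Longrightarrow> \<bar>g x\<bar> \<le> G) \<Longrightarrow>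
      \<bar>expec U U' p (\<lambda>x y. h x * g y) - expec U U' p' (\<lambda>x y. h x * g y)\<bar> \<le> l * H * G) \<Longrightarrow>
    \<bar>expec U U' p (\<lambda>x y. f x * g y) - expec U U' p' (\<lambda>x y. f x * g y)\<bar>
      \<le> \<epsilon> * sqrt (ip U f f / card U) * sqrt (ip U' g g / card U')"
proof -
  \<comment> \<open>The square of a difference is at most twice the sum of the squares, so two
    contractions by \<delta> give the factor \<open>4 * \<delta>\<close>.\<close>
  define \<delta> where "\<delta> = \<epsilon>\<^sup>2 / 4"
  have \<delta>: "0 < \<delta>" using a by (simp add: \<delta>_def)
  obtain d \<tau>\<^sub>0 where d: "1 \<le> d" "0 < \<tau>\<^sub>0" and contr: "\<forall>n U U' p q E \<tau> c0 J h.
    orbit n m U \<longrightarrow> orbit n m' U' \<longrightarrow> sym_law n U U' p \<longrightarrow> near_product n U U' p \<tau> q \<longrightarrow> 0 \<le> \<tau> \<longrightarrow> \<tau> \<le> \<tau>\<^sub>0 \<longrightarrow>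
    (\<forall>(c, b)\<in>E. \<forall>i\<in>{1..n}. \<alpha>\<^sub>1 \<le> expec U U' p (\<lambda>x y. of_bool (x i = c \<and> y i = b))) \<longrightarrow>
    (\<forall>c\<in>{1..m}. (c0, c) \<in> (E O E\<inverse>) ^^ (2 ^ P)) \<longrightarrow>
    (\<forall>x\<in>U. \<kappa> * n \<le> card {i\<in>{1..n}. x i = c0}) \<longrightarrow>
    J \<subseteq> {1..n} \<longrightarrow> d \<le> card J \<longrightarrow> card J \<le> (1 - \<kappa>) * n \<longrightarrow> junta n U J h \<longrightarrow> pure n U (card J) h \<longrightarrow>
    real (card U) * real (card U') * ip U' (adj U p h) (adj U p h) \<le> \<delta> * ip U h h"
    using high_degree_law_contraction[OF a(1-4) \<delta>, of m m' P] by (elim exE conjE) (rule that)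
  show thesis
  proof (rule that[OF d(2), of d])
    fix n U U' p p' q E \<tau> c0 l \<rho> e f g
    assume o: "orbit n m U" and o': "orbit n m' U'" and p: "sym_law n U U' p" and p': "sym_law n U U' p'"
      and np: "near_product n U U' p \<tau> q" and np': "near_product n U U' p' \<tau> q" and \<tau>: "0 \<le> \<tau>" "\<tau> \<le> \<tau>\<^sub>0"
      and E: "\<And>c b i. (c, b) \<in> E \<Longrightarrow> i \<in> {1..n} \<Longrightarrow> \<alpha>\<^sub>1 \<le> expec U U' p (\<lambda>x y. of_bool (x i = c \<and> y i = b))"
      and E': "\<And>c b i. (c, b) \<in> E \<Longrightarrow> i \<in> {1..n} \<Longrightarrow> \<alpha>\<^sub>1 \<le> expec U U' p' (\<lambda>x y. of_bool (x i = c \<and> y i = b))"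
      and con: "\<And>c. c \<in> {1..m} \<Longrightarrow> (c0, c) \<in> (E O E\<inverse>) ^^ (2 ^ P)"
      and cnt: "\<And>x. x \<in> U \<Longrightarrow> \<kappa> * real n \<le> card {i\<in>{1..n}. x i = c0}"
      and e: "real e \<le> (1 - \<kappa>) * n"
        "\<And>x. x \<in> U \<Longrightarrow> \<exists>J\<subseteq>{1..n}. card J \<le> e \<and> (\<forall>y\<in>U. (\<forall>i\<in>J. y i = x i) \<longrightarrow> y = x)"
      and \<rho>: "0 < \<rho>" and l: "0 \<le> l" "l \<le> \<epsilon> * \<rho>"
      and mU: "\<And>J x. J \<subseteq> {1..n} \<Longrightarrow> card J < d \<Longrightarrow> x \<in> U \<Longrightarrow> \<rho> * card U \<le> card {y\<in>U. \<forall>i\<in>J. y i = x i}"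
      and mU': "\<And>J x. J \<subseteq> {1..n} \<Longrightarrow> card J < d \<Longrightarrow> x \<in> U' \<Longrightarrow> \<rho> * card U' \<le> card {y\<in>U'. \<forall>i\<in>J. y i = x i}"
      and close: "\<And>J h g H G. J \<subseteq> {1..n} \<Longrightarrow> card J < d \<Longrightarrow> junta n U J h \<Longrightarrow> junta n U' J g \<Longrightarrow>
      (\<And>x. x \<in> U \<Longrightarrow> \<bar>h x\<bar> \<le> H) \<Longrightarrow> (\<And>x. x \<in> U' \<Longrightarrow> \<bar>g x\<bar> \<le> G) \<Longrightarrow>
      \<bar>expec U U' p (\<lambda>x y. h x * g y) - expec U U' p' (\<lambda>x y. h x * g y)\<bar> \<le> l * H * G"
    interpret U: orbit n m U by fact
    interpret U': orbit n m' U' by fact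
    define D where "D x y = p x y - p' x y" for x y
    have equiv: "D (x \<circ> \<pi>) (y \<circ> \<pi>) = D x y" if "\<pi> permutes {1..n}" "x \<in> U" "y \<in> U'" for \<pi> x y
      using p p' that unfolding D_def sym_law_def by simp
    have expD: "expec U U' D F = expec U U' p F - expec U U' p' F" for F
      unfolding expec_def D_def by (simp add: left_diff_distrib sum_subtractf)
    let ?N = "real (card U) * real (card U')"
    have N: "?N > 0" using U.card_pos U'.card_pos by simp
    have pure: "ip U' (adj U D h) (adj U D h) \<le> (\<epsilon>\<^sup>2 / ?N) * ip U h h"
      if J: "J \<subseteq> {1..n}" "card J \<le> e" and h: "junta n U J h" "pure n U (card J) h" for J h
    proof -
      have "?N * ip U' (adj U D h) (adj U D h) \<le> \<epsilon>\<^sup>2 * ip U h h"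
      proof (cases "d \<le> card J")
        case True
        have Je: "card J \<le> (1 - \<kappa>) * n" using J(2) e(1) by linarith
        have 1: "?N * ip U' (adj U p h) (adj U p h) \<le> \<delta> * ip U h h"
          by (rule contr[rule_format, of n U U' p \<tau> q E c0 J h])
            (use o o' p np \<tau> E con cnt J(1) True Je h in auto)
        have 2: "?N * ip U' (adj U p' h) (adj U p' h) \<le> \<delta> * ip U h h"
          by (rule contr[rule_format, of n U U' p' \<tau> q E c0 J h])
            (use o o' p' np' \<tau> E' con cnt J(1) True Je h in auto)
        have "adj U D h = (\<lambda>y. adj U p h y + - 1 * adj U p' h y)"
          by (simp add: fun_eq_iff adj_def D_def left_diff_distrib sum_subtractf)
        then have "ip U' (adj U D h) (adj U D h) \<le> 2 * ip U' (adj U p h) (adj U p h) +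
            2 * ip U' (\<lambda>y. - 1 * adj U p' h y) (\<lambda>y. - 1 * adj U p' h y)"
          by (simp only: ip_self_add_le)
        also have "ip U' (\<lambda>y. - 1 * adj U p' h y) (\<lambda>y. - 1 * adj U p' h y) = ip U' (adj U p' h) (adj U p' h)"
          unfolding ip_scale_self by simp
        finally have "?N * ip U' (adj U D h) (adj U D h) \<le> ?N * (2 * ip U' (adj U p h) (adj U p h) +
            2 * ip U' (adj U p' h) (adj U p' h))" using N by (intro mult_left_mono) auto
        also have "\<dots> \<le> 4 * (\<delta> * ip U h h)" using 1 2 by (simp add: algebra_simps)
        finally show ?thesis by (simp add: \<delta>_def)
      next
        case False
        then have Jd: "card J < d" by simp
        have "?N * ip U' (adj U D h) (adj U D h) \<le> (l / \<rho>)\<^sup>2 * ip U h h"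
        proof (rule low_degree_difference[OF o o' _ J(1) h(1) \<rho>])
          fix h g H G assume "junta n U J h" "junta n U' J g" "\<And>x. x \<in> U \<Longrightarrow> \<bar>h x\<bar> \<le> H" "\<And>x. x \<in> U' \<Longrightarrow> \<bar>g x\<bar> \<le> G"
          then show "\<bar>expec U U' D (\<lambda>x y. h x * g y)\<bar> \<le> l * H * G" unfolding expD by (rule close[OF J(1) Jd])
        qed (fact equiv mU[OF J(1) Jd] mU'[OF J(1) Jd] l(1))+
        also have "\<dots> \<le> \<epsilon>\<^sup>2 * ip U h h"
          using l \<rho> by (intro mult_right_mono power_mono ip_nonneg) (auto simp: pos_divide_le_eq)
        finally show ?thesis .
      qed
      then show ?thesis using N by (simp add: pos_le_divide_eq mult.commute)
    qed
    have "ip U' (adj U D f) (adj U D f) \<le> (\<epsilon>\<^sup>2 / ?N) * ip U f f"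
    proof (rule U.equivariant_form_bound_from_pure_juntas[OF o'])
      show "0 < \<epsilon>\<^sup>2 / ?N" using a(5) N by simp
    qed (fact equiv pure e(2))+
    then have "ip U' (adj U D f) (adj U D f) * ip U' g g \<le> (\<epsilon>\<^sup>2 / ?N) * ip U f f * ip U' g g"
      by (intro mult_right_mono ip_nonneg)
    then have "(ip U' (adj U D f) g)\<^sup>2 \<le> (\<epsilon>\<^sup>2 / ?N) * ip U f f * ip U' g g"
      using ip_Cauchy_Schwarz[of U' "adj U D f" g] by linarith
    also have "\<dots> = (\<epsilon> * sqrt (ip U f f / card U) * sqrt (ip U' g g / card U'))\<^sup>2"
      using ip_nonneg[of U f] ip_nonneg[of U' g] by (simp add: power_mult_distrib)
    finally have "\<bar>ip U' (adj U D f) g\<bar> \<le> \<epsilon> * sqrt (ip U f f / card U) * sqrt (ip U' g g / card U')"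
      using a(5) ip_nonneg[of U f] ip_nonneg[of U' g] by (intro abs_le_of_square_le) auto
    moreover have "ip U' (adj U D f) g = expec U U' D (\<lambda>x y. f x * g y)"
      unfolding ip_adj expec_def by (simp add: mult_ac)
    ultimately show "\<bar>expec U U' p (\<lambda>x y. f x * g y) - expec U U' p' (\<lambda>x y. f x * g y)\<bar>
      \<le> \<epsilon> * sqrt (ip U f f / card U) * sqrt (ip U' g g / card U')" by (simp add: expD)
  qed
qed

section \<open>Couplings with product measures\<close>

lemma card_fibre_permute:
  assumes "\<pi> permutes {1..n}"
  shows "card {i\<in>{1..n}. (x \<circ> \<pi>) i = c} = card {i\<in>{1..n}. x i = c}"
  using card_letter_pair_permute[OF assms, of x c x c] by simp

lemma finite_multislice: "finite (multislice n m k)"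
  unfolding multislice_def by (rule finite_subset[of _ "{1..n} \<rightarrow>\<^sub>E {1..m}"]) (auto intro: finite_PiE)

text \<open>Two vectors with equal letter counts that agree on \<open>J\<close> have equal letter
  counts off \<open>J\<close>, so a permutation of the complement of \<open>J\<close> relates them;
  outside \<open>{1..n}\<close> both are \<open>undefined\<close>.\<close>

lemma orbit_multislice:
  assumes "multislice n m k \<noteq> {}"
  shows "orbit n m (multislice n m k)"
proof
  show "finite (multislice n m k)" by (rule finite_multislice)
  show "multislice n m k \<noteq> {}" by fact
  fix x assume x: "x \<in> multislice n m k"
  then have xE: "x \<in> {1..n} \<rightarrow>\<^sub>E {1..m}" and xc: "\<And>c. c \<in> {1..m} \<Longrightarrow> card {i\<in>{1..n}. x i = c} = k c"
    unfolding multislice_def by blast+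
  show "x i \<in> {1..m}" if "i \<in> {1..n}" for i using xE that by blast
  show "x \<circ> \<pi> \<in> multislice n m k" if \<pi>: "\<pi> permutes {1..n}" for \<pi>
  proof -
    have "x \<circ> \<pi> \<in> {1..n} \<rightarrow>\<^sub>E {1..m}"
    proof (rule PiE_I)
      fix i assume "i \<in> {1..n}"
      then have "\<pi> i \<in> {1..n}" using permutes_in_image[OF \<pi>] by simp
      then show "(x \<circ> \<pi>) i \<in> {1..m}" using PiE_mem[OF xE, of "\<pi> i"] by simp
    next
      fix i assume i: "i \<notin> {1..n}"
      then show "(x \<circ> \<pi>) i = undefined" using PiE_arb[OF xE i] permutes_not_in[OF \<pi> i] by simp
    qed
    then show ?thesis unfolding multislice_def using xc card_fibre_permute[OF \<pi>, of x] by simp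
  qed
  fix y J assume y: "y \<in> multislice n m k" and J: "J \<subseteq> {1..n}" and eq: "\<forall>i\<in>J. x i = y i"
  from y have yE: "y \<in> {1..n} \<rightarrow>\<^sub>E {1..m}" and yc: "\<And>c. c \<in> {1..m} \<Longrightarrow> card {i\<in>{1..n}. y i = c} = k c"
    unfolding multislice_def by blast+
  have "card {i\<in>{1..n} - J. y i = c} = card {i\<in>{1..n} - J. x i = c}" for c
  proof -
    have dif: "card {i\<in>{1..n} - J. z i = c} = card {i\<in>{1..n}. z i = c} - card {i\<in>J. z i = c}" for z :: "nat \<Rightarrow> nat"
    proof -
      have "{i\<in>{1..n} - J. z i = c} = {i\<in>{1..n}. z i = c} - {i\<in>J. z i = c}" by auto
      moreover have "finite {i\<in>J. z i = c}" using finite_subset[OF J] by simp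
      ultimately show ?thesis using J by (subst \<open>_ = _\<close>, subst card_Diff_subset) auto
    qed
    have "{i\<in>J. y i = c} = {i\<in>J. x i = c}" using eq by auto
    moreover have "card {i\<in>{1..n}. y i = c} = card {i\<in>{1..n}. x i = c}"
    proof (cases "c \<in> {1..m}")
      case True then show ?thesis using xc yc by simp
    next
      case False
      then have "{i\<in>{1..n}. y i = c} = {}" "{i\<in>{1..n}. x i = c} = {}" using PiE_mem[OF xE] PiE_mem[OF yE] by blast+
      then show ?thesis by (simp only:)
    qed
    ultimately show ?thesis unfolding dif by (simp only:)
  qed
  from ex_permutes_of_card_fibres_eq[OF _ this] obtain \<pi>
    where \<pi>: "\<pi> permutes {1..n} - J" "\<forall>i\<in>{1..n} - J. y i = x (\<pi> i)" by blast
  have "y i = x (\<pi> i)" for i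
  proof (cases "i \<in> {1..n} - J")
    case True then show ?thesis using \<pi>(2) by blast
  next
    case False
    then have "\<pi> i = i" using permutes_not_in[OF \<pi>(1)] by blast
    moreover have "y i = x i"
      using False eq PiE_arb[OF xE, of i] PiE_arb[OF yE, of i] by (cases "i \<in> J") auto
    ultimately show ?thesis by simp
  qed
  then have "y = x \<circ> \<pi>" by auto
  then show "\<exists>\<pi>. \<pi> permutes {1..n} - J \<and> y = x \<circ> \<pi>" using \<pi>(1) by blast
qed

lemma expec_pmf:
  assumes "finite A" "finite B" "set_pmf \<mu> \<subseteq> A \<times> B"
  shows "expec A B (\<lambda>x y. pmf \<mu> (x, y)) F = measure_pmf.expectation \<mu> (\<lambda>(x, y). F x y)"
proof -
  have "measure_pmf.expectation \<mu> (\<lambda>(x, y). F x y) = (\<Sum>a\<in>A \<times> B. (\<lambda>(x, y). F x y) a * pmf \<mu> a)"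
    using assms by (intro integral_measure_pmf_real) auto
  then show ?thesis by (simp add: expec_def sum.cartesian_product split_def mult.commute)
qed

text \<open>The marginals of a symmetric law are invariant functions on transitive sets, hence
  constant; uniformity is a consequence of symmetry.\<close>

lemma sym_law_of_pmf:
  assumes "orbit n mA A" "orbit n mB B" and supp: "set_pmf \<mu> \<subseteq> A \<times> B" and sym: "symmetric n \<mu>"
  shows "sym_law n A B (\<lambda>x y. pmf \<mu> (x, y))"
proof -
  interpret A: orbit n mA A by fact
  interpret B: orbit n mB B by fact
  have equiv: "pmf \<mu> (x \<circ> \<pi>, y \<circ> \<pi>) = pmf \<mu> (x, y)" if \<pi>: "\<pi> permutes {1..n}" for \<pi> x y
  proof -
    have "inj (\<lambda>(x::nat\<Rightarrow>nat, y::nat\<Rightarrow>nat). (x \<circ> \<pi>, y \<circ> \<pi>))"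
    proof (rule injI, clarsimp)
      fix x y x' y' :: "nat \<Rightarrow> nat" assume "x \<circ> \<pi> = x' \<circ> \<pi>" "y \<circ> \<pi> = y' \<circ> \<pi>"
      then have "x \<circ> \<pi> \<circ> inv \<pi> = x' \<circ> \<pi> \<circ> inv \<pi>" "y \<circ> \<pi> \<circ> inv \<pi> = y' \<circ> \<pi> \<circ> inv \<pi>" by simp_all
      then show "x = x' \<and> y = y'" using permutes_inv_o(1)[OF \<pi>] by (simp add: comp_assoc)
    qed
    from pmf_map_inj'[OF this, of \<mu> "(x, y)"] show ?thesis using sym \<pi> by (simp add: symmetric_def)
  qed
  have total: "(\<Sum>x\<in>A. \<Sum>y\<in>B. pmf \<mu> (x, y)) = 1"
  proof -
    have "(\<Sum>x\<in>A. \<Sum>y\<in>B. pmf \<mu> (x, y)) = sum (pmf \<mu>) (A \<times> B)" by (simp add: sum.cartesian_product)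
    also have "\<dots> = 1" using A.fin B.fin supp by (intro sum_pmf_eq_1) auto
    finally show ?thesis .
  qed
  have const: "r x * card X = 1"
    if X: "orbit n mX X" and inv: "\<And>\<pi> x. \<pi> permutes {1..n} \<Longrightarrow> x \<in> X \<Longrightarrow> r (x \<circ> \<pi>) = r x"
      and sum: "(\<Sum>x\<in>X. r x) = (1::real)" and x: "x \<in> X" for X mX r x
  proof -
    interpret X: orbit n mX X by fact
    have "r y = r x" if "y \<in> X" for y
      using X.transitive[OF x that, of "{}"] inv x by auto
    then show ?thesis using sum by (simp add: mult.commute)
  qed
  have row: "(\<Sum>y\<in>B. pmf \<mu> (x, y)) * card A = 1" if "x \<in> A" for x
  proof (rule const[OF assms(1) _ total that])
    fix \<pi> x assume \<pi>: "\<pi> permutes {1..n}"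
    show "(\<Sum>y\<in>B. pmf \<mu> (x \<circ> \<pi>, y)) = (\<Sum>y\<in>B. pmf \<mu> (x, y))"
      using B.sum_permute[OF \<pi>, of "\<lambda>y. pmf \<mu> (x \<circ> \<pi>, y)"] equiv[OF \<pi>] by simp
  qed
  have col: "(\<Sum>x\<in>A. pmf \<mu> (x, y)) * card B = 1" if "y \<in> B" for y
  proof (rule const[OF assms(2) _ _ that])
    show "(\<Sum>y\<in>B. \<Sum>x\<in>A. pmf \<mu> (x, y)) = 1" using total by (subst sum.swap)
    fix \<pi> y assume \<pi>: "\<pi> permutes {1..n}"
    show "(\<Sum>x\<in>A. pmf \<mu> (x, y \<circ> \<pi>)) = (\<Sum>x\<in>A. pmf \<mu> (x, y))"
      using A.sum_permute[OF \<pi>, of "\<lambda>x. pmf \<mu> (x, y \<circ> \<pi>)"] equiv[OF \<pi>] by simp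
  qed
  show ?thesis
    unfolding sym_law_def using row col equiv A.card_pos B.card_pos by (simp add: eq_divide_eq)
qed

section \<open>Comparing a coupled law with a product measure on few coordinates\<close>

lemma coupling_expectation_diff_le:
  fixes F :: "'a \<Rightarrow> real" and G :: "'b \<Rightarrow> real"
  assumes fin: "finite (set_pmf R)"
    and le: "\<And>u v. (u, v) \<in> set_pmf R \<Longrightarrow> \<bar>F u - G v\<bar> \<le> c * of_bool (bad (u, v))"
  shows "\<bar>measure_pmf.expectation (map_pmf fst R) F - measure_pmf.expectation (map_pmf snd R) G\<bar>
    \<le> c * measure_pmf.prob R {w. bad w}"
proof -
  note int = integrable_measure_pmf_finite[OF fin]
  have "measure_pmf.expectation (map_pmf fst R) F - measure_pmf.expectation (map_pmf snd R) G =
      measure_pmf.expectation R (\<lambda>w. F (fst w) - G (snd w))"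
    by (simp add: int)
  also have "\<bar>\<dots>\<bar> \<le> measure_pmf.expectation R (\<lambda>w. \<bar>F (fst w) - G (snd w)\<bar>)"
    by (rule integral_abs_bound)
  also have "\<dots> \<le> measure_pmf.expectation R (\<lambda>w. c * indicator {w. bad w} w)"
  proof (intro integral_mono_AE int, unfold AE_measure_pmf_iff, intro ballI)
    fix w assume "w \<in> set_pmf R"
    then show "\<bar>F (fst w) - G (snd w)\<bar> \<le> c * indicator {w. bad w} w"
      using le[of "fst w" "snd w"] by (simp add: indicator_def of_bool_def)
  qed
  also have "\<dots> = c * measure_pmf.prob R {w. bad w}" by simp
  finally show ?thesis .
qed

lemma prob_ex_le:
  fixes t :: real
  assumes "finite J" "\<And>i. i \<in> J \<Longrightarrow> measure_pmf.prob R {w. bad i w} \<le> t"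
  shows "measure_pmf.prob R {w. \<exists>i\<in>J. bad i w} \<le> card J * t"
proof -
  have "{w. \<exists>i\<in>J. bad i w} = (\<Union>i\<in>J. {w. bad i w})" by auto
  then have "measure_pmf.prob R {w. \<exists>i\<in>J. bad i w} \<le> (\<Sum>i\<in>J. measure_pmf.prob R {w. bad i w})"
    using assms(1) by (simp add: measure_pmf.finite_measure_subadditive_finite)
  also have "\<dots> \<le> (\<Sum>i\<in>J. t)" by (rule sum_mono[OF assms(2)])
  finally show ?thesis by simp
qed

lemma Pi_pmf_expectation_component:
  assumes "finite A" "i \<in> A"
  shows "measure_pmf.expectation (Pi_pmf A dflt Q) (\<lambda>z. of_bool (P (z i))) = measure_pmf.prob (Q i) {a. P a}"
proof -
  have "measure_pmf.expectation (Pi_pmf A dflt Q) (\<lambda>z. of_bool (P (z i)) :: real) =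
      measure_pmf.expectation (map_pmf (\<lambda>z. z i) (Pi_pmf A dflt Q)) (\<lambda>a. indicator {a. P a} a)"
    by (simp add: indicator_def of_bool_def)
  then show ?thesis using assms by (simp add: Pi_pmf_component)
qed

lemma Pi_pmf_expectation_two_components:
  assumes "finite A" "i \<in> A" "j \<in> A" "i \<noteq> j"
  shows "measure_pmf.expectation (Pi_pmf A dflt Q) (\<lambda>z. of_bool (P (z i)) * of_bool (P' (z j))) =
    measure_pmf.prob (Q i) {a. P a} * measure_pmf.prob (Q j) {a. P' a}"
proof -
  define B where "B k = (if k = i then {a. P a} else if k = j then {a. P' a} else UNIV)" for k
  have "measure_pmf.expectation (Pi_pmf A dflt Q) (\<lambda>z. of_bool (P (z i)) * of_bool (P' (z j)) :: real) =
      measure_pmf.expectation (Pi_pmf A dflt Q) (\<lambda>z. indicator (Pi A B) z)"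
  proof (intro arg_cong[where f = "measure_pmf.expectation _"] ext)
    fix z
    have "z \<in> Pi A B \<longleftrightarrow> P (z i) \<and> P' (z j)" using assms by (auto simp: B_def Pi_iff)
    then show "(of_bool (P (z i)) * of_bool (P' (z j)) :: real) = indicator (Pi A B) z" by (simp add: indicator_def)
  qed
  also have "\<dots> = (\<Prod>k\<in>A. measure_pmf.prob (Q k) (B k))" using assms by (simp add: measure_Pi_pmf_Pi)
  also have "\<dots> = (\<Prod>k\<in>{i, j}. measure_pmf.prob (Q k) (B k))"
    using assms by (intro prod.mono_neutral_right) (auto simp: B_def)
  also have "\<dots> = measure_pmf.prob (Q i) {a. P a} * measure_pmf.prob (Q j) {a. P' a}"
    using assms by (simp add: B_def)
  finally show ?thesis .
qed

text \<open>Both \<mu> and the law pulled back from its product version will be instances with the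
  same \<open>Q\<close>, which compares each of them with one product measure and thereby with the
  other.\<close>

locale coupled_law =
  fixes n :: nat and A B :: "(nat \<Rightarrow> nat) set" and \<mu> :: "((nat \<Rightarrow> nat) \<times> (nat \<Rightarrow> nat)) pmf"
    and R :: "(((nat \<Rightarrow> nat) \<times> (nat \<Rightarrow> nat)) \<times> (nat \<Rightarrow> nat \<times> nat)) pmf"
    and Q :: "nat \<Rightarrow> (nat \<times> nat) pmf" and dflt :: "nat \<times> nat" and t :: real
  assumes finA: "finite A" and finB: "finite B" and finR: "finite (set_pmf R)" and supp: "set_pmf \<mu> \<subseteq> A \<times> B"
    and fstR: "map_pmf fst R = \<mu>" and sndR: "map_pmf snd R = Pi_pmf {1..n} dflt Q"
    and dev: "\<And>i. i \<in> {1..n} \<Longrightarrow> measure_pmf.prob R {w. (fst (fst w) i, snd (fst w) i) \<noteq> snd w i} \<le> t"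
begin

lemma dev_J:
  assumes "J \<subseteq> {1..n}"
  shows "measure_pmf.prob R {w. \<exists>i\<in>J. (fst (fst w) i, snd (fst w) i) \<noteq> snd w i} \<le> card J * t"
proof (rule prob_ex_le)
  show "finite J" using assms finite_subset by blast
  show "measure_pmf.prob R {w. (fst (fst w) i, snd (fst w) i) \<noteq> snd w i} \<le> t" if "i \<in> J" for i
    using that assms by (intro dev) auto
qed

lemma expec_diff_le:
  assumes J: "J \<subseteq> {1..n}" and c: "0 \<le> c"
    and le: "\<And>x y z. x \<in> A \<Longrightarrow> y \<in> B \<Longrightarrow> \<bar>F x y - G z\<bar> \<le> c"
    and eq: "\<And>x y z. x \<in> A \<Longrightarrow> y \<in> B \<Longrightarrow> (\<And>i. i \<in> J \<Longrightarrow> z i = (x i, y i)) \<Longrightarrow> F x y = G z"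
  shows "\<bar>expec A B (\<lambda>x y. pmf \<mu> (x, y)) F - measure_pmf.expectation (Pi_pmf {1..n} dflt Q) G\<bar> \<le> c * (card J * t)"
proof -
  have "\<bar>measure_pmf.expectation (map_pmf fst R) (\<lambda>(x, y). F x y) - measure_pmf.expectation (map_pmf snd R) G\<bar> \<le>
      c * measure_pmf.prob R {w. \<exists>i\<in>J. (fst (fst w) i, snd (fst w) i) \<noteq> snd w i}"
  proof (rule coupling_expectation_diff_le[OF finR])
    fix u v assume uv: "(u, v) \<in> set_pmf R"
    obtain x y where u: "u = (x, y)" by (cases u)
    have "u \<in> set_pmf \<mu>" using uv unfolding fstR[symmetric] by force
    then have xy: "x \<in> A" "y \<in> B" using supp u by auto
    show "\<bar>(\<lambda>(x, y). F x y) u - G v\<bar> \<le>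
        c * of_bool (\<exists>i\<in>J. (fst (fst (u, v)) i, snd (fst (u, v)) i) \<noteq> snd (u, v) i)"
    proof (cases "\<exists>i\<in>J. (x i, y i) \<noteq> v i")
      case True then show ?thesis using le[OF xy, of v] by (simp add: u)
    next
      case False
      then have "F x y = G v" by (intro eq[OF xy]) auto
      then show ?thesis using c by (simp add: u)
    qed
  qed
  also have "\<dots> \<le> c * (card J * t)" using dev_J[OF J] c by (intro mult_left_mono)
  finally show ?thesis unfolding fstR sndR by (simp add: expec_pmf[OF finA finB supp])
qed

lemma near_product: "near_product n A B (\<lambda>x y. pmf \<mu> (x, y)) (2 * t) (\<lambda>i P. measure_pmf.prob (Q i) {(a, b). P a b})"
  unfolding near_product_def
proof (intro conjI allI ballI impI)
  fix i P assume i: "i \<in> {1..n}"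
  have "\<bar>expec A B (\<lambda>x y. pmf \<mu> (x, y)) (\<lambda>x y. of_bool (P (x i) (y i))) -
      measure_pmf.expectation (Pi_pmf {1..n} dflt Q) (\<lambda>z. of_bool (case z i of (a, b) \<Rightarrow> P a b))\<bar> \<le> 1 * (card {i} * t)"
    using i by (intro expec_diff_le) (auto simp: of_bool_def)
  moreover have "0 \<le> t" using dev[OF i] measure_nonneg order_trans by blast
  ultimately show "\<bar>expec A B (\<lambda>x y. pmf \<mu> (x, y)) (\<lambda>x y. of_bool (P (x i) (y i))) -
      measure_pmf.prob (Q i) {(a, b). P a b}\<bar> \<le> 2 * t"
    using Pi_pmf_expectation_component[of "{1..n}" i dflt Q "\<lambda>(a, b). P a b"] i by simp
next
  fix i j P P' assume i: "i \<in> {1..n}" and j: "j \<in> {1..n}" and ij: "i \<noteq> j"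
  have "\<bar>expec A B (\<lambda>x y. pmf \<mu> (x, y)) (\<lambda>x y. of_bool (P (x i) (y i)) * of_bool (P' (x j) (y j))) -
      measure_pmf.expectation (Pi_pmf {1..n} dflt Q)
        (\<lambda>z. of_bool (case z i of (a, b) \<Rightarrow> P a b) * of_bool (case z j of (a, b) \<Rightarrow> P' a b))\<bar> \<le> 1 * (card {i, j} * t)"
    using i j by (intro expec_diff_le) (auto simp: of_bool_def)
  then show "\<bar>expec A B (\<lambda>x y. pmf \<mu> (x, y)) (\<lambda>x y. of_bool (P (x i) (y i)) * of_bool (P' (x j) (y j))) -
      measure_pmf.prob (Q i) {(a, b). P a b} * measure_pmf.prob (Q j) {(a, b). P' a b}\<bar> \<le> 2 * t"
    using Pi_pmf_expectation_two_components[of "{1..n}" i j dflt Q "\<lambda>(a, b). P a b" "\<lambda>(a, b). P' a b"] i j ij by simp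
qed (simp_all add: measure_nonneg)

end

text \<open>The product measure also charges vectors outside \<open>U\<close>, so a junta must be
  extended to them: by its value on any vector of \<open>U\<close> with the same letters on
  \<open>J\<close>, and by 0 if there is none.\<close>

definition junta_ext :: "(nat \<Rightarrow> nat) set \<Rightarrow> nat set \<Rightarrow> ((nat \<Rightarrow> nat) \<Rightarrow> real) \<Rightarrow> (nat \<Rightarrow> nat) \<Rightarrow> real" where
  "junta_ext U J h v = (if \<exists>x\<in>U. \<forall>i\<in>J. x i = v i then h (SOME x. x \<in> U \<and> (\<forall>i\<in>J. x i = v i)) else 0)"

lemma (in orbit) junta_ext_eq:
  assumes "junta n U J h" "J \<subseteq> {1..n}" "x \<in> U" "\<And>i. i \<in> J \<Longrightarrow> v i = x i"
  shows "junta_ext U J h v = h x"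
proof -
  have ex: "\<exists>x. x \<in> U \<and> (\<forall>i\<in>J. x i = v i)" using assms by auto
  have "h (SOME x. x \<in> U \<and> (\<forall>i\<in>J. x i = v i)) = h x"
    using someI_ex[OF ex] assms by (intro junta_eq[OF assms(1,2)]) auto
  then show ?thesis using ex by (auto simp: junta_ext_def)
qed

lemma (in orbit) junta_ext_le:
  assumes "\<And>x. x \<in> U \<Longrightarrow> \<bar>h x\<bar> \<le> H"
  shows "\<bar>junta_ext U J h v\<bar> \<le> H"
proof (cases "\<exists>x\<in>U. \<forall>i\<in>J. x i = v i")
  case True
  then have "\<exists>x. x \<in> U \<and> (\<forall>i\<in>J. x i = v i)" by blast
  from someI_ex[OF this] show ?thesis using True assms by (simp add: junta_ext_def)
next
  case False
  have "0 \<le> H" using ne assms abs_ge_zero order_trans by blast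
  then show ?thesis unfolding junta_ext_def if_not_P[OF False] by simp
qed

text \<open>The two integrands agree unless the coupling fails somewhere on \<open>J\<close>, and in
  that case they differ by at most \<open>2 * H * G\<close>.\<close>

lemma (in coupled_law) junta_form_diff_le:
  assumes "orbit n mA A" "orbit n mB B" and J: "J \<subseteq> {1..n}" and h: "junta n A J h" "junta n B J g"
    and H: "\<And>x. x \<in> A \<Longrightarrow> \<bar>h x\<bar> \<le> H" and G: "\<And>x. x \<in> B \<Longrightarrow> \<bar>g x\<bar> \<le> G"
  shows "\<bar>expec A B (\<lambda>x y. pmf \<mu> (x, y)) (\<lambda>x y. h x * g y) - measure_pmf.expectation (Pi_pmf {1..n} dflt Q)
      (\<lambda>z. junta_ext A J h (fst \<circ> z) * junta_ext B J g (snd \<circ> z))\<bar> \<le> 2 * H * G * (card J * t)"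
proof (rule expec_diff_le[OF J])
  interpret A: orbit n mA A by fact
  interpret B: orbit n mB B by fact
  have H0: "0 \<le> H" "0 \<le> G" using A.ne B.ne H G abs_ge_zero order_trans by blast+
  then show "0 \<le> 2 * H * G" by simp
  fix x y z assume x: "x \<in> A" and y: "y \<in> B"
  have "\<bar>h x * g y\<bar> \<le> H * G" unfolding abs_mult using H[OF x] G[OF y] H0 by (intro mult_mono) auto
  moreover have "\<bar>junta_ext A J h (fst \<circ> z) * junta_ext B J g (snd \<circ> z)\<bar> \<le> H * G"
    unfolding abs_mult using A.junta_ext_le[OF H] B.junta_ext_le[OF G] H0 by (intro mult_mono) auto
  ultimately show "\<bar>h x * g y - junta_ext A J h (fst \<circ> z) * junta_ext B J g (snd \<circ> z)\<bar> \<le> 2 * H * G"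
    by linarith
  assume "\<And>i. i \<in> J \<Longrightarrow> z i = (x i, y i)"
  then show "h x * g y = junta_ext A J h (fst \<circ> z) * junta_ext B J g (snd \<circ> z)"
    using A.junta_ext_eq[OF h(1) J x, of "fst \<circ> z"] B.junta_ext_eq[OF h(2) J y, of "snd \<circ> z"] by simp
qed

section \<open>The law of the pair of letters at one coordinate\<close>

definition letter_pair_pmf :: "((nat \<Rightarrow> nat) \<times> (nat \<Rightarrow> nat)) pmf \<Rightarrow> nat \<Rightarrow> (nat \<times> nat) pmf" where
  "letter_pair_pmf \<mu> i = map_pmf (\<lambda>(x, y). (x i, y i)) \<mu>"

lemma letter_pair_pmf_eq:
  assumes "symmetric n \<mu>" "i \<in> {1..n}" "j \<in> {1..n}"
  shows "letter_pair_pmf \<mu> i = letter_pair_pmf \<mu> j"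
proof -
  let ?t = "Transposition.transpose i j"
  have "?t permutes {1..n}" using assms by (intro permutes_swap_id)
  then have "map_pmf (\<lambda>(x, x'). (x \<circ> ?t, x' \<circ> ?t)) \<mu> = \<mu>" using assms(1) by (simp add: symmetric_def)
  then have "letter_pair_pmf \<mu> i = letter_pair_pmf (map_pmf (\<lambda>(x, x'). (x \<circ> ?t, x' \<circ> ?t)) \<mu>) i" by simp
  also have "\<dots> = letter_pair_pmf \<mu> j"
    unfolding letter_pair_pmf_def by (simp add: map_pmf_comp split_def)
  finally show ?thesis .
qed

lemma product_version_eq:
  assumes "symmetric n \<mu>" "1 \<le> n"
  shows "product_version n \<mu> = Pi_pmf {1..n} undefined (\<lambda>_. letter_pair_pmf \<mu> 1)"
  unfolding product_version_def letter_pair_pmf_def[symmetric]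
proof (rule Pi_pmf_cong)
  fix i assume "i \<in> {1..n}"
  then show "letter_pair_pmf \<mu> i = letter_pair_pmf \<mu> 1"
    using assms(2) by (intro letter_pair_pmf_eq[OF assms(1)]) auto
qed simp_all

lemma pair_freq_eq:
  assumes "symmetric n \<mu>" "1 \<le> n"
  shows "pair_freq n \<mu> a = pmf (letter_pair_pmf \<mu> 1) a"
proof -
  let ?u = "pmf_of_set {1..n}"
  have fin: "finite {1..n}" "{1..n} \<noteq> {}" using assms(2) by auto
  have "map_pmf (\<lambda>((x, y), i). (x i, y i)) (pair_pmf \<mu> ?u) = bind_pmf ?u (letter_pair_pmf \<mu>)"
    unfolding pair_pmf_def letter_pair_pmf_def map_pmf_def
    by (subst bind_commute_pmf) (simp add: bind_assoc_pmf bind_return_pmf split_def)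
  also have "\<dots> = bind_pmf ?u (\<lambda>_. letter_pair_pmf \<mu> 1)"
    using fin assms by (intro bind_pmf_cong refl letter_pair_pmf_eq[OF assms(1)]) (auto simp: set_pmf_of_set)
  finally have "map_pmf (\<lambda>((x, y), i). (x i, y i)) (pair_pmf \<mu> ?u) = letter_pair_pmf \<mu> 1" by (simp add: bind_pmf_const)
  then have "pmf (letter_pair_pmf \<mu> 1) a = measure_pmf.prob (pair_pmf \<mu> ?u) ((\<lambda>((x, y), i). (x i, y i)) -` {a})"
    by (metis pmf_map)
  also have "(\<lambda>((x, y), i). (x i, y i)) -` {a} = {((x, x'), i). x i = fst a \<and> x' i = snd a}" by auto
  finally show ?thesis by (simp add: pair_freq_def)
qed

lemma map_Pi_pmf_restrict:
  fixes n :: nat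
  shows "map_pmf (\<lambda>z. \<lambda>i\<in>{1..n}. f (z i)) (Pi_pmf {1..n} d q) = Pi_pmf {1..n} undefined (\<lambda>i. map_pmf f (q i))"
proof -
  have "Pi_pmf {1..n} undefined (\<lambda>i. map_pmf f (q i)) =
      Pi_pmf {1..n} undefined (\<lambda>i. bind_pmf (q i) (\<lambda>a. return_pmf (f a)))" by (simp add: map_pmf_def)
  also have "\<dots> = bind_pmf (Pi_pmf {1..n} d q) (\<lambda>h. Pi_pmf {1..n} undefined (\<lambda>i. return_pmf (f (h i))))"
    by (rule Pi_pmf_bind) simp
  also have "\<dots> = bind_pmf (Pi_pmf {1..n} d q) (\<lambda>h. return_pmf (\<lambda>i\<in>{1..n}. f (h i)))"
    by (simp add: restrict_def)
  finally show ?thesis by (simp add: map_pmf_def)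
qed

lemma sum_expectation_letter:
  fixes \<mu> :: "((nat \<Rightarrow> nat) \<times> (nat \<Rightarrow> nat)) pmf"
  assumes supp: "set_pmf \<mu> \<subseteq> multislice n m k \<times> multislice n m' k'"
  shows "(\<Sum>i\<in>{1..n}. measure_pmf.expectation \<mu> (\<lambda>w. of_bool (fst w i = c) :: real)) =
    (if c \<in> {1..m} then real (k c) else 0)"
proof -
  have finS: "finite (set_pmf \<mu>)"
    by (rule finite_subset[OF supp]) (simp add: finite_multislice)
  have "(\<Sum>i\<in>{1..n}. measure_pmf.expectation \<mu> (\<lambda>w. of_bool (fst w i = c) :: real)) =
      measure_pmf.expectation \<mu> (\<lambda>w. \<Sum>i\<in>{1..n}. of_bool (fst w i = c) :: real)"
    by (subst Bochner_Integration.integral_sum) (auto intro: integrable_measure_pmf_finite[OF finS])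
  also have "\<dots> = measure_pmf.expectation \<mu> (\<lambda>w. if c \<in> {1..m} then real (k c) else 0)"
  proof (rule integral_cong_AE)
    show "AE w in measure_pmf \<mu>. (\<Sum>i\<in>{1..n}. of_bool (fst w i = c) :: real) = (if c \<in> {1..m} then real (k c) else 0)"
      unfolding AE_measure_pmf_iff
    proof
      fix w assume "w \<in> set_pmf \<mu>"
      then have "fst w \<in> multislice n m k" using supp by auto
      then have w: "fst w \<in> {1..n} \<rightarrow>\<^sub>E {1..m}" "\<forall>j\<in>{1..m}. card {i\<in>{1..n}. fst w i = j} = k j"
        unfolding multislice_def by blast+
      have card: "(\<Sum>i\<in>{1..n}. of_bool (fst w i = c) :: real) = real (card {i\<in>{1..n}. fst w i = c})"
        by (simp add: Int_def)
      show "(\<Sum>i\<in>{1..n}. of_bool (fst w i = c) :: real) = (if c \<in> {1..m} then real (k c) else 0)"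
      proof (cases "c \<in> {1..m}")
        case True
        then show ?thesis unfolding card using w(2) by simp
      next
        case False
        then have "{i\<in>{1..n}. fst w i = c} = {}" using PiE_mem[OF w(1)] by blast
        then show ?thesis unfolding card if_not_P[OF False] by (simp only: card.empty of_nat_0)
      qed
    qed
  qed simp_all
  also have "\<dots> = (if c \<in> {1..m} then real (k c) else 0)" by simp
  finally show ?thesis .
qed

text \<open>Every vector of the multislice has exactly \<open>k c\<close> coordinates with letter
  \<open>c\<close>, and by symmetry they are spread evenly. Hence the components of the product
  version have exactly the laws of the second marginals of the couplings, which is what allows
  gluing along them.\<close>

lemma map_fst_letter_pair_pmf:
  assumes sym: "symmetric n \<mu>" and n: "1 \<le> n" and k: "(\<Sum>j=1..m. k j) = n"
    and supp: "set_pmf \<mu> \<subseteq> multislice n m k \<times> multislice n m' k'"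
  shows "map_pmf fst (letter_pair_pmf \<mu> 1) = freq_pmf n m k"
proof (rule pmf_eqI)
  fix c
  have v: "measure_pmf.expectation \<mu> (\<lambda>w. of_bool (fst w i = c) :: real) = pmf (map_pmf fst (letter_pair_pmf \<mu> 1)) c"
    if "i \<in> {1..n}" for i
  proof -
    have "letter_pair_pmf \<mu> 1 = letter_pair_pmf \<mu> i"
      using that n by (intro letter_pair_pmf_eq[OF sym]) auto
    then have "pmf (map_pmf fst (letter_pair_pmf \<mu> 1)) c = pmf (map_pmf (\<lambda>w. fst w i) \<mu>) c"
      by (simp add: letter_pair_pmf_def map_pmf_comp split_def)
    also have "\<dots> = measure_pmf.expectation \<mu> (\<lambda>w. indicator ((\<lambda>w. fst w i) -` {c}) w)" by (simp add: pmf_map)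
    also have "\<dots> = measure_pmf.expectation \<mu> (\<lambda>w. of_bool (fst w i = c))"
      by (intro arg_cong[where f = "measure_pmf.expectation \<mu>"]) (auto simp: indicator_def fun_eq_iff)
    finally show ?thesis by simp
  qed
  have "real n * pmf (map_pmf fst (letter_pair_pmf \<mu> 1)) c = (if c \<in> {1..m} then real (k c) else 0)"
  proof -
    have "(\<Sum>i\<in>{1..n}. measure_pmf.expectation \<mu> (\<lambda>w. of_bool (fst w i = c) :: real)) =
        (\<Sum>i\<in>{1..n}. pmf (map_pmf fst (letter_pair_pmf \<mu> 1)) c)" by (rule sum.cong[OF refl v])
    then show ?thesis unfolding sum_expectation_letter[OF supp] by simp
  qed
  then show "pmf (map_pmf fst (letter_pair_pmf \<mu> 1)) c = pmf (freq_pmf n m k) c"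
    unfolding pmf_freq_pmf[OF n k] using n by (simp add: field_simps split: if_splits)
qed

lemma symmetric_swap: "symmetric n \<mu> \<Longrightarrow> symmetric n (map_pmf prod.swap \<mu>)"
  unfolding symmetric_def
proof (intro allI impI)
  fix \<pi> assume "\<forall>\<pi>. \<pi> permutes {1..n} \<longrightarrow> map_pmf (\<lambda>(x, x'). (x \<circ> \<pi>, x' \<circ> \<pi>)) \<mu> = \<mu>" "\<pi> permutes {1..n}"
  then have e: "map_pmf (\<lambda>(x, x'). (x \<circ> \<pi>, x' \<circ> \<pi>)) \<mu> = \<mu>" by blast
  have "map_pmf (\<lambda>(x, x'). (x \<circ> \<pi>, x' \<circ> \<pi>)) (map_pmf prod.swap \<mu>) =
      map_pmf prod.swap (map_pmf (\<lambda>(x, x'). (x \<circ> \<pi>, x' \<circ> \<pi>)) \<mu>)"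
    by (simp add: map_pmf_comp split_def prod.swap_def)
  then show "map_pmf (\<lambda>(x, x'). (x \<circ> \<pi>, x' \<circ> \<pi>)) (map_pmf prod.swap \<mu>) = map_pmf prod.swap \<mu>" by (simp only: e)
qed

lemma map_snd_letter_pair_pmf:
  assumes sym: "symmetric n \<mu>" and n: "1 \<le> n" and k: "(\<Sum>j=1..m'. k' j) = n"
    and supp: "set_pmf \<mu> \<subseteq> multislice n m k \<times> multislice n m' k'"
  shows "map_pmf snd (letter_pair_pmf \<mu> 1) = freq_pmf n m' k'"
proof -
  have "map_pmf fst (letter_pair_pmf (map_pmf prod.swap \<mu>) 1) = freq_pmf n m' k'"
    using supp by (intro map_fst_letter_pair_pmf[OF symmetric_swap[OF sym] n k, where m' = m and k' = k]) auto
  then show ?thesis by (simp add: letter_pair_pmf_def map_pmf_comp split_def prod.swap_def)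
qed

section \<open>Gluing the two couplings along the product version\<close>

lemma finite_set_pmf_coupling:
  assumes "finite (set_pmf (map_pmf fst C))" "finite (set_pmf (map_pmf snd C))"
  shows "finite (set_pmf C)"
proof (rule finite_subset)
  show "set_pmf C \<subseteq> set_pmf (map_pmf fst C) \<times> set_pmf (map_pmf snd C)" by force
qed (use assms in simp)

lemma bind_cond_pmf_snd:
  fixes C :: "('a \<times> 'b) pmf"
  shows "bind_pmf (map_pmf snd C) (\<lambda>y. cond_pmf C {p. snd p = y}) = C"
proof (rule bind_cond_pmf_cancel)
  fix y assume "y \<in> set_pmf (map_pmf snd C)"
  then show "set_pmf C \<inter> {p. snd p = y} \<noteq> {}" by auto
next
  fix p assume "p \<in> set_pmf C"
  then show "set_pmf (map_pmf snd C) \<inter> {y. snd p = y} \<noteq> {}" by auto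
next
  fix y and p :: "'a \<times> 'b" assume "snd p = y"
  then have e: "{x. snd p = x} = {y}" "snd -` {y} = {p :: 'a \<times> 'b. snd p = y}" by auto
  show "measure_pmf.prob C {p. snd p = y} = measure_pmf.prob (map_pmf snd C) {x. snd p = x}"
    by (simp only: e measure_map_pmf)
qed

lemma expectation_pair_pmf_mult:
  fixes f :: "'a \<Rightarrow> real" and g :: "'b \<Rightarrow> real"
  assumes "finite (set_pmf p)" "finite (set_pmf q)"
  shows "measure_pmf.expectation (pair_pmf p q) (\<lambda>w. f (fst w) * g (snd w)) =
    measure_pmf.expectation p f * measure_pmf.expectation q g"
proof -
  have "measure_pmf.expectation (pair_pmf p q) (\<lambda>w. f (fst w) * g (snd w)) =
      (\<Sum>w\<in>set_pmf p \<times> set_pmf q. f (fst w) * g (snd w) * pmf (pair_pmf p q) w)"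
    using assms by (intro integral_measure_pmf_real) auto
  also have "\<dots> = (\<Sum>a\<in>set_pmf p. \<Sum>b\<in>set_pmf q. (f a * pmf p a) * (g b * pmf q b))"
    by (subst sum.cartesian_product) (auto simp: pmf_pair intro!: sum.cong)
  also have "\<dots> = (\<Sum>a\<in>set_pmf p. f a * pmf p a) * (\<Sum>b\<in>set_pmf q. g b * pmf q b)" by (simp only: sum_product)
  finally show ?thesis using assms by (simp add: integral_measure_pmf_real[of "set_pmf p"] integral_measure_pmf_real[of "set_pmf q"])
qed

lemma cond_pmf_equivariant:
  assumes sym: "symmetric n C" and \<pi>: "\<pi> permutes {1..n}" and y: "y \<in> set_pmf (map_pmf snd C)"
  shows "cond_pmf C {p. snd p = y \<circ> \<pi>} = map_pmf (\<lambda>(x, x'). (x \<circ> \<pi>, x' \<circ> \<pi>)) (cond_pmf C {p. snd p = y})"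
proof -
  let ?F = "\<lambda>(x, x'). (x \<circ> \<pi>, x' \<circ> \<pi>)"
  have F: "map_pmf ?F C = C" using sym \<pi> by (simp add: symmetric_def)
  have vim: "?F -` {p. snd p = y \<circ> \<pi>} = {p. snd p = y}"
  proof -
    have "x' = y" if "x' \<circ> \<pi> = y \<circ> \<pi>" for x'
    proof -
      have "x' \<circ> \<pi> \<circ> inv \<pi> = y \<circ> \<pi> \<circ> inv \<pi>" using that by simp
      then show ?thesis using permutes_inv_o(1)[OF \<pi>] by (simp add: comp_assoc)
    qed
    then show ?thesis by auto
  qed
  have "cond_pmf (map_pmf ?F C) {p. snd p = y \<circ> \<pi>} = map_pmf ?F (cond_pmf C (?F -` {p. snd p = y \<circ> \<pi>}))"
    by (rule cond_map_pmf) (use y in \<open>auto simp: vim\<close>)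
  then show ?thesis by (simp only: F vim)
qed

lemma fst_vec_comp: "\<pi> permutes {1..n} \<Longrightarrow> fst_vec n (z \<circ> \<pi>) = fst_vec n z \<circ> \<pi>"
  and snd_vec_comp: "\<pi> permutes {1..n} \<Longrightarrow> snd_vec n (z \<circ> \<pi>) = snd_vec n z \<circ> \<pi>"
  using permutes_in_image[of \<pi> "{1..n}"] by (auto simp: fst_vec_def snd_vec_def fun_eq_iff restrict_def)

text \<open>The law of \<open>(x, x')\<close> when \<open>(y, y') = z\<close> is drawn from the product version and \<open>x\<close>, \<open>x'\<close> are then drawn
  from the conditional laws of \<open>C\<close>, \<open>C'\<close>; the form \<open>\<langle>T\<^sub>C f, T\<^sub>C\<^sub>' g\<rangle>\<close> is the expectation of \<open>f(x) g(x')\<close>.\<close>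

definition pullback_kernel :: "nat \<Rightarrow> ((nat \<Rightarrow> nat) \<times> (nat \<Rightarrow> nat)) pmf \<Rightarrow> ((nat \<Rightarrow> nat) \<times> (nat \<Rightarrow> nat)) pmf \<Rightarrow>
    (nat \<Rightarrow> nat \<times> nat) \<Rightarrow> (((nat \<Rightarrow> nat) \<times> (nat \<Rightarrow> nat)) \<times> (nat \<Rightarrow> nat \<times> nat)) pmf" where
  "pullback_kernel n C C' z = map_pmf (\<lambda>w. ((fst (fst w), fst (snd w)), z))
     (pair_pmf (cond_pmf C {p. snd p = fst_vec n z}) (cond_pmf C' {p. snd p = snd_vec n z}))"

text \<open>The assumptions \<open>sndC\<close> and \<open>sndC'\<close> say that the two components
  of a vector with independent letters of law \<open>q\<close> have the second marginals of
  \<open>C\<close> and \<open>C'\<close>, so conditioning on them is meaningful almost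
  surely.\<close>

locale pullback =
  fixes n :: nat and U U' :: "(nat \<Rightarrow> nat) set" and C C' :: "((nat \<Rightarrow> nat) \<times> (nat \<Rightarrow> nat)) pmf"
    and q :: "(nat \<times> nat) pmf" and \<zeta> :: real
  assumes finU: "finite U" and finU': "finite U'" and finC: "finite (set_pmf C)" and finC': "finite (set_pmf C')"
    and finq: "finite (set_pmf q)"
    and fstC: "set_pmf (map_pmf fst C) \<subseteq> U" and fstC': "set_pmf (map_pmf fst C') \<subseteq> U'"
    and sndC: "map_pmf snd C = Pi_pmf {1..n} undefined (\<lambda>_. map_pmf fst q)"
    and sndC': "map_pmf snd C' = Pi_pmf {1..n} undefined (\<lambda>_. map_pmf snd q)"
    and symC: "symmetric n C" and symC': "symmetric n C'"
    and devC: "\<And>i. i \<in> {1..n} \<Longrightarrow> measure_pmf.prob C {(x, y). x i \<noteq> y i} \<le> \<zeta>"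
    and devC': "\<And>i. i \<in> {1..n} \<Longrightarrow> measure_pmf.prob C' {(x, y). x i \<noteq> y i} \<le> \<zeta>"
begin

definition zlaw where "zlaw = Pi_pmf {1..n} (undefined :: nat \<times> nat) (\<lambda>_. q)"
text \<open>The vector \<open>z\<close> is kept next to the pair drawn from it, so that
  \<open>joint\<close> is itself a coupling of the pulled-back law with the product measure.\<close>

definition joint where "joint = bind_pmf zlaw (pullback_kernel n C C')"

lemma fst_vec_zlaw: "map_pmf (fst_vec n) zlaw = map_pmf snd C"
  unfolding sndC zlaw_def fst_vec_def[abs_def] by (rule map_Pi_pmf_restrict)

lemma snd_vec_zlaw: "map_pmf (snd_vec n) zlaw = map_pmf snd C'"
  unfolding sndC' zlaw_def snd_vec_def[abs_def] by (rule map_Pi_pmf_restrict)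

lemma vec_in_support:
  assumes "z \<in> set_pmf zlaw"
  shows "fst_vec n z \<in> set_pmf (map_pmf snd C)" "snd_vec n z \<in> set_pmf (map_pmf snd C')"
  using assms unfolding fst_vec_zlaw[symmetric] snd_vec_zlaw[symmetric] by auto

lemma set_cond:
  assumes "z \<in> set_pmf zlaw"
  shows "set_pmf (cond_pmf C {p. snd p = fst_vec n z}) = set_pmf C \<inter> {p. snd p = fst_vec n z}"
    "set_pmf (cond_pmf C' {p. snd p = snd_vec n z}) = set_pmf C' \<inter> {p. snd p = snd_vec n z}"
  using vec_in_support[OF assms] by (auto intro!: set_cond_pmf)

lemma finite_zlaw: "finite (set_pmf zlaw)"
  unfolding zlaw_def
  by (rule finite_subset[OF set_Pi_pmf_subset'], simp, rule finite_PiE_dflt) (simp_all add: finq)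

lemma finite_kernel: "z \<in> set_pmf zlaw \<Longrightarrow> finite (set_pmf (pullback_kernel n C C' z))"
  using finC finC' by (simp add: pullback_kernel_def set_cond)

lemma finite_joint: "finite (set_pmf joint)"
  unfolding joint_def using finite_zlaw finite_kernel by simp

lemma snd_joint: "map_pmf snd joint = zlaw"
  unfolding joint_def pullback_kernel_def map_bind_pmf by (simp add: map_pmf_comp map_pmf_const bind_return_pmf')

text \<open>After forgetting the second drawn vector, what remains is a vector with the second
  marginal of \<open>C\<close> together with a draw from the conditional law given it, and this is
  \<open>C\<close> again. The deviation bound of \<open>C\<close> therefore carries over to
  \<open>joint\<close>.\<close>

lemma joint_fst: "map_pmf (\<lambda>w. (fst (fst w), fst_vec n (snd w))) joint = C"
proof -
  have "map_pmf (\<lambda>w. (fst (fst w), fst_vec n (snd w))) joint = bind_pmf zlaw (\<lambda>z. cond_pmf C {p. snd p = fst_vec n z})"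
    unfolding joint_def map_bind_pmf
  proof (intro bind_pmf_cong refl)
    fix z assume z: "z \<in> set_pmf zlaw"
    have "map_pmf (\<lambda>w. (fst (fst w), fst_vec n (snd w))) (pullback_kernel n C C' z) =
        map_pmf (\<lambda>p. (fst p, fst_vec n z)) (map_pmf fst (pair_pmf (cond_pmf C {p. snd p = fst_vec n z}) (cond_pmf C' {p. snd p = snd_vec n z})))"
      by (simp add: pullback_kernel_def map_pmf_comp)
    also have "\<dots> = map_pmf (\<lambda>p. p) (cond_pmf C {p. snd p = fst_vec n z})"
      unfolding map_fst_pair_pmf by (rule map_pmf_cong[OF refl]) (use set_cond(1)[OF z] in auto)
    finally show "map_pmf (\<lambda>w. (fst (fst w), fst_vec n (snd w))) (pullback_kernel n C C' z) = cond_pmf C {p. snd p = fst_vec n z}"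
      by simp
  qed
  also have "\<dots> = bind_pmf (map_pmf (fst_vec n) zlaw) (\<lambda>y. cond_pmf C {p. snd p = y})" by (simp add: bind_map_pmf)
  finally show ?thesis by (simp only: fst_vec_zlaw bind_cond_pmf_snd)
qed

lemma joint_snd: "map_pmf (\<lambda>w. (snd (fst w), snd_vec n (snd w))) joint = C'"
proof -
  have "map_pmf (\<lambda>w. (snd (fst w), snd_vec n (snd w))) joint = bind_pmf zlaw (\<lambda>z. cond_pmf C' {p. snd p = snd_vec n z})"
    unfolding joint_def map_bind_pmf
  proof (intro bind_pmf_cong refl)
    fix z assume z: "z \<in> set_pmf zlaw"
    have "map_pmf (\<lambda>w. (snd (fst w), snd_vec n (snd w))) (pullback_kernel n C C' z) =
        map_pmf (\<lambda>p. (fst p, snd_vec n z)) (map_pmf snd (pair_pmf (cond_pmf C {p. snd p = fst_vec n z}) (cond_pmf C' {p. snd p = snd_vec n z})))"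
      by (simp add: pullback_kernel_def map_pmf_comp)
    also have "\<dots> = map_pmf (\<lambda>p. p) (cond_pmf C' {p. snd p = snd_vec n z})"
      unfolding map_snd_pair_pmf by (rule map_pmf_cong[OF refl]) (use set_cond(2)[OF z] in auto)
    finally show "map_pmf (\<lambda>w. (snd (fst w), snd_vec n (snd w))) (pullback_kernel n C C' z) = cond_pmf C' {p. snd p = snd_vec n z}"
      by simp
  qed
  also have "\<dots> = bind_pmf (map_pmf (snd_vec n) zlaw) (\<lambda>y. cond_pmf C' {p. snd p = y})" by (simp add: bind_map_pmf)
  finally show ?thesis by (simp only: snd_vec_zlaw bind_cond_pmf_snd)
qed

lemma joint_support: "set_pmf (map_pmf fst joint) \<subseteq> U \<times> U'"
proof
  fix w assume "w \<in> set_pmf (map_pmf fst joint)"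
  then obtain z where z: "(w, z) \<in> set_pmf joint" by auto
  have "(fst w, fst_vec n z) \<in> set_pmf (map_pmf (\<lambda>w. (fst (fst w), fst_vec n (snd w))) joint)"
    using imageI[OF z, of "\<lambda>w. (fst (fst w), fst_vec n (snd w))"] by simp
  then have "(fst w, fst_vec n z) \<in> set_pmf C" by (simp only: joint_fst)
  from imageI[OF this, of fst] have 1: "fst w \<in> U" using fstC by auto
  have "(snd w, snd_vec n z) \<in> set_pmf (map_pmf (\<lambda>w. (snd (fst w), snd_vec n (snd w))) joint)"
    using imageI[OF z, of "\<lambda>w. (snd (fst w), snd_vec n (snd w))"] by simp
  then have "(snd w, snd_vec n z) \<in> set_pmf C'" by (simp only: joint_snd)
  from imageI[OF this, of fst] have "snd w \<in> U'" using fstC' by auto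
  with 1 show "w \<in> U \<times> U'" by (cases w) auto
qed

lemma joint_dev:
  assumes i: "i \<in> {1..n}"
  shows "measure_pmf.prob joint {w. (fst (fst w) i, snd (fst w) i) \<noteq> snd w i} \<le> 2 * \<zeta>"
proof -
  have 1: "measure_pmf.prob joint {w. fst (fst w) i \<noteq> fst (snd w i)} \<le> \<zeta>"
  proof -
    have "measure_pmf.prob (map_pmf (\<lambda>w. (fst (fst w), fst_vec n (snd w))) joint) {(x, y). x i \<noteq> y i} =
        measure_pmf.prob joint {w. fst (fst w) i \<noteq> fst (snd w i)}"
      using i by (simp add: vimage_def fst_vec_def)
    then show ?thesis using devC[OF i] by (simp only: joint_fst)
  qed
  have 2: "measure_pmf.prob joint {w. snd (fst w) i \<noteq> snd (snd w i)} \<le> \<zeta>"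
  proof -
    have "measure_pmf.prob (map_pmf (\<lambda>w. (snd (fst w), snd_vec n (snd w))) joint) {(x, y). x i \<noteq> y i} =
        measure_pmf.prob joint {w. snd (fst w) i \<noteq> snd (snd w i)}"
      using i by (simp add: vimage_def snd_vec_def)
    then show ?thesis using devC'[OF i] by (simp only: joint_snd)
  qed
  have "{w :: ((nat \<Rightarrow> nat) \<times> (nat \<Rightarrow> nat)) \<times> (nat \<Rightarrow> nat \<times> nat). (fst (fst w) i, snd (fst w) i) \<noteq> snd w i} =
      {w. fst (fst w) i \<noteq> fst (snd w i)} \<union> {w. snd (fst w) i \<noteq> snd (snd w i)}"
    by (auto simp: prod_eq_iff)
  then have "measure_pmf.prob joint {w. (fst (fst w) i, snd (fst w) i) \<noteq> snd w i} \<le>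
      measure_pmf.prob joint {w. fst (fst w) i \<noteq> fst (snd w i)} + measure_pmf.prob joint {w. snd (fst w) i \<noteq> snd (snd w i)}"
    using measure_Un_le[of "{w. fst (fst w) i \<noteq> fst (snd w i)}" joint "{w. snd (fst w) i \<noteq> snd (snd w i)}"] by simp
  then show ?thesis using 1 2 by linarith
qed

lemma symmetric_joint: "symmetric n (map_pmf fst joint)"
  unfolding symmetric_def
proof (intro allI impI)
  fix \<pi> assume \<pi>: "\<pi> permutes {1..n}"
  let ?F = "\<lambda>(x, x'). (x \<circ> \<pi>, x' \<circ> \<pi>)"
  have zl: "zlaw = map_pmf (\<lambda>z. z \<circ> \<pi>) zlaw"
    unfolding zlaw_def using \<pi> permutes_imp_bij[OF \<pi>] permutes_not_in[OF \<pi>]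
    by (intro Pi_pmf_bij_betw) auto
  have ker: "map_pmf (\<lambda>w. (?F (fst w), snd w \<circ> \<pi>)) (pullback_kernel n C C' z) = pullback_kernel n C C' (z \<circ> \<pi>)"
    if z: "z \<in> set_pmf zlaw" for z
  proof -
    have "pullback_kernel n C C' (z \<circ> \<pi>) = map_pmf (\<lambda>w. ((fst (fst w), fst (snd w)), z \<circ> \<pi>))
        (pair_pmf (map_pmf ?F (cond_pmf C {p. snd p = fst_vec n z})) (map_pmf ?F (cond_pmf C' {p. snd p = snd_vec n z})))"
      unfolding pullback_kernel_def fst_vec_comp[OF \<pi>] snd_vec_comp[OF \<pi>]
        cond_pmf_equivariant[OF symC \<pi> vec_in_support(1)[OF z]] cond_pmf_equivariant[OF symC' \<pi> vec_in_support(2)[OF z]] ..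
    also have "\<dots> = map_pmf (\<lambda>w. (?F (fst w), snd w \<circ> \<pi>)) (pullback_kernel n C C' z)"
      unfolding pullback_kernel_def map_pair[symmetric] by (simp add: map_pmf_comp split_def)
    finally show ?thesis by simp
  qed
  have "map_pmf (\<lambda>w. (?F (fst w), snd w \<circ> \<pi>)) joint = bind_pmf zlaw (\<lambda>z. pullback_kernel n C C' (z \<circ> \<pi>))"
    unfolding joint_def map_bind_pmf by (intro bind_pmf_cong refl ker)
  also have "\<dots> = bind_pmf (map_pmf (\<lambda>z. z \<circ> \<pi>) zlaw) (pullback_kernel n C C')" by (simp add: bind_map_pmf)
  also have "\<dots> = joint" unfolding joint_def by (simp only: zl[symmetric])
  finally have "map_pmf fst (map_pmf (\<lambda>w. (?F (fst w), snd w \<circ> \<pi>)) joint) = map_pmf fst joint" by simp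
  then show "map_pmf ?F (map_pmf fst joint) = map_pmf fst joint" by (simp add: map_pmf_comp)
qed

text \<open>Given \<open>z\<close>, the two vectors are drawn independently, so the product of the
  two conditional expectations is the conditional expectation of the product.\<close>

lemma expectation_joint:
  "measure_pmf.expectation zlaw (\<lambda>z. coupling_op C f (fst_vec n z) * coupling_op C' g (snd_vec n z)) =
    measure_pmf.expectation (map_pmf fst joint) (\<lambda>(x, y). f x * g y)"
proof -
  have "measure_pmf.expectation (map_pmf fst joint) (\<lambda>(x, y). f x * g y) =
      measure_pmf.expectation joint (\<lambda>w. f (fst (fst w)) * g (snd (fst w)))" by (simp add: split_def)
  also have "\<dots> = (\<Sum>z\<in>set_pmf zlaw. pmf zlaw z *\<^sub>R measure_pmf.expectation (pullback_kernel n C C' z)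
      (\<lambda>w. f (fst (fst w)) * g (snd (fst w))))"
    unfolding joint_def by (rule pmf_expectation_bind[OF finite_zlaw finite_kernel]) auto
  also have "\<dots> = (\<Sum>z\<in>set_pmf zlaw. (coupling_op C f (fst_vec n z) * coupling_op C' g (snd_vec n z)) * pmf zlaw z)"
  proof (intro sum.cong refl)
    fix z assume z: "z \<in> set_pmf zlaw"
    have "measure_pmf.expectation (pullback_kernel n C C' z) (\<lambda>w. f (fst (fst w)) * g (snd (fst w))) =
        measure_pmf.expectation (pair_pmf (cond_pmf C {p. snd p = fst_vec n z}) (cond_pmf C' {p. snd p = snd_vec n z}))
          (\<lambda>w. f (fst (fst w)) * g (fst (snd w)))"
      by (simp add: pullback_kernel_def)
    also have "\<dots> = coupling_op C f (fst_vec n z) * coupling_op C' g (snd_vec n z)"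
      unfolding coupling_op_def using finC finC'
      by (intro expectation_pair_pmf_mult[of _ _ "\<lambda>p. f (fst p)" "\<lambda>p. g (fst p)"]) (auto simp: set_cond[OF z])
    finally show "pmf zlaw z *\<^sub>R measure_pmf.expectation (pullback_kernel n C C' z) (\<lambda>w. f (fst (fst w)) * g (snd (fst w))) =
        (coupling_op C f (fst_vec n z) * coupling_op C' g (snd_vec n z)) * pmf zlaw z" by simp
  qed
  also have "\<dots> = measure_pmf.expectation zlaw (\<lambda>z. coupling_op C f (fst_vec n z) * coupling_op C' g (snd_vec n z))"
    by (rule integral_measure_pmf_real[OF finite_zlaw, symmetric])
  finally show ?thesis by simp
qed

end

section \<open>Class masses, connectivity of the letters, and the final assembly\<close>

lemma finite_set_freq_pmf:
  assumes "1 \<le> n" "(\<Sum>j=1..m. k j) = n"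
  shows "finite (set_pmf (freq_pmf n m k))"
proof (rule finite_subset)
  show "set_pmf (freq_pmf n m k) \<subseteq> {1..m}"
    using pmf_freq_pmf[OF assms] by (auto simp: set_pmf_iff split: if_splits)
qed simp

lemma finite_set_Pi_pmf: "finite A \<Longrightarrow> (\<And>i. i \<in> A \<Longrightarrow> finite (set_pmf (q i))) \<Longrightarrow> finite (set_pmf (Pi_pmf A d q))"
  by (rule finite_subset[OF set_Pi_pmf_subset'], assumption, rule finite_PiE_dflt) simp_all

lemma is_couplingD:
  assumes "is_coupling n \<alpha> \<zeta> \<nu>\<^sub>1 \<nu>\<^sub>2 C"
  shows "map_pmf fst C = \<nu>\<^sub>1" "map_pmf snd C = \<nu>\<^sub>2" "symmetric n C"
    "\<And>i. i \<in> {1..n} \<Longrightarrow> measure_pmf.prob C {(x, y). x i \<noteq> y i} \<le> \<zeta>"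
  using assms unfolding is_coupling_def by blast+

text \<open>Under the product measure the class of \<open>x\<close> has mass at least
  \<open>\<alpha> ^ card J\<close> by balance. The coupling transfers this to the multislice, with
  an error of at most \<zeta> for every coordinate of \<open>J\<close>.\<close>

lemma junta_class_mass_ge:
  fixes \<alpha> \<zeta> :: real
  assumes C: "is_coupling n \<alpha> \<zeta> (pmf_of_set (multislice n m k)) (Pi_pmf {1..n} undefined (\<lambda>_. freq_pmf n m k)) C"
    and n: "1 \<le> n" and k: "(\<Sum>j=1..m. k j) = n" and bal: "balanced \<alpha> n m k" and \<alpha>: "0 < \<alpha>" "\<alpha> \<le> 1"
    and \<zeta>: "0 \<le> \<zeta>" and J: "J \<subseteq> {1..n}" "card J \<le> d" and x: "x \<in> multislice n m k"
  shows "(\<alpha> ^ d - d * \<zeta>) * card (multislice n m k) \<le> card {y\<in>multislice n m k. \<forall>i\<in>J. y i = x i}"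
proof -
  let ?U = "multislice n m k" and ?\<nu> = "Pi_pmf {1..n} undefined (\<lambda>_. freq_pmf n m k)"
  note CD = is_couplingD[OF C]
  have finJ: "finite J" using J finite_subset by blast
  have fU: "finite ?U" "?U \<noteq> {}" using x finite_multislice by auto
  have finC: "finite (set_pmf C)"
  proof (rule finite_set_pmf_coupling)
    show "finite (set_pmf (map_pmf fst C))" unfolding CD(1) using fU by (simp add: set_pmf_of_set)
    show "finite (set_pmf (map_pmf snd C))" unfolding CD(2)
      using finite_set_freq_pmf[OF n k] by (intro finite_set_Pi_pmf) auto
  qed
  define F where "F y = (of_bool (\<forall>i\<in>J. y i = x i) :: real)" for y :: "nat \<Rightarrow> nat"
  have "\<bar>measure_pmf.expectation (map_pmf fst C) F - measure_pmf.expectation (map_pmf snd C) F\<bar> \<le>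
      1 * measure_pmf.prob C {w. \<exists>i\<in>J. fst w i \<noteq> snd w i}"
    by (rule coupling_expectation_diff_le[OF finC]) (auto simp: F_def)
  also have "\<dots> \<le> card J * \<zeta>"
  proof -
    have "measure_pmf.prob C {w. \<exists>i\<in>J. fst w i \<noteq> snd w i} \<le> card J * \<zeta>"
    proof (rule prob_ex_le[OF finJ])
      fix i assume "i \<in> J"
      then have "measure_pmf.prob C {(x, y). x i \<noteq> y i} \<le> \<zeta>" using CD(4) J(1) by blast
      then show "measure_pmf.prob C {w. fst w i \<noteq> snd w i} \<le> \<zeta>" by (simp add: split_def)
    qed
    then show ?thesis by simp
  qed
  also have "\<dots> \<le> d * \<zeta>" using J(2) \<zeta> by (intro mult_right_mono) auto
  finally have diff: "\<bar>measure_pmf.expectation (pmf_of_set ?U) F - measure_pmf.expectation ?\<nu> F\<bar> \<le> d * \<zeta>"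
    unfolding CD(1,2) .
  have "measure_pmf.expectation (pmf_of_set ?U) F = (\<Sum>y\<in>?U. F y) / card ?U"
    by (rule integral_pmf_of_set[OF fU(2,1)])
  also have "(\<Sum>y\<in>?U. F y) = card {y\<in>?U. \<forall>i\<in>J. y i = x i}"
    unfolding F_def using fU(1) by (simp add: Int_def)
  finally have E1: "measure_pmf.expectation (pmf_of_set ?U) F = card {y\<in>?U. \<forall>i\<in>J. y i = x i} / card ?U" .
  have "\<alpha> ^ d \<le> \<alpha> ^ card J" using \<alpha> J(2) by (intro power_decreasing) auto
  also have "\<dots> = (\<Prod>i\<in>J. \<alpha>)" by simp
  also have "\<dots> \<le> (\<Prod>i\<in>J. pmf (freq_pmf n m k) (x i))"
  proof (rule prod_mono)
    fix i assume "i \<in> J"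
    then have xi: "x i \<in> {1..m}" using x J(1) unfolding multislice_def by blast
    have "\<alpha> * n \<le> k (x i)" using bal xi unfolding balanced_def by blast
    then show "0 \<le> \<alpha> \<and> \<alpha> \<le> pmf (freq_pmf n m k) (x i)"
      unfolding pmf_freq_pmf[OF n k] using xi \<alpha> n by (simp add: pos_le_divide_eq)
  qed
  also have "\<dots> = (\<Prod>i\<in>{1..n}. measure_pmf.prob (freq_pmf n m k) (if i \<in> J then {x i} else UNIV))"
    using J(1) by (intro prod.mono_neutral_cong_left) (auto simp: measure_pmf_single)
  also have "\<dots> = measure_pmf.prob ?\<nu> (Pi {1..n} (\<lambda>i. if i \<in> J then {x i} else UNIV))"
    by (rule measure_Pi_pmf_Pi[symmetric]) simp
  also have "\<dots> = measure_pmf.expectation ?\<nu> F"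
  proof -
    have "indicator (Pi {1..n} (\<lambda>i. if i \<in> J then {x i} else UNIV)) = F"
    proof
      fix y
      have "y \<in> Pi {1..n} (\<lambda>i. if i \<in> J then {x i} else UNIV) \<longleftrightarrow> (\<forall>i\<in>J. y i = x i)"
        using J(1) by (auto simp: Pi_iff split: if_splits)
      then show "indicator (Pi {1..n} (\<lambda>i. if i \<in> J then {x i} else UNIV)) y = F y"
        by (simp add: F_def indicator_def of_bool_def)
    qed
    moreover have "measure_pmf.prob ?\<nu> A = measure_pmf.expectation ?\<nu> (indicator A)" for A by simp
    ultimately show ?thesis by metis
  qed
  finally have "\<alpha> ^ d - d * \<zeta> \<le> card {y\<in>?U. \<forall>i\<in>J. y i = x i} / card ?U"
    using diff unfolding E1 by linarith
  moreover have "real (card ?U) > 0" using fU by (simp add: card_gt_0_iff)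
  ultimately show ?thesis by (simp add: pos_le_divide_eq)
qed

text \<open>A translation from zipped vectors to pairs. Unzipping inverts zipping on the support
  because vectors of a multislice are \<open>undefined\<close> outside
  \<open>{1..n}\<close>.\<close>

lemma coupled_law_of_coupling:
  assumes n: "1 \<le> n" and sym: "symmetric n \<mu>"
    and supp: "set_pmf \<mu> \<subseteq> multislice n m k \<times> multislice n m' k'"
    and C: "is_coupling n \<alpha> \<zeta> (map_pmf (zip_vec n) \<mu>) (product_version n \<mu>) C"
  shows "coupled_law n (multislice n m k) (multislice n m' k') \<mu>
    (map_pmf (\<lambda>w. ((fst_vec n (fst w), snd_vec n (fst w)), snd w)) C) (\<lambda>_. letter_pair_pmf \<mu> 1) undefined \<zeta>"
proof
  note CD = is_couplingD[OF C]
  have finS: "finite (set_pmf \<mu>)" by (rule finite_subset[OF supp]) (simp add: finite_multislice)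
  show "finite (multislice n m k)" "finite (multislice n m' k')" by (rule finite_multislice)+
  have "finite (set_pmf C)"
  proof (rule finite_set_pmf_coupling)
    show "finite (set_pmf (map_pmf fst C))" unfolding CD(1) using finS by simp
    show "finite (set_pmf (map_pmf snd C))" unfolding CD(2) product_version_eq[OF sym n]
      using finS by (intro finite_set_Pi_pmf) (auto simp: letter_pair_pmf_def)
  qed
  then show "finite (set_pmf (map_pmf (\<lambda>w. ((fst_vec n (fst w), snd_vec n (fst w)), snd w)) C))" by simp
  show "set_pmf \<mu> \<subseteq> multislice n m k \<times> multislice n m' k'" by (rule supp)
  have "map_pmf fst (map_pmf (\<lambda>w. ((fst_vec n (fst w), snd_vec n (fst w)), snd w)) C) =
      map_pmf (\<lambda>u. (fst_vec n u, snd_vec n u)) (map_pmf fst C)" by (simp add: map_pmf_comp)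
  also have "\<dots> = map_pmf (\<lambda>w. (fst_vec n (zip_vec n w), snd_vec n (zip_vec n w))) \<mu>"
    unfolding CD(1) by (simp add: map_pmf_comp)
  also have "\<dots> = map_pmf (\<lambda>w. w) \<mu>"
  proof (rule map_pmf_cong[OF refl])
    fix w assume "w \<in> set_pmf \<mu>"
    then have "fst w \<in> multislice n m k" "snd w \<in> multislice n m' k'" using supp by (auto simp: mem_Times_iff)
    then have w: "fst w \<in> {1..n} \<rightarrow>\<^sub>E {1..m}" "snd w \<in> {1..n} \<rightarrow>\<^sub>E {1..m'}"
      unfolding multislice_def by blast+
    have "fst w i = undefined" "snd w i = undefined" if "i \<notin> {1..n}" for i
      using PiE_arb[OF w(1) that] PiE_arb[OF w(2) that] .
    then show "(fst_vec n (zip_vec n w), snd_vec n (zip_vec n w)) = w"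
      by (cases w) (auto simp: fst_vec_def snd_vec_def zip_vec_def fun_eq_iff restrict_def)
  qed
  finally show "map_pmf fst (map_pmf (\<lambda>w. ((fst_vec n (fst w), snd_vec n (fst w)), snd w)) C) = \<mu>" by simp
  show "map_pmf snd (map_pmf (\<lambda>w. ((fst_vec n (fst w), snd_vec n (fst w)), snd w)) C) =
      Pi_pmf {1..n} undefined (\<lambda>_. letter_pair_pmf \<mu> 1)"
    using CD(2) by (simp add: map_pmf_comp product_version_eq[OF sym n])
  fix i assume i: "i \<in> {1..n}"
  have "measure_pmf.prob (map_pmf (\<lambda>w. ((fst_vec n (fst w), snd_vec n (fst w)), snd w)) C)
      {w. (fst (fst w) i, snd (fst w) i) \<noteq> snd w i} = measure_pmf.prob C {(x, y). x i \<noteq> y i}"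
    using i by (simp add: vimage_def fst_vec_def snd_vec_def split_def)
  then show "measure_pmf.prob (map_pmf (\<lambda>w. ((fst_vec n (fst w), snd_vec n (fst w)), snd w)) C)
      {w. (fst (fst w) i, snd (fst w) i) \<noteq> snd w i} \<le> \<zeta>" using CD(4)[OF i] by simp
qed

lemma bipartite_invariant:
  assumes "(u, v) \<in> (bipartite_edges E)\<^sup>*" "\<And>x y. (x, y) \<in> E \<Longrightarrow> S (Inl x) = S (Inr y)"
  shows "S u = S v"
  using assms(1) by induction (auto simp: bipartite_edges_def assms(2))

text \<open>If the letter graph were disconnected, the set of coordinates carrying a letter from one component
  would be constant along the edges between vectors.\<close>

lemma letter_graph_connected:
  assumes "orbit n m U" "orbit n m' U'" and supp: "set_pmf \<mu> \<subseteq> U \<times> U'" and sym: "symmetric n \<mu>"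
    and con: "connected_pmf \<mu>" and n: "1 \<le> n"
    and letters: "\<And>x c. x \<in> U \<Longrightarrow> c \<in> {1..m} \<Longrightarrow> \<exists>i\<in>{1..n}. x i = c"
    and c: "c0 \<in> {1..m}" "c \<in> {1..m}"
  defines "E \<equiv> set_pmf (letter_pair_pmf \<mu> 1)"
  shows "(c0, c) \<in> (E O E\<inverse>) ^^ (2 ^ (m * m))"
proof -
  interpret U: orbit n m U by fact
  interpret U': orbit n m' U' by fact
  define R where "R = E O E\<inverse>"
  have law: "sym_law n U U' (\<lambda>x y. pmf \<mu> (x, y))" by (rule sym_law_of_pmf[OF assms(1-4)])
  \<comment> \<open>The first marginal is uniform by symmetry, so every vector of \<open>U\<close>
    is a vertex of the bipartite graph.\<close>
  have full: "x \<in> set_pmf (map_pmf fst \<mu>)" if "x \<in> U" for x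
  proof (rule ccontr)
    assume "x \<notin> set_pmf (map_pmf fst \<mu>)"
    then have "pmf \<mu> (x, y) = 0" for y by (force simp: set_pmf_iff)
    moreover have "(\<Sum>y\<in>U'. pmf \<mu> (x, y)) = 1 / card U" using law that by (simp add: sym_law_def)
    ultimately show False using U.card_pos by simp
  qed
  have edge: "(x i, y i) \<in> E" if "(x, y) \<in> set_pmf \<mu>" "i \<in> {1..n}" for x y i
  proof -
    have "E = set_pmf (letter_pair_pmf \<mu> i)"
      unfolding E_def using letter_pair_pmf_eq[OF sym, of 1 i] that(2) n by simp
    then show ?thesis using that(1) by (force simp: letter_pair_pmf_def)
  qed
  have Em: "E \<subseteq> {1..m} \<times> {1..m'}"
  proof
    fix e assume "e \<in> E"
    then obtain x y where "(x, y) \<in> set_pmf \<mu>" "e = (x 1, y 1)" by (auto simp: E_def letter_pair_pmf_def)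
    then show "e \<in> {1..m} \<times> {1..m'}" using supp U.letters[of x 1] U'.letters[of y 1] n by auto
  qed
  then have Rm: "R \<subseteq> {1..m} \<times> {1..m}" by (auto simp: R_def)
  obtain x0 where x0: "x0 \<in> U" using U.ne by blast
  \<comment> \<open>One edge at \<open>c0\<close> traversed forth and back; this loop will pad walks
    to a prescribed length.\<close>
  have refl: "(c0, c0) \<in> R"
  proof -
    obtain i where i: "i \<in> {1..n}" "x0 i = c0" using letters[OF x0 c(1)] by blast
    obtain y where "(x0, y) \<in> set_pmf \<mu>" using full[OF x0] by auto
    from edge[OF this i(1)] i(2) show ?thesis by (auto simp: R_def)
  qed
  have reach: "(c0, c) \<in> R\<^sup>*"
  proof (rule ccontr)
    assume nc: "(c0, c) \<notin> R\<^sup>*"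
    define A where "A = {a. (c0, a) \<in> R\<^sup>*}"
    define S :: "(nat \<Rightarrow> nat) + (nat \<Rightarrow> nat) \<Rightarrow> nat set" where
      "S = case_sum (\<lambda>x. {i\<in>{1..n}. x i \<in> A}) (\<lambda>y. {i\<in>{1..n}. y i \<in> E `` A})"
    have inv: "S (Inl x) = S (Inr y)" if xy: "(x, y) \<in> set_pmf \<mu>" for x y
    proof -
      have "x i \<in> A \<longleftrightarrow> y i \<in> E `` A" if i: "i \<in> {1..n}" for i
      proof
        assume "x i \<in> A" then show "y i \<in> E `` A" using edge[OF xy i] by blast
      next
        assume "y i \<in> E `` A"
        then obtain a where a: "a \<in> A" "(a, y i) \<in> E" by blast
        then have "(a, x i) \<in> R" using edge[OF xy i] by (auto simp: R_def)
        then show "x i \<in> A" using a(1) unfolding A_def by (auto intro: rtrancl_into_rtrancl)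
      qed
      then show ?thesis by (auto simp: S_def)
    qed
    have same: "S (Inl x) = S (Inl x')" if "x \<in> U" "x' \<in> U" for x x'
    proof (rule bipartite_invariant[OF _ inv])
      have "Inl x \<in> set_pmf (map_pmf fst \<mu>) <+> set_pmf (map_pmf snd \<mu>)"
        "Inl x' \<in> set_pmf (map_pmf fst \<mu>) <+> set_pmf (map_pmf snd \<mu>)" using full that by (auto simp del: set_map_pmf)
      then show "(Inl x, Inl x') \<in> (bipartite_edges (set_pmf \<mu>))\<^sup>*"
        using con unfolding connected_pmf_def bipartite_connected_def by blast
    qed
    obtain i where i: "i \<in> {1..n}" "x0 i = c0" using letters[OF x0 c(1)] by blast
    obtain j where j: "j \<in> {1..n}" "x0 j = c" using letters[OF x0 c(2)] by blast
    \<comment> \<open>Exchanging a position of \<open>c0\<close> with a position of \<open>c\<close>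
      stays in \<open>U\<close>, but would change the set \<open>S\<close> if exactly one of the two
      letters were reachable.\<close>
    let ?t = "Transposition.transpose i j"
    have "x0 \<circ> ?t \<in> U" by (rule U.closed[OF x0 permutes_swap_id[OF i(1) j(1)]])
    from same[OF x0 this] have "i \<in> S (Inl x0) \<longleftrightarrow> i \<in> S (Inl (x0 \<circ> ?t))" by simp
    then have "c0 \<in> A \<longleftrightarrow> c \<in> A" using i j by (simp add: S_def)
    then show False using nc by (simp add: A_def)
  qed
  \<comment> \<open>A walk can be taken of length at most \<open>card R\<close>, hence at most
    \<open>m * m\<close>, and that is below \<open>2 ^ (m * m)\<close>. The loop at
    \<open>c0\<close> fills it up to exactly this length.\<close>
  have finR: "finite R" using Rm finite_subset by blast
  have cR: "card R \<le> m * m" using card_mono[OF _ Rm] by simp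
  obtain l where l: "l \<le> card R" "(c0, c) \<in> R ^^ l"
    using reach unfolding rtrancl_finite_eq_relpow[OF finR] by blast
  have "l \<le> 2 ^ (m * m)" using l(1) cR less_exp[of "m * m"] by linarith
  moreover have loop: "(c0, c0) \<in> R ^^ r" for r
  proof (induction r)
    case (Suc r) then show ?case using refl by auto
  qed simp
  have "(c0, c) \<in> R ^^ (2 ^ (m * m) - l) O R ^^ l" using loop l(2) by blast
  ultimately show ?thesis unfolding R_def[symmetric] by (simp add: relpow_add[symmetric])
qed

text \<open>The permutation relating \<open>x\<close> and \<open>y\<close> moves only positions
  where \<open>x\<close> has the letter \<open>c\<close>, so it fixes \<open>x\<close>. This makes
  the point mass at \<open>x\<close> a junta on the positions of the other letters.\<close>

lemma (in orbit) determined_by_other_letters: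
  assumes x: "x \<in> U" and y: "y \<in> U" and eq: "\<And>i. i \<in> {1..n} \<Longrightarrow> x i \<noteq> c \<Longrightarrow> y i = x i"
  shows "y = x"
proof -
  define J where "J = {i\<in>{1..n}. x i \<noteq> c}"
  have J: "J \<subseteq> {1..n}" "\<forall>i\<in>J. x i = y i" using eq by (auto simp: J_def)
  obtain \<pi> where \<pi>: "\<pi> permutes {1..n} - J" "y = x \<circ> \<pi>" using transitive[OF x y J] by blast
  have "x (\<pi> i) = x i" for i
  proof (cases "i \<in> {1..n} - J")
    case True
    then have "\<pi> i \<in> {1..n} - J" using permutes_in_image[OF \<pi>(1)] by blast
    then have "x (\<pi> i) = c" "x i = c" using True by (auto simp: J_def)
    then show ?thesis by simp
  next
    case False
    then show ?thesis using permutes_not_in[OF \<pi>(1) False] by simp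
  qed
  then show ?thesis unfolding \<pi>(2) by auto
qed

lemma norm2_eq:
  assumes "finite U" "U \<noteq> {}"
  shows "norm2 U f = sqrt (ip U f f / card U)"
  unfolding norm2_def ip_def integral_pmf_of_set[OF assms(2,1)] by (simp add: power2_eq_square)

lemma coupled_law_mono: "coupled_law n A B \<mu> R Q d t \<Longrightarrow> t \<le> t' \<Longrightarrow> coupled_law n A B \<mu> R Q d t'"
  unfolding coupled_law_def by (meson order_trans)

theorem mainTheorem3:
  fixes \<alpha> \<epsilon> :: real and m m' :: nat
  assumes "0 < \<alpha>" and "\<alpha> < 1" and "0 < \<epsilon>"
  shows "\<exists>\<zeta>>0. \<forall>n\<ge>1. \<forall>(k :: nat \<Rightarrow> nat) (k' :: nat \<Rightarrow> nat)
            (\<mu> :: ((nat \<Rightarrow> nat) \<times> (nat \<Rightarrow> nat)) pmf)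
            (C :: ((nat \<Rightarrow> nat) \<times> (nat \<Rightarrow> nat)) pmf)
            (C' :: ((nat \<Rightarrow> nat) \<times> (nat \<Rightarrow> nat)) pmf).
          (\<Sum>j=1..m. k j) = n \<longrightarrow> (\<Sum>j=1..m'. k' j) = n \<longrightarrow>
          balanced \<alpha> n m k \<longrightarrow> balanced \<alpha> n m' k' \<longrightarrow>
          set_pmf \<mu> \<subseteq> multislice n m k \<times> multislice n m' k' \<longrightarrow>
          connected_pmf \<mu> \<longrightarrow> admissible \<alpha> n \<mu> \<longrightarrow>
          is_coupling n \<alpha> \<zeta> (pmf_of_set (multislice n m k))
            (Pi_pmf {1..n} undefined (\<lambda>_. freq_pmf n m k)) C \<longrightarrow>
          is_coupling n \<alpha> \<zeta> (pmf_of_set (multislice n m' k'))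
            (Pi_pmf {1..n} undefined (\<lambda>_. freq_pmf n m' k')) C' \<longrightarrow>
          (\<exists>C''. is_coupling n \<alpha> \<zeta> (map_pmf (zip_vec n) \<mu>) (product_version n \<mu>) C'') \<longrightarrow>
          (\<forall>(f :: (nat \<Rightarrow> nat) \<Rightarrow> real) (g :: (nat \<Rightarrow> nat) \<Rightarrow> real).
             \<bar>measure_pmf.expectation \<mu> (\<lambda>(x, x'). f x * g x')
               - measure_pmf.expectation (product_version n \<mu>)
                   (\<lambda>z. coupling_op C f (fst_vec n z) * coupling_op C' g (snd_vec n z))\<bar>
             \<le> \<epsilon> * norm2 (multislice n m k) f * norm2 (multislice n m' k') g)"
proof -
  \<comment> \<open>The edge bound is half of the admissibility constant: the other half is left to
    the coupling errors. The balance constant is \<alpha> itself.\<close>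
  have \<alpha>: "0 < \<alpha> / 2" "\<alpha> / 2 \<le> 1" "0 < \<alpha>" "\<alpha> \<le> 1" using assms by auto
  show ?thesis
  proof (rule two_law_comparison[OF \<alpha> assms(3), where m = m and m' = m' and P = "m * m"], goal_cases)
    case (1 d \<tau>\<^sub>0)
    note \<tau>\<^sub>0 = 1(1) and cmp = 1(2)
    \<comment> \<open>Half of the product mass of a class of fewer than \<open>d\<close> coordinates
      is kept; the other half absorbs the error \<open>d * \<zeta>\<close>.\<close>
    define \<rho> where "\<rho> = \<alpha> ^ d / 2"
    \<comment> \<open>The four bounds serve, in this order: the admissible distance
      \<open>4 * \<zeta>\<close> from a product; the loss \<open>4 * \<zeta>\<close> in the
      probability of a letter pair; the low-degree difference \<open>8 * d * \<zeta>\<close>; the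
      class masses.\<close>
    define \<zeta> where "\<zeta> = min (min (\<tau>\<^sub>0 / 4) (\<alpha> / 8)) (min (\<epsilon> * \<rho> / (8 * (real d + 1))) (\<rho> / (real d + 1)))"
    have \<rho>: "0 < \<rho>" using \<alpha> by (simp add: \<rho>_def)
    have \<zeta>: "0 < \<zeta>" using \<rho> \<tau>\<^sub>0 \<alpha> assms(3) by (simp add: \<zeta>_def)
    have z: "\<zeta> \<le> \<tau>\<^sub>0 / 4" "\<zeta> \<le> \<alpha> / 8" "\<zeta> \<le> \<epsilon> * \<rho> / (8 * (real d + 1))" "\<zeta> \<le> \<rho> / (real d + 1)"
      unfolding \<zeta>_def by (meson min.cobounded1 min.cobounded2 order_trans)+
    have \<zeta>1: "4 * \<zeta> \<le> \<tau>\<^sub>0" "4 * \<zeta> \<le> \<alpha> / 2" using z(1,2) by simp_all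
    have \<zeta>2: "8 * d * \<zeta> \<le> \<epsilon> * \<rho>"
    proof -
      have "\<zeta> * (8 * (real d + 1)) \<le> \<epsilon> * \<rho>" using z(3) by (simp add: pos_le_divide_eq)
      then show ?thesis using \<zeta> by (simp add: algebra_simps)
    qed
    have \<zeta>3: "\<rho> \<le> \<alpha> ^ d - d * \<zeta>"
    proof -
      have "\<zeta> * (real d + 1) \<le> \<rho>" using z(4) by (simp add: pos_le_divide_eq)
      then have "d * \<zeta> \<le> \<rho>" using \<zeta> by (simp add: algebra_simps)
      then show ?thesis by (simp add: \<rho>_def)
    qed
    show ?thesis
    proof (intro exI[of _ \<zeta>] conjI \<zeta> allI impI)
      fix n k k' \<mu> C C' f g
      assume n: "1 \<le> n" and k: "(\<Sum>j=1..m. k j) = n" and k': "(\<Sum>j=1..m'. k' j) = n"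
        and bal: "balanced \<alpha> n m k" and bal': "balanced \<alpha> n m' k'"
        and supp: "set_pmf \<mu> \<subseteq> multislice n m k \<times> multislice n m' k'"
        and con: "connected_pmf \<mu>" and adm: "admissible \<alpha> n \<mu>"
        and C: "is_coupling n \<alpha> \<zeta> (pmf_of_set (multislice n m k)) (Pi_pmf {1..n} undefined (\<lambda>_. freq_pmf n m k)) C"
        and C': "is_coupling n \<alpha> \<zeta> (pmf_of_set (multislice n m' k')) (Pi_pmf {1..n} undefined (\<lambda>_. freq_pmf n m' k')) C'"
        and "\<exists>C''. is_coupling n \<alpha> \<zeta> (map_pmf (zip_vec n) \<mu>) (product_version n \<mu>) C''"
      then obtain C'' where C'': "is_coupling n \<alpha> \<zeta> (map_pmf (zip_vec n) \<mu>) (product_version n \<mu>) C''" by blast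
      define U where "U = multislice n m k"
      define U' where "U' = multislice n m' k'"
      define q where "q = letter_pair_pmf \<mu> 1"
      have sym: "symmetric n \<mu>" using adm by (simp add: admissible_def)
      have supp': "set_pmf \<mu> \<subseteq> U \<times> U'" using supp by (simp add: U_def U'_def)
      have ne: "U \<noteq> {}" "U' \<noteq> {}" using supp' set_pmf_not_empty[of \<mu>] by auto
      have o: "orbit n m U" and o': "orbit n m' U'" using ne orbit_multislice by (auto simp: U_def U'_def)
      interpret U: orbit n m U by fact
      interpret U': orbit n m' U' by fact
      \<comment> \<open>The letter 1 plays the part of the fixed letter; it exists because the
        counts sum to a positive number.\<close>
      have m: "1 \<in> {1..m}" using n k by (cases m) auto
      have finq: "finite (set_pmf q)"
        using finite_subset[OF supp'] U.fin U'.fin by (simp add: q_def letter_pair_pmf_def)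
      have freq: "map_pmf fst q = freq_pmf n m k" "map_pmf snd q = freq_pmf n m' k'"
        unfolding q_def using map_fst_letter_pair_pmf[OF sym n k supp] map_snd_letter_pair_pmf[OF sym n k' supp] by auto
      note CD = is_couplingD[OF C] and CD' = is_couplingD[OF C']
      have fstC: "set_pmf (map_pmf fst C) = U" "set_pmf (map_pmf fst C') = U'"
        unfolding CD(1) CD'(1) U_def[symmetric] U'_def[symmetric] using ne U.fin U'.fin by (simp_all add: set_pmf_of_set)
      interpret pullback n U U' C C' q \<zeta>
      proof
        show "finite (set_pmf C)"
        proof (rule finite_set_pmf_coupling)
          show "finite (set_pmf (map_pmf fst C))" unfolding fstC by (rule U.fin)
          show "finite (set_pmf (map_pmf snd C))" unfolding CD(2)
            using finite_set_freq_pmf[OF n k] by (intro finite_set_Pi_pmf) auto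
        qed
        show "finite (set_pmf C')"
        proof (rule finite_set_pmf_coupling)
          show "finite (set_pmf (map_pmf fst C'))" unfolding fstC by (rule U'.fin)
          show "finite (set_pmf (map_pmf snd C'))" unfolding CD'(2)
            using finite_set_freq_pmf[OF n k'] by (intro finite_set_Pi_pmf) auto
        qed
        show "map_pmf snd C = Pi_pmf {1..n} undefined (\<lambda>_. map_pmf fst q)" unfolding freq by (rule CD(2))
        show "map_pmf snd C' = Pi_pmf {1..n} undefined (\<lambda>_. map_pmf snd q)" unfolding freq by (rule CD'(2))
      qed (use U.fin U'.fin finq fstC CD(3,4) CD'(3,4) in auto)
      define \<mu>' where "\<mu>' = map_pmf fst joint"
      have supp2: "set_pmf \<mu>' \<subseteq> U \<times> U'" unfolding \<mu>'_def by (rule joint_support)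
      \<comment> \<open>The coupling of \<mu> with its product version deviates by \<zeta> only; it
        is weakened to \<open>2 * \<zeta>\<close> to match the pulled-back law, which inherits a
        \<zeta> from each of \<open>C\<close> and \<open>C'\<close>.\<close>
      interpret L: coupled_law n U U' \<mu> "map_pmf (\<lambda>w. ((fst_vec n (fst w), snd_vec n (fst w)), snd w)) C''"
        "\<lambda>_. q" undefined "2 * \<zeta>"
        unfolding q_def U_def U'_def
        by (rule coupled_law_mono[OF coupled_law_of_coupling[OF n sym supp C'']]) (use \<zeta> in simp)
      interpret L': coupled_law n U U' \<mu>' joint "\<lambda>_. q" undefined "2 * \<zeta>"
        by unfold_locales (use U.fin U'.fin finite_joint supp2 joint_dev snd_joint in \<open>auto simp: \<mu>'_def zlaw_def\<close>)
      let ?p = "\<lambda>x y. pmf \<mu> (x, y)" and ?p' = "\<lambda>x y. pmf \<mu>' (x, y)"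
      let ?q = "\<lambda>i P. measure_pmf.prob q {(a, b). P a b}"
      have np: "near_product n U U' ?p (4 * \<zeta>) (\<lambda>i. ?q i)" "near_product n U U' ?p' (4 * \<zeta>) (\<lambda>i. ?q i)"
        using L.near_product L'.near_product by simp_all
      have edge: "\<alpha> / 2 \<le> expec U U' p (\<lambda>x y. of_bool (x i = c \<and> y i = b))"
        if cb: "(c, b) \<in> set_pmf q" and i: "i \<in> {1..n}" and np: "near_product n U U' p (4 * \<zeta>) (\<lambda>i. ?q i)" for c b i p
      proof -
        have "pair_freq n \<mu> (c, b) \<noteq> 0" using cb by (simp add: pair_freq_eq[OF sym n] q_def set_pmf_iff)
        then have "\<alpha> \<le> pair_freq n \<mu> (c, b)" using adm unfolding admissible_def by blast
        also have "\<dots> = pmf q (c, b)" by (simp only: pair_freq_eq[OF sym n] q_def)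
        also have "pmf q (c, b) = ?q i (\<lambda>a b'. a = c \<and> b' = b)"
        proof -
          have "{(a, b'). a = c \<and> b' = b} = {(c, b)}" by auto
          then show ?thesis by (simp add: measure_pmf_single)
        qed
        also have "\<dots> \<le> expec U U' p (\<lambda>x y. of_bool (x i = c \<and> y i = b)) + 4 * \<zeta>"
          using np[unfolded near_product_def, THEN conjunct2, THEN conjunct1, rule_format, OF i, of "\<lambda>a b'. a = c \<and> b' = b"]
          by linarith
        finally show ?thesis using \<zeta>1(2) by linarith
      qed
      have cnt: "card {i\<in>{1..n}. x i = c} = k c" if "x \<in> U" "c \<in> {1..m}" for x c
        using that unfolding U_def multislice_def by blast
      have k\<alpha>: "\<alpha> * n \<le> k c" if "c \<in> {1..m}" for c using bal that unfolding balanced_def by blast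
      have kn: "k 1 \<le> n"
      proof -
        obtain x where x: "x \<in> U" using ne(1) by blast
        have "card {i\<in>{1..n}. x i = 1} \<le> card {1..n}" by (rule card_mono) auto
        then show ?thesis unfolding cnt[OF x m] by simp
      qed
      have "\<bar>expec U U' ?p (\<lambda>x y. f x * g y) - expec U U' ?p' (\<lambda>x y. f x * g y)\<bar>
        \<le> \<epsilon> * sqrt (ip U f f / card U) * sqrt (ip U' g g / card U')"
      \<comment> \<open>\<open>e\<close> counts the positions with a letter other than 1. In
        \<open>l\<close>, each of the two laws differs from the product by at most
        \<open>2 * H * G * (card J * (2 * \<zeta>))\<close>, which adds up to the factor 8.\<close>
      proof (rule cmp[where \<tau> = "4 * \<zeta>" and q = "\<lambda>i. ?q i" and E = "set_pmf q" and ?c0.0 = 1 and \<rho> = \<rho> and l = "8 * d * \<zeta>" and e = "n - k 1"])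
        show "sym_law n U U' ?p" by (rule sym_law_of_pmf[OF o o' supp' sym])
        show "sym_law n U U' ?p'" unfolding \<mu>'_def by (rule sym_law_of_pmf[OF o o' joint_support symmetric_joint])
        show "(1, c) \<in> (set_pmf q O (set_pmf q)\<inverse>) ^^ (2 ^ (m * m))" if c: "c \<in> {1..m}" for c
          unfolding q_def
        proof (rule letter_graph_connected[OF o o' supp' sym con n _ m c])
          fix x c assume xc: "x \<in> U" "c \<in> {1..m}"
          have "0 < \<alpha> * n" using \<alpha>(3) n by simp
          then have "0 < real (k c)" using k\<alpha>[OF xc(2)] by linarith
          then have "card {i\<in>{1..n}. x i = c} \<noteq> 0" using cnt[OF xc] by simp
          then have "{i\<in>{1..n}. x i = c} \<noteq> {}" by (metis card.empty)
          then show "\<exists>i\<in>{1..n}. x i = c" by blast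
        qed
        show "\<alpha> * real n \<le> card {i\<in>{1..n}. x i = 1}" if "x \<in> U" for x using cnt[OF that m] k\<alpha>[OF m] by simp
        show "real (n - k 1) \<le> (1 - \<alpha>) * n" using k\<alpha>[OF m] kn by (simp add: of_nat_diff algebra_simps)
        show "\<exists>J\<subseteq>{1..n}. card J \<le> n - k 1 \<and> (\<forall>y\<in>U. (\<forall>i\<in>J. y i = x i) \<longrightarrow> y = x)" if x: "x \<in> U" for x
        proof (intro exI[of _ "{i\<in>{1..n}. x i \<noteq> 1}"] conjI ballI impI)
          have "card ({1..n} - {i\<in>{1..n}. x i = 1}) = card {1..n} - card {i\<in>{1..n}. x i = 1}"
            by (rule card_Diff_subset) auto
          moreover have "{i\<in>{1..n}. x i \<noteq> 1} = {1..n} - {i\<in>{1..n}. x i = 1}" by auto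
          ultimately show "card {i\<in>{1..n}. x i \<noteq> 1} \<le> n - k 1" by (simp only: cnt[OF x m] card_atLeastAtMost)
          fix y assume y: "y \<in> U" and yx: "\<forall>i\<in>{i\<in>{1..n}. x i \<noteq> 1}. y i = x i"
          show "y = x" by (rule U.determined_by_other_letters[OF x y]) (use yx in blast)
        qed auto
        show "\<rho> * card U \<le> card {y\<in>U. \<forall>i\<in>J. y i = x i}" if J: "J \<subseteq> {1..n}" "card J < d" and x: "x \<in> U" for J x
        proof -
          have "(\<alpha> ^ d - d * \<zeta>) * card U \<le> card {y\<in>U. \<forall>i\<in>J. y i = x i}"
            using junta_class_mass_ge[OF C n k bal \<alpha>(3,4) _ J(1), of d x] \<zeta> J(2) x by (simp add: U_def)
          moreover have "\<rho> * card U \<le> (\<alpha> ^ d - d * \<zeta>) * card U" using \<zeta>3 by (intro mult_right_mono) auto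
          ultimately show ?thesis by linarith
        qed
        show "\<rho> * card U' \<le> card {y\<in>U'. \<forall>i\<in>J. y i = x i}" if J: "J \<subseteq> {1..n}" "card J < d" and x: "x \<in> U'" for J x
        proof -
          have "(\<alpha> ^ d - d * \<zeta>) * card U' \<le> card {y\<in>U'. \<forall>i\<in>J. y i = x i}"
            using junta_class_mass_ge[OF C' n k' bal' \<alpha>(3,4) _ J(1), of d x] \<zeta> J(2) x by (simp add: U'_def)
          moreover have "\<rho> * card U' \<le> (\<alpha> ^ d - d * \<zeta>) * card U'" using \<zeta>3 by (intro mult_right_mono) auto
          ultimately show ?thesis by linarith
        qed
        show "\<bar>expec U U' ?p (\<lambda>x y. h x * g y) - expec U U' ?p' (\<lambda>x y. h x * g y)\<bar> \<le> 8 * d * \<zeta> * H * G"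
          if J: "J \<subseteq> {1..n}" "card J < d" and hg: "junta n U J h" "junta n U' J g"
            and H: "\<And>x. x \<in> U \<Longrightarrow> \<bar>h x\<bar> \<le> H" and G: "\<And>x. x \<in> U' \<Longrightarrow> \<bar>g x\<bar> \<le> G" for J h g H G
        proof -
          have HG: "0 \<le> H" "0 \<le> G" using ne H G abs_ge_zero order_trans by blast+
          have "\<bar>expec U U' ?p (\<lambda>x y. h x * g y) - expec U U' ?p' (\<lambda>x y. h x * g y)\<bar> \<le>
              2 * (2 * H * G * (card J * (2 * \<zeta>)))"
            using L.junta_form_diff_le[OF o o' J(1) hg H G] L'.junta_form_diff_le[OF o o' J(1) hg H G] by linarith
          also have "\<dots> \<le> 2 * (2 * H * G * (d * (2 * \<zeta>)))"
            using J(2) HG \<zeta> by (intro mult_left_mono mult_right_mono) auto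
          finally show ?thesis by (simp add: mult_ac)
        qed
      qed (use o o' np edge \<zeta> \<zeta>1 \<zeta>2 \<rho> in auto)
      moreover have "expec U U' ?p (\<lambda>x y. f x * g y) = measure_pmf.expectation \<mu> (\<lambda>(x, x'). f x * g x')"
        by (rule expec_pmf[OF U.fin U'.fin supp'])
      moreover have "expec U U' ?p' (\<lambda>x y. f x * g y) = measure_pmf.expectation (product_version n \<mu>)
          (\<lambda>z. coupling_op C f (fst_vec n z) * coupling_op C' g (snd_vec n z))"
        unfolding product_version_eq[OF sym n] q_def[symmetric] zlaw_def[symmetric] expectation_joint \<mu>'_def[symmetric]
        by (rule expec_pmf[OF U.fin U'.fin supp2])
      ultimately show "\<bar>measure_pmf.expectation \<mu> (\<lambda>(x, x'). f x * g x') - measure_pmf.expectation (product_version n \<mu>)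
          (\<lambda>z. coupling_op C f (fst_vec n z) * coupling_op C' g (snd_vec n z))\<bar>
        \<le> \<epsilon> * norm2 (multislice n m k) f * norm2 (multislice n m' k') g"
        by (simp add: norm2_eq[OF U.fin U.ne, unfolded U_def] norm2_eq[OF U'.fin U'.ne, unfolded U'_def] U_def U'_def)
    qed
  qed
qed

end
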